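(* For every integer $k$ and nonnegative integer $n$, \[ \mathrm{sroots}_k^{B_n}=\sum_{C\in\mathrm{Conj}(B_n):\,C^k=\{w_0\}}\psi^C, \] where $w_0\in B_n$ is given by $w_0(i)=-i$, $C^k=\{x^k:x\in C\}$, and $\mathrm{sroots}_k^{B_n}(y)=\sum_{x\in B_n,\,x^k=y}\chi(x)$.
   Context: $B_n$ is the group of bijections $w$ of $\{\pm1,\dots,\pm n\}$ with $w(-i)=-w(i)$. $\chi$ is the linear character of $B_n$ with $\chi(w)=\prod_{i=1}^n\mathrm{sign}(w(i))$. Cycles: if $c=(a_1,\dots,a_\ell)$ is a cycle of $w$ on $\{\pm1,\dots,\pm n\}$ so is $\bar c$ (negated entries); if $c\ne\bar c$, $c\bar c$ is a cycle of length $\ell$ and $\mathbb Z_2$-class $+1$; if $c=\bar c$, a cycle of length $\ell/2$ and class $-1$. Higher Lie characters $\psi^C$: for $x\in C$ with $a_{i,\varepsilon}$ cycles of length $i$ and class $\varepsilon$, $Z_{B_n}(x)\cong\prod_{i,\varepsilon}G_{i,\varepsilon}\wr S_{a_{i,\varepsilon}}$, where $G_{i,+}\cong\mathbb Z_2\times\mathbb Z_i$ is the centralizer in $B_i$ of one cycle of length $i$ and class $+1$ ($\mathbb Z_2$ generated by $[-1,\dots,-i]$, $\mathbb Z_i$ by the cycle) and $G_{i,-}\cong\mathbb Z_{2i}$ is generated by one cycle of length $i$ and class $-1$. $\omega_{i,+}$ is the linear character of $G_{i,+}\wr S_a$ equal on the base group to the product over factors of (trivial on $\mathbb Z_2$)$\times$(faithful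 linear character of $\mathbb Z_i$) and trivial on the complement $S_a$; $\omega_{i,-}$ is the product over base factors of a faithful linear character of $\mathbb Z_{2i}$, trivial on $S_a$; $\omega^x=\bigotimes\omega_{i,\varepsilon}$ and $\psi^C=\mathrm{Ind}_{Z_{B_n}(x)}^{B_n}\omega^x$. *)

theory Defs
  imports Complex_Main "HOL-Combinatorics.Orbits" "HOL-Algebra.Generated_Groups"
begin

subsection \<open>The group of signed permutations\<close>

definition pm :: "nat \<Rightarrow> int set" where
  "pm n = {i. i \<noteq> 0 \<and> \<bar>i\<bar> \<le> int n}"

text \<open>A signed permutation is extended by the identity outside \<open>\<plusminus>1, \<dots>, \<plusminus>n\<close>.\<close>

definition Bgrp :: "nat \<Rightarrow> (int \<Rightarrow> int) monoid" where
  "Bgrp n = \<lparr>carrier = {w. w permutes pm n \<and> (\<forall>i. w (- i) = - w i)}, mult = (\<circ>), one = id\<rparr>"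

definition w0 :: "nat \<Rightarrow> int \<Rightarrow> int" where
  "w0 n = (\<lambda>i. if i \<in> pm n then - i else i)"

definition chi :: "nat \<Rightarrow> (int \<Rightarrow> int) \<Rightarrow> complex" where
  "chi n w = (\<Prod>i\<in>{1..int n}. of_int (sgn (w i)))"

definition sroots :: "nat \<Rightarrow> int \<Rightarrow> (int \<Rightarrow> int) \<Rightarrow> complex" where
  "sroots n k y = (\<Sum>x\<in>{x \<in> carrier (Bgrp n). x [^]\<^bsub>Bgrp n\<^esub> k = y}. chi n x)"


subsection \<open>Conjugacy classes, centralizers, linear and induced characters\<close>

definition conj_classes :: "('a, 'b) monoid_scheme \<Rightarrow> 'a set set" where
  "conj_classes G = (\<lambda>x. {g \<otimes>\<^bsub>G\<^esub> x \<otimes>\<^bsub>G\<^esub> inv\<^bsub>G\<^esub> g | g. g \<in> carrier G}) ` carrier G"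

definition centralizer :: "('a, 'b) monoid_scheme \<Rightarrow> 'a \<Rightarrow> 'a set" where
  "centralizer G x = {g \<in> carrier G. g \<otimes>\<^bsub>G\<^esub> x = x \<otimes>\<^bsub>G\<^esub> g}"

definition complex_units :: "complex monoid" where
  "complex_units = \<lparr>carrier = - {0}, mult = (*), one = 1\<rparr>"

definition linear_character :: "('a, 'b) monoid_scheme \<Rightarrow> 'a set \<Rightarrow> ('a \<Rightarrow> complex) \<Rightarrow> bool" where
  "linear_character G H \<omega> \<longleftrightarrow> \<omega> \<in> hom (G\<lparr>carrier := H\<rparr>) complex_units"

definition induced_character ::
    "('a, 'b) monoid_scheme \<Rightarrow> 'a set \<Rightarrow> ('a \<Rightarrow> complex) \<Rightarrow> 'a \<Rightarrow> complex" where
  "induced_character G H \<omega> y =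
     (\<Sum>g\<in>{g \<in> carrier G. g \<otimes>\<^bsub>G\<^esub> y \<otimes>\<^bsub>G\<^esub> inv\<^bsub>G\<^esub> g \<in> H}. \<omega> (g \<otimes>\<^bsub>G\<^esub> y \<otimes>\<^bsub>G\<^esub> inv\<^bsub>G\<^esub> g))
       / of_nat (card H)"


subsection \<open>Higher Lie characters\<close>

text \<open>
  \<open>orbit x p\<close> is the set of entries of the cycle \<open>c\<close> of \<open>x\<close> through \<open>p\<close>, and \<open>block x p\<close> is the
  set of entries of \<open>c\<close> and its negation \<open>c'\<close> together.  The signed cycle through \<open>p\<close> (that is,
  \<open>c c'\<close> if the two differ, and \<open>c\<close> if they agree) is \<open>signed_cycle x p\<close>, and it has class \<open>+1\<close>
  iff \<open>c \<noteq> c'\<close>.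
\<close>

definition block :: "(int \<Rightarrow> int) \<Rightarrow> int \<Rightarrow> int set" where
  "block x p = orbit x p \<union> uminus ` orbit x p"

definition signed_cycle :: "(int \<Rightarrow> int) \<Rightarrow> int \<Rightarrow> int \<Rightarrow> int" where
  "signed_cycle x p = perm_restrict x (block x p)"

definition block_negation :: "(int \<Rightarrow> int) \<Rightarrow> int \<Rightarrow> int \<Rightarrow> int" where
  "block_negation x p = perm_restrict uminus (block x p)"

definition positive_cycle :: "(int \<Rightarrow> int) \<Rightarrow> int \<Rightarrow> bool" where
  "positive_cycle x p \<longleftrightarrow> orbit x p \<noteq> uminus ` orbit x p"

text \<open>
  One entry from each signed cycle, i.e. a way of writing each of them starting from a marked
  entry.  Such a choice \<open>P\<close> fixes the identification of the centralizer \<open>Z\<close> of \<open>x\<close> with the product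
  of the wreath products of \<open>G\<^sub>i\<^sub>,\<^sub>\<epsilon>\<close> with the symmetric groups: the base group is generated by the
  signed cycles of \<open>x\<close> and the negations of the blocks of class \<open>+1\<close>; the complement, the product
  of the symmetric groups on the signed cycles of equal length and class, consists of the elements
  of \<open>Z\<close> that map \<open>P\<close> to itself, since commuting with \<open>x\<close> and mapping \<open>p\<close> to \<open>q\<close> means mapping
  each entry of the cycle written from \<open>p\<close> to the corresponding entry of the one written from \<open>q\<close>.
\<close>

definition base_points :: "nat \<Rightarrow> (int \<Rightarrow> int) \<Rightarrow> int set \<Rightarrow> bool" where
  "base_points n x P \<longleftrightarrow> P \<subseteq> pm n \<and> (\<forall>i\<in>pm n. \<exists>!p. p \<in> P \<and> i \<in> block x p)"

definition cycle_complement :: "nat \<Rightarrow> (int \<Rightarrow> int) \<Rightarrow> int set \<Rightarrow> (int \<Rightarrow> int) set" where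
  "cycle_complement n x P = {z \<in> centralizer (Bgrp n) x. z ` P = P}"

text \<open>
  The linear character \<open>\<omega>\<^sup>x\<close>.  That its restrictions to the factors of the base group belonging to
  signed cycles of equal length and class are given by one and the same faithful character is
  automatic, as the complement permutes these factors and \<open>\<omega>\<close> is trivial on it.
\<close>

definition centralizer_character ::
    "nat \<Rightarrow> (int \<Rightarrow> int) \<Rightarrow> int set \<Rightarrow> ((int \<Rightarrow> int) \<Rightarrow> complex) \<Rightarrow> bool" where
  "centralizer_character n x P \<omega> \<longleftrightarrow>
     linear_character (Bgrp n) (centralizer (Bgrp n) x) \<omega> \<and>
     (\<forall>p\<in>P. inj_on \<omega> (generate (Bgrp n) {signed_cycle x p})) \<and>
     (\<forall>p\<in>P. positive_cycle x p \<longrightarrow> \<omega> (block_negation x p) = 1) \<and>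
     (\<forall>z\<in>cycle_complement n x P. \<omega> z = 1)"

text \<open>
  The induced character does not depend on the choice of \<open>x\<close> in \<open>C\<close>, of the base points, and of
  the faithful characters of the cyclic groups.
\<close>

definition higher_Lie_character :: "nat \<Rightarrow> (int \<Rightarrow> int) set \<Rightarrow> (int \<Rightarrow> int) \<Rightarrow> complex" where
  "higher_Lie_character n C =
     (SOME \<psi>. \<exists>x\<in>C. \<exists>P \<omega>. base_points n x P \<and> centralizer_character n x P \<omega> \<and>
        \<psi> = induced_character (Bgrp n) (centralizer (Bgrp n) x) \<omega>)"

end

theory Submission
  imports Defs "HOL-Number_Theory.Cong" "HOL-Algebra.Multiplicative_Group"
begin

text \<open>
  Write \<open>\<omega>\<^sup>x(y)\<close> for the value at \<open>y\<close> of the character attached to \<open>x\<close>.  Unfolding the induced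
  characters, the right-hand side at \<open>y\<close> is the sum of \<open>\<omega>\<^sup>x(y)\<close> over the \<open>x\<close> that commute with \<open>y\<close>
  and satisfy \<open>x\<^sup>k = w\<^sub>0\<close>; all signed cycles of such an \<open>x\<close> have class \<open>-1\<close>.  Both this sum and the sum
  of \<open>\<chi>(x)\<close> over the \<open>k\<close>-th roots \<open>x\<close> of \<open>y\<close> run over elements of the centralizer of \<open>y\<close>, and both summands are
  products of local weights over the orbits of \<open>x\<close>, \<open>y\<close> and negation.  The weights can therefore be
  exchanged one orbit at a time: for a fixed point \<open>p\<close>, multiply \<open>x\<close> on the orbit of \<open>p\<close> under the abelian
  group \<open>K\<close> generated by \<open>y\<close> and negation by the elements of \<open>K\<close>.  If \<open>b\<close> is the first return time of \<open>x\<close>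
  to this orbit, both weights depend only on the \<open>\<kappa> \<in> K\<close> that agrees with \<open>x\<^sup>b\<close> at \<open>p\<close>, and with \<open>k = b q\<close>
  their sums over \<open>K\<close> agree, because the roots of unity \<open>z\<close> with \<open>z\<^sup>a = z\<^sup>q = 1\<close> sum to \<open>1\<close> if \<open>a\<close> and \<open>q\<close> are
  coprime and to \<open>0\<close> otherwise.
\<close>

subsection \<open>Cycles and signed permutations\<close>

text \<open>Shifting \<open>x\<close> by an element of the group K of one orbit keeps it in the
  centralizer of \<open>y\<close> and keeps the partition into orbits; this is why one factor of a
  product can be averaged while the others stay fixed. At \<open>p\<close> the shifted element
  satisfies x^b p = y^t p or x^b p = - y^t p, with t modulo the length a of the
  \<open>y\<close>-cycle. Its phase is a root of unity with exponent gcd t a times an inverse of t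
  or of 2 t, in the sense made precise by \<open>sum_inverse_exponents\<close>; inversion permutes
  residues with the same gcd, so phases can be summed as if their exponent were t. With z the
  corresponding a-th root of unity, x^k = w0 reads z^q = -1 if - p lies on the
  \<open>y\<close>-cycle of p; otherwise it forces the minus sign, odd q and z^q = 1. On the other
  side chi supplies the signs: always -1 in the first case, and in the second a cancellation between
  the two signs when q is even. A separate obstacle is that the characters are given only up to a
  choice of faithful characters and base points. The choice is absorbed by a conjugate of
  \<open>x\<close> with the same centralizer, which leaves only \<open>Lie_product\<close>, an
  expression without base points.\<close>

lemma funpow_eq_iff_cong:
  assumes "permutation x"
  shows "(x ^^ a) i = (x ^^ b) i \<longleftrightarrow> [a = b] (mod card (orbit x i))"
proof -
  define d where "d = funpow_dist1 x i i"
  have self: "i \<in> orbit x i" by (rule permutation_self_in_orbit[OF assms])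
  have inj: "inj_on (\<lambda>n. (x ^^ n) i) {0..<d}"
    unfolding d_def by (rule inj_on_funpow_dist1[OF self])
  have "card (orbit x i) = d"
    using orbit_conv_funpow_dist1[OF self] card_image[OF inj] unfolding d_def by simp
  moreover have per: "(x ^^ d) i = i" unfolding d_def by (rule funpow_dist1_prop[OF self])
  have md: "(x ^^ m) i = (x ^^ (m mod d)) i" for m using funpow_mod_eq[OF per, of m] by simp
  have "d > 0" by (simp add: d_def)
  then have "(x ^^ a) i = (x ^^ b) i \<longleftrightarrow> a mod d = b mod d"
    using inj_on_eq_iff[OF inj, of "a mod d" "b mod d"] by (simp add: md[of a] md[of b])
  ultimately show ?thesis by (simp add: cong_def)
qed

lemma funpow_eq_self_iff:
  assumes "permutation x"
  shows "(x ^^ a) i = i \<longleftrightarrow> card (orbit x i) dvd a"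
  using funpow_eq_iff_cong[OF assms, of a i 0] by (simp add: cong_0_iff)

lemma card_orbit_pos:
  assumes "permutation x" shows "0 < card (orbit x i)"
  by (meson assms card_gt_0_iff finite_orbit orbit_nonempty permutation_self_in_orbit)

lemma in_orbit_iff:
  assumes "permutation x" shows "j \<in> orbit x i \<longleftrightarrow> (\<exists>a. j = (x ^^ a) i)"
  using orbit_altdef_permutation[OF assms] by blast

lemma orbit_eq_of_mem:
  assumes "permutation x" "j \<in> orbit x i" shows "orbit x j = orbit x i"
  by (metis assms cyclic_on_alldef cyclic_on_orbit')

lemma funpow_commute:
  assumes "z \<circ> x = x \<circ> z" shows "z ((x ^^ a) i) = (x ^^ a) (z i)"
proof (induction a)
  case (Suc a)
  then show ?case using fun_cong[OF assms, of "(x ^^ a) i"] by simp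
qed simp

lemma funpow_commute2:
  assumes "z \<circ> x = x \<circ> z" shows "(z ^^ b) ((x ^^ a) i) = (x ^^ a) ((z ^^ b) i)"
  by (induction b) (simp_all add: funpow_commute[OF assms])

lemma orbit_commute_image:
  assumes "permutation x" "z \<circ> x = x \<circ> z" shows "orbit x (z i) = z ` orbit x i"
  unfolding orbit_altdef_permutation[OF assms(1)] by (auto simp flip: funpow_commute[OF assms(2)])

lemma card_orbit_commute:
  assumes "permutation x" "inj z" "z \<circ> x = x \<circ> z"
  shows "card (orbit x (z i)) = card (orbit x i)"
  unfolding orbit_commute_image[OF assms(1,3)]
  by (rule card_image) (meson assms(2) inj_on_subset subset_UNIV)

text \<open>The product of the orbit lengths over the finite support is a common period. It serves
  to guarantee return times and to write inverses as nonnegative powers.\<close>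

lemma permutation_period:
  fixes x :: "'a \<Rightarrow> 'a"
  assumes "permutation x"
  obtains N where "N > 0" "x ^^ N = id"
proof -
  define S where "S = {i. x i \<noteq> i}"
  have fin: "finite S" using assms by (simp add: S_def permutation)
  define N where "N = (\<Prod>i\<in>S. card (orbit x i))"
  have "N > 0" unfolding N_def using card_orbit_pos[OF assms] by (simp add: prod_pos)
  moreover have "(x ^^ N) i = i" for i
  proof (cases "i \<in> S")
    case True
    then show ?thesis
      unfolding funpow_eq_self_iff[OF assms] N_def by (rule dvd_prodI[OF fin])
  next
    case False
    then have "x i = i" by (simp add: S_def)
    then show ?thesis by (induction N) auto
  qed
  ultimately show ?thesis using that[of N] by (auto simp: fun_eq_iff)
qed

section \<open>Signed permutations as a finite group under composition\<close>

lemma finite_pm [simp]: "finite (pm n)"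
proof -
  have "pm n \<subseteq> {- int n..int n}" by (auto simp: pm_def)
  then show ?thesis using finite_subset by blast
qed

lemma uminus_in_pm [simp]: "- i \<in> pm n \<longleftrightarrow> i \<in> pm n"
  by (auto simp: pm_def)

lemma Bgrp_iff: "w \<in> carrier (Bgrp n) \<longleftrightarrow> w permutes pm n \<and> (\<forall>i. w (- i) = - w i)"
  by (simp add: Bgrp_def)

lemma Bgrp_mult [simp]: "x \<otimes>\<^bsub>Bgrp n\<^esub> y = x \<circ> y"
  and Bgrp_one [simp]: "\<one>\<^bsub>Bgrp n\<^esub> = id"
  by (simp_all add: Bgrp_def)

lemma Bgrp_permutes: "w \<in> carrier (Bgrp n) \<Longrightarrow> w permutes pm n"
  and Bgrp_odd: "w \<in> carrier (Bgrp n) \<Longrightarrow> w (- i) = - w i"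
  by (simp_all add: Bgrp_iff)

lemma Bgrp_permutation: "w \<in> carrier (Bgrp n) \<Longrightarrow> permutation w"
  using Bgrp_permutes permutation_permutes finite_pm by blast

lemma Bgrp_in_pm: "w \<in> carrier (Bgrp n) \<Longrightarrow> w i \<in> pm n \<longleftrightarrow> i \<in> pm n"
  using Bgrp_permutes permutes_in_image by fastforce

lemma Bgrp_inj: "w \<in> carrier (Bgrp n) \<Longrightarrow> inj w"
  using Bgrp_permutes permutes_inj by blast

lemma Bgrp_outside: "w \<in> carrier (Bgrp n) \<Longrightarrow> i \<notin> pm n \<Longrightarrow> w i = i"
  using Bgrp_permutes permutes_not_in by fastforce

lemma Bgrp_compose:
  assumes "x \<in> carrier (Bgrp n)" "y \<in> carrier (Bgrp n)" shows "x \<circ> y \<in> carrier (Bgrp n)"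
  using assms by (simp add: Bgrp_iff permutes_compose)

lemma Bgrp_inverse:
  assumes "x \<in> carrier (Bgrp n)" shows "Hilbert_Choice.inv x \<in> carrier (Bgrp n)"
proof -
  have p: "x permutes pm n" using assms by (simp add: Bgrp_iff)
  have "Hilbert_Choice.inv x (- i) = - Hilbert_Choice.inv x i" for i
    using permutes_inv_eq[OF p, of "-i" "- Hilbert_Choice.inv x i"] Bgrp_odd[OF assms] permutes_inverses[OF p] by simp
  then show ?thesis using permutes_inv[OF p] by (simp add: Bgrp_iff)
qed

lemma group_Bgrp: "group (Bgrp n)"
proof (rule groupI)
  fix x assume x: "x \<in> carrier (Bgrp n)"
  then have "Hilbert_Choice.inv x \<otimes>\<^bsub>Bgrp n\<^esub> x = \<one>\<^bsub>Bgrp n\<^esub>"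
    using permutes_inv_o[OF Bgrp_permutes[OF x]] by simp
  then show "\<exists>y\<in>carrier (Bgrp n). y \<otimes>\<^bsub>Bgrp n\<^esub> x = \<one>\<^bsub>Bgrp n\<^esub>"
    using Bgrp_inverse[OF x] by blast
qed (auto simp: Bgrp_compose o_assoc, auto simp: Bgrp_iff permutes_id)

lemma Bgrp_inv [simp]: "x \<in> carrier (Bgrp n) \<Longrightarrow> inv\<^bsub>Bgrp n\<^esub> x = Hilbert_Choice.inv x"
  by (rule group.inv_equality[OF group_Bgrp])
    (auto simp: Bgrp_inverse permutes_inv_o[OF Bgrp_permutes])

lemma finite_Bgrp: "finite (carrier (Bgrp n))"
  by (rule finite_subset[OF _ finite_permutations[OF finite_pm[of n]]]) (auto simp: Bgrp_iff)

lemma Bgrp_nat_pow: "x [^]\<^bsub>Bgrp n\<^esub> (m :: nat) = x ^^ m"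
  by (induction m) (simp_all add: nat_pow_0 nat_pow_Suc funpow_Suc_right del: funpow.simps(2))

lemma Bgrp_id: "id \<in> carrier (Bgrp n)"
  by (simp add: Bgrp_iff permutes_id)

lemma Bgrp_funpow: "x \<in> carrier (Bgrp n) \<Longrightarrow> x ^^ m \<in> carrier (Bgrp n)"
  by (induction m) (auto simp: Bgrp_id Bgrp_compose)

text \<open>Exponents matter only modulo the group order, so a possibly negative \<open>k\<close> is
  traded for an iteration count; adding the order once more keeps it positive when the order divides
  \<open>k\<close>.\<close>

lemma Bgrp_int_pow:
  fixes k :: int
  obtains m :: nat where "m > 0" "\<And>x. x \<in> carrier (Bgrp n) \<Longrightarrow> x [^]\<^bsub>Bgrp n\<^esub> k = x ^^ m"
proof
  interpret group "Bgrp n" by (rule group_Bgrp)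
  define N where "N = order (Bgrp n)"
  define m where "m = nat (k mod int N) + N"
  have N: "N > 0" using finite_Bgrp by (simp add: N_def order_gt_0_iff_finite)
  then show "m > 0" by (simp add: m_def)
  have km: "k = int m + int N * (k div int N - 1)"
    using N by (simp add: m_def algebra_simps)
  fix x assume x: "x \<in> carrier (Bgrp n)"
  have "x [^]\<^bsub>Bgrp n\<^esub> k = x [^]\<^bsub>Bgrp n\<^esub> int m \<otimes>\<^bsub>Bgrp n\<^esub> (x [^]\<^bsub>Bgrp n\<^esub> int N) [^]\<^bsub>Bgrp n\<^esub> (k div int N - 1)"
    using x by (subst km) (simp only: int_pow_mult int_pow_pow)
  also have "x [^]\<^bsub>Bgrp n\<^esub> int N = \<one>\<^bsub>Bgrp n\<^esub>"
    using pow_order_eq_1[OF x] by (simp add: int_pow_int N_def)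
  also have "x [^]\<^bsub>Bgrp n\<^esub> int m \<otimes>\<^bsub>Bgrp n\<^esub> \<one>\<^bsub>Bgrp n\<^esub> [^]\<^bsub>Bgrp n\<^esub> (k div int N - 1) = x [^]\<^bsub>Bgrp n\<^esub> int m"
    using x by (simp only: int_pow_one r_one int_pow_closed)
  finally show "x [^]\<^bsub>Bgrp n\<^esub> k = x ^^ m" by (simp add: int_pow_int Bgrp_nat_pow)
qed

lemma w0_in_Bgrp: "w0 n \<in> carrier (Bgrp n)"
  unfolding Bgrp_iff
proof
  show "w0 n permutes pm n"
    by (rule bij_imp_permutes) (auto simp: w0_def intro!: bij_betwI[where g = uminus])
qed (auto simp: w0_def)

lemma in_centralizer_iff:
  "z \<in> centralizer (Bgrp n) x \<longleftrightarrow> z \<in> carrier (Bgrp n) \<and> z \<circ> x = x \<circ> z"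
  by (simp add: centralizer_def)

subsection \<open>Sums of roots of unity\<close>

definition unit_root :: "nat \<Rightarrow> complex" where
  "unit_root a = cis (2 * pi / real a)"

lemma root_pow: "unit_root a ^ t = cis (2 * pi * real t / real a)"
  by (simp add: unit_root_def DeMoivre mult_ac)

lemma root_pow_self: "a > 0 \<Longrightarrow> unit_root a ^ a = 1"
  by (simp add: root_pow)

lemma root_pow_cong:
  assumes "[s = t] (mod a)" shows "unit_root a ^ s = unit_root a ^ t"
proof (cases "a = 0")
  case True
  then show ?thesis using assms by (simp add: cong_def)
next
  case False
  have "unit_root a ^ m = unit_root a ^ (m mod a)" for m
  proof -
    have "unit_root a ^ m = unit_root a ^ (a * (m div a) + m mod a)" by simp
    also have "\<dots> = unit_root a ^ (m mod a)"
      using False by (simp only: power_add power_mult root_pow_self) simp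
    finally show ?thesis .
  qed
  then show ?thesis using assms by (metis cong_def)
qed

lemma root_pow_scale:
  assumes "c > 0" shows "unit_root (c * a) ^ (c * t) = unit_root a ^ t"
  using assms by (simp add: root_pow mult_ac)

lemma bij_betw_root_pow: "a > 0 \<Longrightarrow> bij_betw (\<lambda>t. unit_root a ^ t) {..<a} {z. z ^ a = 1}"
  using bij_betw_roots_unity[of a] by (simp add: root_pow)

lemma root_pow_eq_1_iff:
  assumes "a > 0" shows "unit_root a ^ t = 1 \<longleftrightarrow> a dvd t"
proof -
  have "unit_root a ^ t = unit_root a ^ (t mod a)" by (rule root_pow_cong) (simp add: cong_def)
  moreover have "unit_root a ^ (t mod a) = unit_root a ^ 0 \<longleftrightarrow> t mod a = 0"
    using bij_betw_root_pow[OF assms] assms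
    by (intro inj_on_eq_iff) (auto simp: bij_betw_def)
  ultimately show ?thesis by (simp add: dvd_eq_mod_eq_0)
qed

lemma root_pow_eq_iff:
  assumes "a > 0" shows "unit_root a ^ s = unit_root a ^ t \<longleftrightarrow> [s = t] (mod a)"
proof -
  have "unit_root a ^ m = unit_root a ^ (m mod a)" for m by (rule root_pow_cong) (simp add: cong_def)
  moreover have "unit_root a ^ (s mod a) = unit_root a ^ (t mod a) \<longleftrightarrow> s mod a = t mod a"
    using bij_betw_root_pow[OF assms] assms
    by (intro inj_on_eq_iff) (auto simp: bij_betw_def)
  ultimately show ?thesis by (metis cong_def)
qed

text \<open>Bezout: the gcd is a difference a u - q v of multiples, so z to the gcd is a quotient of
  two powers equal to 1.\<close>

lemma power_gcd_eq_1_iff: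
  fixes z :: complex
  assumes "a > 0"
  shows "z ^ gcd a q = 1 \<longleftrightarrow> z ^ a = 1 \<and> z ^ q = 1"
proof
  assume z: "z ^ gcd a q = 1"
  have "z ^ m = 1" if d: "gcd a q dvd m" for m
  proof -
    obtain c where "m = gcd a q * c" using d by (auto simp: dvd_def)
    then show ?thesis by (simp only: power_mult z power_one)
  qed
  then show "z ^ a = 1 \<and> z ^ q = 1" by simp
next
  assume z: "z ^ a = 1 \<and> z ^ q = 1"
  obtain u v where uv: "a * u = q * v + gcd a q" using bezout_nat[of a q] assms by auto
  have "z ^ (a * u) = z ^ (q * v) * z ^ gcd a q" by (simp only: uv power_add)
  then show "z ^ gcd a q = 1" using z by (simp add: power_mult)
qed

text \<open>Substituting z = \<open>unit_root a ^ t\<close> turns the divisibility into z^q = 1, so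
  the sum runs over all roots of unity of order dividing gcd a q.\<close>

lemma sum_root_dvd:
  assumes "a > 0"
  shows "(\<Sum>t | t < a \<and> a dvd t * q. unit_root a ^ t) = (if gcd a q = 1 then 1 else 0)"
proof -
  have "(\<Sum>t | t < a \<and> a dvd t * q. unit_root a ^ t) = \<Sum>{z. z ^ gcd a q = 1}"
  proof (rule sum.reindex_bij_betw)
    have "inj_on (\<lambda>t. unit_root a ^ t) {..<a}" using bij_betw_root_pow[OF assms] by (simp add: bij_betw_def)
    moreover have "(\<lambda>t. unit_root a ^ t) ` {t. t < a \<and> a dvd t * q} = {z. z ^ gcd a q = 1}"
    proof (intro Set.set_eqI iffI)
      fix z assume "z \<in> (\<lambda>t. unit_root a ^ t) ` {t. t < a \<and> a dvd t * q}"
      then obtain t where t: "z = unit_root a ^ t" "t < a" "a dvd t * q" by blast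
      have "z ^ q = 1" unfolding t(1) power_mult[symmetric] root_pow_eq_1_iff[OF assms] by (rule t(3))
      moreover have "z ^ a = 1" unfolding t(1) power_mult[symmetric] root_pow_eq_1_iff[OF assms] by simp
      ultimately show "z \<in> {z. z ^ gcd a q = 1}" by (simp add: power_gcd_eq_1_iff[OF assms])
    next
      fix z :: complex assume "z \<in> {z. z ^ gcd a q = 1}"
      then have z: "z ^ a = 1" "z ^ q = 1" by (simp_all add: power_gcd_eq_1_iff[OF assms])
      then obtain t where t: "t < a" "z = unit_root a ^ t"
        using bij_betw_root_pow[OF assms] by (auto simp: bij_betw_def image_iff set_eq_iff)
      have "a dvd t * q"
        using z(2) unfolding t(2) power_mult[symmetric] root_pow_eq_1_iff[OF assms] .
      then show "z \<in> (\<lambda>t. unit_root a ^ t) ` {t. t < a \<and> a dvd t * q}" using t by blast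
    qed
    ultimately show "bij_betw (\<lambda>t. unit_root a ^ t) {t. t < a \<and> a dvd t * q} {z. z ^ gcd a q = 1}"
      unfolding bij_betw_def by (auto elim: inj_on_subset)
  qed
  also have "\<dots> = (if gcd a q = 1 then 1 else 0)"
    using sum_roots_unity[of "gcd a q"] assms by (cases "gcd a q > 1") (auto simp: not_less le_Suc_eq)
  finally show ?thesis .
qed

text \<open>The left side sees \<open>t\<close> only through its gcd with \<open>a\<close>, which is
  the invariance that \<open>sum_inverse_exponents\<close> asks of its predicate.\<close>

lemma dvd_gcd_mult_iff: "(a :: nat) dvd gcd t a * q \<longleftrightarrow> a dvd t * q"
  by (metis dvd_triv_left gcd_greatest_iff gcd_mult_distrib_nat mult.commute)

lemma cong_mult_factor_iff:
  assumes "(g :: nat) > 0"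
  shows "[g * s = g * t] (mod (g * e)) \<longleftrightarrow> [s = t] (mod e)"
proof -
  have "g * s mod (g * e) = g * (s mod e)" "g * t mod (g * e) = g * (t mod e)"
    by (rule mult_mod_right[symmetric])+
  then show ?thesis using assms by (simp only: cong_def mult_cancel1) simp
qed

text \<open>Up to the factor \<open>gcd t a\<close>, the exponent \<open>u\<close> is an inverse of \<open>c * t\<close>; inversion only
  permutes the residues with a given gcd with \<open>a\<close>.\<close>

lemma sum_inverse_exponents:
  fixes f :: "nat \<Rightarrow> complex"
  assumes a: "a > 0"
    and P: "\<And>s t. s < a \<Longrightarrow> t < a \<Longrightarrow> gcd s a = gcd t a \<Longrightarrow> P s \<longleftrightarrow> P t"
    and f: "\<And>t. t < a \<Longrightarrow> P t \<Longrightarrow> \<exists>u. [c * t * u = gcd t a] (mod a) \<and> f t = unit_root a ^ (gcd t a * u)"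
  shows "(\<Sum>t | t < a \<and> P t. f t) = (\<Sum>t | t < a \<and> P t. unit_root a ^ t)"
proof -
  let ?S = "{t. t < a \<and> P t}"
  obtain u where u: "\<And>t. t \<in> ?S \<Longrightarrow> [c * t * u t = gcd t a] (mod a) \<and> f t = unit_root a ^ (gcd t a * u t)"
    using f by (metis (mono_tags, lifting) mem_Collect_eq)
  define h where "h t = (gcd t a * u t) mod a" for t
  \<comment> \<open>Cancelling the gcd makes \<open>u t\<close> a unit modulo
    \<open>a div gcd t a\<close>; hence \<open>h\<close> preserves the gcd with \<open>a\<close>,
    and with it the index set.\<close>
  have unit: "[c * (t div gcd t a) * u t = 1] (mod (a div gcd t a))" if "t \<in> ?S" for t
  proof -
    let ?g = "gcd t a"
    have g: "?g > 0" using a by simp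
    have "[?g * (c * (t div ?g) * u t) = ?g * 1] (mod (?g * (a div ?g)))"
    proof -
      have "?g * (c * (t div ?g) * u t) = c * (?g * (t div ?g)) * u t" by (simp only: ac_simps)
      also have "\<dots> = c * t * u t" by simp
      finally have "?g * (c * (t div ?g) * u t) = c * t * u t" .
      moreover have "?g * (a div ?g) = a" by simp
      ultimately show ?thesis using u[OF that] by (simp only: mult_1_right)
    qed
    then show ?thesis by (simp only: cong_mult_factor_iff[OF g])
  qed
  have gcd_h: "gcd (h t) a = gcd t a" if "t \<in> ?S" for t
  proof -
    let ?g = "gcd t a"
    have "coprime (u t) (a div ?g)"
      using unit[OF that] unfolding coprime_iff_invertible_nat
      by (intro exI[of _ "c * (t div ?g)"]) (simp add: ac_simps)
    then have "gcd (u t) (a div ?g) = 1" by simp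
    then have "gcd (?g * u t) (?g * (a div ?g)) = ?g" by (metis gcd_mult_distrib_nat mult.right_neutral)
    then show ?thesis using a by (simp add: h_def)
  qed
  have hS: "h t \<in> ?S" if "t \<in> ?S" for t
    using gcd_h[OF that] that P[of "h t" t] a by (simp add: h_def)
  have inj: "inj_on h ?S"
  proof (rule inj_onI)
    fix s t assume st: "s \<in> ?S" "t \<in> ?S" "h s = h t"
    let ?g = "gcd t a"
    have gs: "gcd s a = ?g" using gcd_h[OF st(1)] gcd_h[OF st(2)] st(3) by simp
    have g: "?g > 0" using a by simp
    have "[?g * u s = ?g * u t] (mod (?g * (a div ?g)))"
      using st(3) gs by (simp add: h_def cong_def)
    then have us: "[u s = u t] (mod (a div ?g))"
      by (simp only: cong_mult_factor_iff[OF g])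
    \<comment> \<open>Write s', t' for the quotients by the common gcd. Inserting one inverse and
      then removing the other gives s' = s' c t' u(t) = s' c t' u(s) = t' modulo
      \<open>a div ?g\<close>, because u(s) = u(t) there.\<close>
    have "[s div ?g = (s div ?g) * (c * (t div ?g) * u t)] (mod (a div ?g))"
      using cong_scalar_left[OF unit[OF st(2)], of "s div ?g"] by (simp add: cong_sym)
    also have "[(s div ?g) * (c * (t div ?g) * u t) = (s div ?g) * (c * (t div ?g) * u s)] (mod (a div ?g))"
      by (intro cong_mult cong_refl cong_sym[OF us])
    also have "(s div ?g) * (c * (t div ?g) * u s) = (t div ?g) * (c * (s div ?g) * u s)"
      by (simp only: ac_simps)
    also have "[(t div ?g) * (c * (s div ?g) * u s) = (t div ?g) * 1] (mod (a div ?g))"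
      using unit[OF st(1)] unfolding gs by (rule cong_scalar_left)
    finally have "[s div ?g = t div ?g] (mod (a div ?g))" by simp
    moreover have "s div ?g < a div ?g" "t div ?g < a div ?g"
      using st g by (auto intro!: less_mult_imp_div_less)
    ultimately have "s div ?g = t div ?g" by (simp add: cong_def)
    then show "s = t" by (metis gs dvd_mult_div_cancel gcd_dvd1)
  qed
  have fin: "finite ?S" by simp
  have "h ` ?S = ?S" using hS inj by (intro endo_inj_surj[OF fin]) auto
  then have bij: "bij_betw h ?S ?S" using inj by (simp add: bij_betw_def)
  have "f t = unit_root a ^ h t" if "t \<in> ?S" for t
    using u[OF that] root_pow_cong[of "gcd t a * u t" "h t" a] by (simp add: h_def cong_def)
  then have "sum f ?S = (\<Sum>t\<in>?S. unit_root a ^ h t)" by (intro sum.cong) auto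
  also have "\<dots> = (\<Sum>t\<in>?S. unit_root a ^ t)" by (rule sum.reindex_bij_betw[OF bij])
  finally show ?thesis .
qed

text \<open>In terms of w = \<open>unit_root a ^ (t * q)\<close>, the left side says w = -1 and the
  right side says that w^2 = 1 while w is not 1.\<close>

lemma cong_half_iff:
  fixes a t q :: nat
  assumes "a > 0" "even a"
  shows "[t * q = a div 2] (mod a) \<longleftrightarrow> a dvd t * (2 * q) \<and> \<not> a dvd t * q"
proof -
  obtain h where h: "a = 2 * h" "h > 0" using assms by (auto elim: evenE)
  have "[t * q = h] (mod (2 * h)) \<longleftrightarrow> 2 * h dvd 2 * (t * q) \<and> \<not> 2 * h dvd t * q"
  proof
    assume *: "[t * q = h] (mod (2 * h))"
    then have "[2 * (t * q) = 2 * h] (mod (2 * h))" by (metis cong_scalar_left)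
    then have "2 * h dvd 2 * (t * q)" using cong_dvd_iff dvd_refl by blast
    moreover have "\<not> 2 * h dvd t * q"
      using cong_dvd_iff[OF *] h dvd_imp_le[of "2 * h" h] by auto
    ultimately show "2 * h dvd 2 * (t * q) \<and> \<not> 2 * h dvd t * q" by blast
  next
    assume *: "2 * h dvd 2 * (t * q) \<and> \<not> 2 * h dvd t * q"
    then obtain m where m: "t * q = h * m" by (auto simp: dvd_def)
    have "odd m"
    proof
      assume "even m"
      then have "2 * h dvd h * m" by (metis mult.commute mult_dvd_mono dvd_refl)
      then show False using * m by simp
    qed
    then obtain r where "m = 2 * r + 1" by (auto elim: oddE)
    then have "t * q = r * (2 * h) + h" using m by (simp add: algebra_simps)
    then show "[t * q = h] (mod (2 * h))" by (simp add: cong_def)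
  qed
  then show ?thesis using h(1) by (simp add: mult.left_commute)
qed

text \<open>Difference of two instances of \<open>sum_root_dvd\<close>, with 2 q and with q; the
  first one vanishes because \<open>a\<close> and 2 q share the factor 2.\<close>

lemma sum_root_half:
  assumes "a > 0" "even a"
  shows "(\<Sum>t | t < a \<and> [t * q = a div 2] (mod a). unit_root a ^ t) = (if gcd a q = 1 then - 1 else 0)"
proof -
  have "{t. t < a \<and> [t * q = a div 2] (mod a)} = {t. t < a \<and> a dvd t * (2 * q)} - {t. t < a \<and> a dvd t * q}"
    by (auto simp: cong_half_iff[OF assms])
  moreover have "{t. t < a \<and> a dvd t * q} \<subseteq> {t. t < a \<and> a dvd t * (2 * q)}"
    by (auto simp: mult.left_commute[of _ 2])
  ultimately have "(\<Sum>t | t < a \<and> [t * q = a div 2] (mod a). unit_root a ^ t) =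
      (\<Sum>t | t < a \<and> a dvd t * (2 * q). unit_root a ^ t) - (\<Sum>t | t < a \<and> a dvd t * q. unit_root a ^ t)"
    by (simp add: sum_diff)
  also have "\<dots> = (if gcd a (2 * q) = 1 then 1 else 0) - (if gcd a q = 1 then 1 else 0)"
    by (simp only: sum_root_dvd[OF assms(1)])
  finally have *: "(\<Sum>t | t < a \<and> [t * q = a div 2] (mod a). unit_root a ^ t) = \<dots>" .
  have "gcd a (2 * q) \<noteq> 1"
  proof -
    have "2 dvd gcd a (2 * q)" using assms(2) by simp
    then show ?thesis by (metis odd_one)
  qed
  then show ?thesis unfolding * by simp
qed

text \<open>The sum counts the inverses of \<open>q\<close> modulo \<open>a\<close>: exactly one if
  \<open>q\<close> is a unit, none otherwise.\<close>

lemma sum_cong_1: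
  fixes a q :: nat
  assumes "a > 0"
  shows "(\<Sum>t<a. if [t * q = 1] (mod a) then 1 else 0 :: complex) = (if gcd a q = 1 then 1 else 0)"
proof (cases "gcd a q = 1")
  case True
  then have cop: "coprime q a" by (metis gcd_eq_1_imp_coprime gcd.commute)
  then obtain x where x: "[q * x = 1] (mod a)"
    by (auto simp: coprime_iff_invertible_nat)
  define t0 where "t0 = x mod a"
  have t0: "t0 < a" "[t0 * q = 1] (mod a)"
    using x assms unfolding t0_def cong_def mod_mult_left_eq by (simp_all only: mult.commute mod_less_divisor)
  have "[t * q = 1] (mod a) \<longleftrightarrow> t = t0" if "t < a" for t
  proof
    assume "[t * q = 1] (mod a)"
    then have "[t * q = t0 * q] (mod a)" using t0 by (metis cong_sym cong_trans)
    then have "[t = t0] (mod a)" by (simp only: cong_mult_rcancel_nat[OF cop])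
    then show "t = t0" using that t0 by (simp add: cong_def)
  qed (use t0 in auto)
  then have "(\<Sum>t<a. if [t * q = 1] (mod a) then 1 else 0 :: complex) = (\<Sum>t<a. if t = t0 then 1 else 0)"
    by (intro sum.cong) auto
  then show ?thesis using True t0 by simp
next
  case False
  then have "\<not> coprime q a" by (metis coprime_imp_gcd_eq_1 gcd.commute)
  then have "\<not> [t * q = 1] (mod a)" for t
    by (auto simp: coprime_iff_invertible_nat mult.commute)
  then show ?thesis using False by simp
qed

subsection \<open>Local weights\<close>

text \<open>
  The contribution of the orbit of \<open>p\<close> under \<open>x\<close> and \<open>y\<close> to \<open>\<omega>\<^sup>x(y)\<close>: \<open>y\<close> permutes the \<open>m\<close> cycles of \<open>x\<close> in it
  cyclically, and \<open>y\<^sup>m = x\<^sup>j\<close> there.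
\<close>

definition phase :: "(int \<Rightarrow> int) \<Rightarrow> (int \<Rightarrow> int) \<Rightarrow> int \<Rightarrow> complex" where
  "phase x y p =
     (let m = LEAST m. 0 < m \<and> (y ^^ m) p \<in> orbit x p
      in unit_root (card (orbit x p)) ^ (LEAST j. (x ^^ j) p = (y ^^ m) p))"

text \<open>Only \<open>m\<close> has to be minimal here. Any exponent \<open>j\<close> will do in
  place of the least one, since it matters only modulo the length of the cycle.\<close>

lemma phaseI:
  assumes "permutation x" "0 < m" "(y ^^ m) p = (x ^^ j) p"
    and "\<And>m'. 0 < m' \<Longrightarrow> m' < m \<Longrightarrow> (y ^^ m') p \<notin> orbit x p"
  shows "phase x y p = unit_root (card (orbit x p)) ^ j"
proof -
  have "(LEAST m. 0 < m \<and> (y ^^ m) p \<in> orbit x p) = m"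
  proof (rule Least_equality)
    show "0 < m \<and> (y ^^ m) p \<in> orbit x p" using assms(2,3) in_orbit_iff[OF assms(1)] by metis
    show "m \<le> m'" if "0 < m' \<and> (y ^^ m') p \<in> orbit x p" for m'
      using assms(4)[of m'] that by (meson not_le)
  qed
  moreover define l where "l = (LEAST j. (x ^^ j) p = (y ^^ m) p)"
  ultimately have "phase x y p = unit_root (card (orbit x p)) ^ l"
    by (simp add: phase_def)
  moreover have "(x ^^ l) p = (x ^^ j) p"
    unfolding l_def using LeastI[of "\<lambda>j. (x ^^ j) p = (y ^^ m) p" j] assms(3) by simp
  then have "[l = j] (mod card (orbit x p))"
    by (simp add: funpow_eq_iff_cong[OF assms(1)])
  ultimately show ?thesis using root_pow_cong by metis
qed

text \<open>Local form of chi times the indicator of \<open>x ^^ k = y\<close>. Testing the equation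
  at the single point \<open>p\<close> is enough because both sides commute with everything that
  generates the orbit (see \<open>pow_eq_of_reps\<close>); the sign is that of a signed cycle by its
  class. \<open>Lie_weight\<close> treats \<open>x ^^ k = w0 n\<close> in the same way.\<close>

definition root_weight :: "nat \<Rightarrow> (int \<Rightarrow> int) \<Rightarrow> (int \<Rightarrow> int) \<Rightarrow> int \<Rightarrow> complex" where
  "root_weight k y x p = (if (x ^^ k) p = y p then if - p \<in> orbit x p then - 1 else 1 else 0)"

definition Lie_weight :: "nat \<Rightarrow> (int \<Rightarrow> int) \<Rightarrow> (int \<Rightarrow> int) \<Rightarrow> int \<Rightarrow> complex" where
  "Lie_weight k y x p = (if (x ^^ k) p = - p then phase x y p else 0)"

section \<open>Blocks of a signed permutation and first returns to them\<close>

lemma block_iff: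
  assumes "permutation y"
  shows "v \<in> block y p \<longleftrightarrow> (\<exists>t. v = (y ^^ t) p \<or> v = - (y ^^ t) p)"
  by (auto simp: block_def orbit_altdef_permutation[OF assms])

lemma odd_funpow:
  fixes y :: "int \<Rightarrow> int"
  assumes "\<And>i. y (- i) = - y i" shows "(y ^^ t) (- i) = - (y ^^ t) i"
  by (induction t) (simp_all add: assms)

lemma self_in_block: "permutation y \<Longrightarrow> p \<in> block y p"
  by (simp add: block_def permutation_self_in_orbit)

lemma block_eq_of_mem:
  assumes y: "permutation y" and odd: "\<And>i. y (- i) = - y i" and v: "v \<in> block y p"
  shows "block y v = block y p"
proof -
  have neg: "orbit y (- i) = uminus ` orbit y i" for i
    unfolding orbit_altdef_permutation[OF y] by (auto simp: odd_funpow[of y, OF odd])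
  have inv: "uminus ` uminus ` S = S" for S :: "int set" by (simp add: image_image)
  show ?thesis
    using v by (auto simp: block_def neg image_Un inv orbit_eq_of_mem[OF y])
qed

lemma block_commute:
  assumes y: "permutation y" and z: "z \<circ> y = y \<circ> z" "\<And>i. z (- i) = - z i"
    and v: "v \<in> block y p"
  shows "z v \<in> block y (z p)"
  using v by (auto simp: block_iff[OF y] funpow_commute[OF z(1)] z(2))

lemma funpow_circ_commute:
  assumes "x \<circ> y = y \<circ> x" shows "(x ^^ a) \<circ> y = y \<circ> (x ^^ a)"
  using funpow_commute[OF assms[symmetric], of a] by (simp add: fun_eq_iff)

text \<open>Since \<open>x\<close> commutes with \<open>y\<close> and negation, it permutes the
  blocks of \<open>y\<close>; the block of \<open>p\<close> lies on a cycle of blocks, and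
  \<open>b\<close> is the length of that cycle.\<close>

lemma first_return_dvd:
  assumes xy: "x \<in> carrier (Bgrp n)" "y \<in> carrier (Bgrp n)" "x \<circ> y = y \<circ> x"
    and b: "0 < b" "(x ^^ b) p \<in> block y p"
      "\<And>b'. 0 < b' \<Longrightarrow> b' < b \<Longrightarrow> (x ^^ b') p \<notin> block y p"
  shows "(x ^^ j) p \<in> block y p \<longleftrightarrow> b dvd j"
proof -
  note py = Bgrp_permutation[OF xy(2)] and oy = Bgrp_odd[OF xy(2)]
  have move: "(x ^^ a) v \<in> block y ((x ^^ a) p)" if "v \<in> block y p" for a v
    by (rule block_commute[OF py funpow_circ_commute[OF xy(3)] _ that])
      (rule odd_funpow[of x, OF Bgrp_odd[OF xy(1)]])
  have mult: "(x ^^ (b * q)) p \<in> block y p" for q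
  proof (induction q)
    case 0
    then show ?case by (simp add: self_in_block[OF py])
  next
    case (Suc q)
    from move[OF this, of b] show ?case
      by (simp add: funpow_add block_eq_of_mem[of y, OF py oy b(2)])
  qed
  have "(x ^^ j) p = (x ^^ (j mod b)) ((x ^^ (b * (j div b))) p)"
    by (metis comp_apply funpow_add mod_mult_div_eq)
  moreover have "\<dots> \<in> block y ((x ^^ (j mod b)) p)" by (rule move[OF mult])
  ultimately have "(x ^^ j) p \<in> block y ((x ^^ (j mod b)) p)" by simp
  then have eq: "block y ((x ^^ j) p) = block y ((x ^^ (j mod b)) p)"
    by (rule block_eq_of_mem[of y, OF py oy])
  show ?thesis
  proof
    assume "(x ^^ j) p \<in> block y p"
    then have "block y ((x ^^ (j mod b)) p) = block y p"
      using eq block_eq_of_mem[of y, OF py oy] by metis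
    then have "(x ^^ (j mod b)) p \<in> block y p" using self_in_block[OF py] by metis
    then have "j mod b = 0" using b(1) b(3)[of "j mod b"] by auto
    then show "b dvd j" by auto
  next
    assume "b dvd j"
    then show "(x ^^ j) p \<in> block y p" using mult by (auto simp: dvd_def)
  qed
qed

lemma dvd_mult_iff_div_gcd:
  assumes "(a :: nat) > 0" shows "a dvd t * i \<longleftrightarrow> a div gcd t a dvd i"
proof -
  let ?g = "gcd t a"
  have g: "?g > 0" using assms by simp
  have "a dvd t * i \<longleftrightarrow> ?g * (a div ?g) dvd ?g * i" by (simp add: dvd_gcd_mult_iff)
  then show ?thesis using assms by (simp only: nat_mult_dvd_cancel_disj) simp
qed

text \<open>Both sides are the u-th power of \<open>unit_root (a div g)\<close>. This passes from
  the root attached to a cycle of \<open>x\<close> to the one attached to the cycle of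
  \<open>y\<close>.\<close>

lemma root_pow_div_gcd:
  assumes "(g :: nat) dvd a" "a > 0" "b > 0"
  shows "unit_root (b * (a div g)) ^ (b * u) = unit_root a ^ (g * u)"
proof -
  have g: "g > 0" using assms by (metis dvd_0_left gr0I less_irrefl)
  have "unit_root (b * (a div g)) ^ (b * u) = unit_root (a div g) ^ u" by (rule root_pow_scale[OF assms(3)])
  also have "\<dots> = unit_root (g * (a div g)) ^ (g * u)" by (rule root_pow_scale[OF g, symmetric])
  finally show ?thesis using assms(1) by simp
qed

text \<open>\<open>b\<close> is the time of the first return of \<open>p\<close> under \<open>x\<close> to its orbit under \<open>y\<close> and negation.\<close>

locale commuting_pair =
  fixes n :: nat and x y :: "int \<Rightarrow> int" and p :: int and b :: nat
  assumes x: "x \<in> carrier (Bgrp n)" and y: "y \<in> carrier (Bgrp n)" and comm: "x \<circ> y = y \<circ> x"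
    and p: "p \<noteq> 0" and b_pos: "0 < b" and b_in: "(x ^^ b) p \<in> block y p"
    and b_first: "\<And>b'. 0 < b' \<Longrightarrow> b' < b \<Longrightarrow> (x ^^ b') p \<notin> block y p"
begin

abbreviation "a \<equiv> card (orbit y p)"

lemmas px = Bgrp_permutation[OF x] and py = Bgrp_permutation[OF y]

lemma a_pos: "a > 0" by (rule card_orbit_pos[OF py])

lemma return_iff: "(x ^^ j) p \<in> block y p \<longleftrightarrow> b dvd j"
  by (rule first_return_dvd[OF x y comm b_pos b_in b_first])

lemma y_in_block: "(y ^^ m) p \<in> block y p" and neg_in_block: "- (y ^^ m) p \<in> block y p"
  by (auto simp: block_iff[OF py])

lemma odd_x: "(x ^^ m) (- i) = - (x ^^ m) i" and odd_y: "(y ^^ m) (- i) = - (y ^^ m) i"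
  by (simp_all add: odd_funpow Bgrp_odd[OF x] Bgrp_odd[OF y])

lemma commute: "(x ^^ c) ((y ^^ d) i) = (y ^^ d) ((x ^^ c) i)"
  using funpow_commute2[OF comm] .

lemma y_eq_iff: "(y ^^ s) p = (y ^^ t) p \<longleftrightarrow> [s = t] (mod a)"
  by (rule funpow_eq_iff_cong[OF py])

lemma x_multiple_pos:
  assumes "(x ^^ b) p = (y ^^ t) p" shows "(x ^^ (b * i)) p = (y ^^ (t * i)) p"
proof (induction i)
  case (Suc i)
  have "(x ^^ (b * Suc i)) p = (x ^^ b) ((x ^^ (b * i)) p)" by (simp add: funpow_add)
  also have "\<dots> = (y ^^ (t * i)) ((y ^^ t) p)" by (simp add: Suc commute assms)
  also have "\<dots> = (y ^^ (t * Suc i)) p" by (metis comp_apply funpow_add mult_Suc_right add.commute)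
  finally show ?case .
qed simp

lemma x_multiple_neg:
  assumes "(x ^^ b) p = - (y ^^ t) p"
  shows "(x ^^ (b * i)) p = (if even i then (y ^^ (t * i)) p else - (y ^^ (t * i)) p)"
proof (induction i)
  case (Suc i)
  have "(x ^^ (b * Suc i)) p = (x ^^ b) ((x ^^ (b * i)) p)" by (simp add: funpow_add)
  also have "\<dots> = (if even i then - (y ^^ (t * i)) ((y ^^ t) p) else (y ^^ (t * i)) ((y ^^ t) p))"
    by (simp add: Suc commute assms odd_x odd_y)
  also have "(y ^^ (t * i)) ((y ^^ t) p) = (y ^^ (t * Suc i)) p"
    by (metis comp_apply funpow_add mult_Suc_right add.commute)
  finally show ?case by simp
qed simp

text \<open>If y^h p = - p, then a divides 2 h but not h, as p is nonzero. So 2 h is an odd multiple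
  of a, which makes a even and h congruent to a / 2.\<close>

lemma neg_p_exponent:
  assumes "- p \<in> orbit y p"
  shows "even a" and "(y ^^ s) p = - p \<longleftrightarrow> [s = a div 2] (mod a)"
proof -
  obtain h where h: "(y ^^ h) p = - p" using assms by (auto simp: in_orbit_iff[OF py])
  have "(y ^^ (2 * h)) p = (y ^^ h) ((y ^^ h) p)" by (simp add: mult_2 funpow_add)
  then have "(y ^^ (2 * h)) p = p" using h odd_y[of h p] by simp
  then have dvd: "a dvd 2 * h" by (simp add: funpow_eq_self_iff[OF py])
  have ndvd: "\<not> a dvd h" using h p by (simp add: funpow_eq_self_iff[OF py, symmetric])
  obtain r where r: "2 * h = a * r" using dvd by (auto simp: dvd_def)
  have "odd r"
  proof
    assume "even r"
    then obtain s where "r = 2 * s" by (auto elim: evenE)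
    then have "h = a * s" using r by simp
    then show False using ndvd by simp
  qed
  then show ev: "even a" using r by (metis dvd_triv_left even_mult_iff)
  obtain c where c: "a = 2 * c" using ev by (auto elim: evenE)
  obtain s where s: "r = 2 * s + 1" using \<open>odd r\<close> by (auto elim: oddE)
  have "h = a * s + c" using r unfolding c s by (simp add: algebra_simps)
  then have "[h = a div 2] (mod a)" by (simp add: c cong_def)
  then show "(y ^^ s) p = - p \<longleftrightarrow> [s = a div 2] (mod a)" for s
    unfolding h[symmetric] y_eq_iff by (metis cong_sym cong_trans)
qed

text \<open>The points of the \<open>x\<close>-cycle of p in its block are y^(t i) p, and the
  multiples of t modulo a are those of g = gcd t a. So y first returns to that cycle at time g, with
  y^g = x^(b u) at p, and the cycle has length b (a / g). The factor 1 gives the conclusion the same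
  shape as in \<open>phase_neg\<close>.\<close>

lemma phase_pos:
  assumes t: "(x ^^ b) p = (y ^^ t) p" and nb: "- p \<in> orbit y p"
  shows "\<exists>u. [1 * t * u = gcd t a] (mod a) \<and> phase x y p = unit_root a ^ (gcd t a * u)"
proof -
  let ?g = "gcd t a"
  obtain u where u: "[t * u = ?g] (mod a)" using cong_solve_nat by blast
  have g: "?g > 0" using a_pos by simp
  have "(y ^^ ?g) p = (x ^^ (b * u)) p"
    unfolding x_multiple_pos[OF t] y_eq_iff by (rule cong_sym[OF u])
  then have "phase x y p = unit_root (card (orbit x p)) ^ (b * u)"
  proof (rule phaseI[OF px g])
    fix m assume m: "0 < m" "m < ?g"
    show "(y ^^ m) p \<notin> orbit x p"
    proof
      assume "(y ^^ m) p \<in> orbit x p"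
      then obtain j where j: "(y ^^ m) p = (x ^^ j) p" by (auto simp: in_orbit_iff[OF px])
      then have "b dvd j" using return_iff y_in_block by metis
      then obtain i where "j = b * i" by (auto simp: dvd_def)
      then have *: "[m = t * i] (mod a)" using j by (simp add: x_multiple_pos[OF t] y_eq_iff)
      have "?g dvd m" using cong_dvd_iff[OF cong_dvd_modulus_nat[OF *]] by simp
      then show False using m dvd_imp_le by fastforce
    qed
  qed
  moreover have "card (orbit x p) = b * (a div ?g)"
  proof (rule dvd_antisym)
    have iff: "card (orbit x p) dvd b * i \<longleftrightarrow> a div ?g dvd i" for i
      using x_multiple_pos[OF t, of i] dvd_mult_iff_div_gcd[OF a_pos, of t i]
      by (simp add: funpow_eq_self_iff[OF px, symmetric] funpow_eq_self_iff[OF py])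
    then show "card (orbit x p) dvd b * (a div ?g)" by simp
    have "(x ^^ card (orbit x p)) p \<in> block y p"
      using funpow_eq_self_iff[OF px, of "card (orbit x p)" p] self_in_block[OF py] by simp
    then have "b dvd card (orbit x p)" by (simp add: return_iff)
    then obtain i where i: "card (orbit x p) = b * i" by (auto simp: dvd_def)
    then have "a div ?g dvd i" using iff[of i] by simp
    then show "b * (a div ?g) dvd card (orbit x p)" by (simp add: i)
  qed
  ultimately have "phase x y p = unit_root a ^ (?g * u)"
    using root_pow_div_gcd[OF _ a_pos b_pos] by simp
  then show ?thesis using u by auto
qed

lemma neg_not_orbit:
  assumes "- p \<notin> orbit y p" shows "(y ^^ s) p \<noteq> - (y ^^ t) p"
proof
  assume *: "(y ^^ s) p = - (y ^^ t) p"
  have m: "(y ^^ t) p \<in> orbit y p" "(y ^^ s) p \<in> orbit y p" by (auto simp: in_orbit_iff[OF py])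
  have "p \<in> orbit y ((y ^^ t) p)"
    using orbit_eq_of_mem[OF py m(1)] permutation_self_in_orbit[OF py] by blast
  then obtain r where r: "(y ^^ r) ((y ^^ t) p) = p" unfolding in_orbit_iff[OF py] by metis
  have "(y ^^ (r + s)) p = (y ^^ r) (- (y ^^ t) p)" by (simp add: funpow_add *)
  also have "\<dots> = - p" by (simp add: odd_y r)
  finally show False using assms by (metis in_orbit_iff[OF py])
qed

text \<open>Here x^(b i) p carries the sign (-1)^i, and its points in the \<open>y\<close>-cycle of
  p are those with even i. The returning power of \<open>x\<close> is therefore b (2 u), whence the
  factor 2, and the cycle has length 2 b (a / g), where a / g is odd because it divides q.\<close>

lemma phase_neg:
  assumes t: "(x ^^ b) p = - (y ^^ t) p" and nb: "- p \<notin> orbit y p"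
    and q: "odd q" "a dvd t * q"
  shows "\<exists>u. [2 * t * u = gcd t a] (mod a) \<and> phase x y p = unit_root a ^ (gcd t a * u)"
proof -
  let ?g = "gcd t a"
  let ?e = "a div ?g"
  have g: "?g > 0" using a_pos by simp
  have "?e dvd q" using q(2) by (simp add: dvd_mult_iff_div_gcd[OF a_pos])
  then have odd_e: "odd ?e" using q(1) dvd_trans by blast
  obtain u0 where u0: "[t * u0 = ?g] (mod a)" using cong_solve_nat by blast
  \<comment> \<open>The odd number \<open>?e\<close> can be added to \<open>u0\<close> without
    changing \<open>t * u0\<close> modulo \<open>a\<close>; this adjusts the parity of the
    solution.\<close>
  have "[t * (u0 + ?e) = t * u0] (mod a)"
    using dvd_mult_iff_div_gcd[OF a_pos, of t ?e] by (simp add: distrib_left cong_add_lcancel_0_nat cong_0_iff)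
  then have u1: "[t * (u0 + ?e) = ?g] (mod a)" using u0 cong_trans by blast
  have "\<exists>u. [t * (2 * u) = ?g] (mod a)"
  proof (cases "even u0")
    case True
    then show ?thesis using u0 by (auto elim!: evenE)
  next
    case False
    then have "even (u0 + ?e)" using odd_e by simp
    then show ?thesis using u1 by (metis evenE)
  qed
  then obtain u where u: "[t * (2 * u) = ?g] (mod a)" ..
  have "(y ^^ ?g) p = (x ^^ (b * (2 * u))) p"
    unfolding x_multiple_neg[OF t] using u by (simp add: y_eq_iff cong_sym)
  then have "phase x y p = unit_root (card (orbit x p)) ^ (b * (2 * u))"
  proof (rule phaseI[OF px g])
    fix m assume m: "0 < m" "m < ?g"
    show "(y ^^ m) p \<notin> orbit x p"
    proof
      assume "(y ^^ m) p \<in> orbit x p"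
      then obtain j where j: "(y ^^ m) p = (x ^^ j) p" by (auto simp: in_orbit_iff[OF px])
      then have "b dvd j" using return_iff y_in_block by metis
      then obtain i where "j = b * i" by (auto simp: dvd_def)
      then have *: "[m = t * i] (mod a)"
        using j neg_not_orbit[OF nb] by (simp add: x_multiple_neg[OF t] y_eq_iff split: if_splits)
      have "?g dvd m" using cong_dvd_iff[OF cong_dvd_modulus_nat[OF *]] by simp
      then show False using m dvd_imp_le by fastforce
    qed
  qed
  moreover have "card (orbit x p) = (b * 2) * ?e"
  proof (rule dvd_antisym)
    have iff: "card (orbit x p) dvd b * i \<longleftrightarrow> even i \<and> ?e dvd i" for i
      using x_multiple_neg[OF t, of i] dvd_mult_iff_div_gcd[OF a_pos, of t i]
        neg_not_orbit[OF nb, of 0 "t * i"]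
      by (auto simp: funpow_eq_self_iff[OF px, symmetric] funpow_eq_self_iff[OF py, symmetric])
    show "card (orbit x p) dvd (b * 2) * ?e" using iff[of "2 * ?e"] by (simp add: mult.assoc)
    have "(x ^^ card (orbit x p)) p \<in> block y p"
      using funpow_eq_self_iff[OF px, of "card (orbit x p)" p] self_in_block[OF py] by simp
    then have "b dvd card (orbit x p)" by (simp add: return_iff)
    then obtain i where i: "card (orbit x p) = b * i" by (auto simp: dvd_def)
    then have "even i" "?e dvd i" using iff[of i] by simp_all
    then have "2 * ?e dvd i" using odd_e by (simp add: divides_mult)
    then show "(b * 2) * ?e dvd card (orbit x p)" by (simp add: i mult.assoc)
  qed
  ultimately have "phase x y p = unit_root ((b * 2) * ?e) ^ ((b * 2) * u)" by (simp add: mult.assoc)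
  also have "\<dots> = unit_root a ^ (?g * u)"
    using root_pow_div_gcd[of ?g a "b * 2" u] a_pos b_pos by simp
  finally show ?thesis using u by (auto simp: ac_simps)
qed

section \<open>The two weights as functions of the exponent t\<close>

lemma Lie_weight_zero: "\<not> b dvd k \<Longrightarrow> Lie_weight k y x p = 0"
  using return_iff[of k] neg_in_block[of 0] by (auto simp: Lie_weight_def)

lemma root_weight_zero: "\<not> b dvd k \<Longrightarrow> root_weight k y x p = 0"
  using return_iff[of k] y_in_block[of 1] by (auto simp: root_weight_def)

text \<open>Suffix A: - p lies on the \<open>y\<close>-cycle of p, so powers of \<open>y\<close>
  alone fill the block. Suffix B: it does not, and pos or neg records the sign in x^b p = y^t p or
  x^b p = - y^t p.\<close>

lemma Lie_weight_A:
  assumes "- p \<in> orbit y p" "(x ^^ b) p = (y ^^ t) p"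
  shows "[t * q = a div 2] (mod a) \<Longrightarrow> \<exists>u. [1 * t * u = gcd t a] (mod a) \<and> Lie_weight (b * q) y x p = unit_root a ^ (gcd t a * u)"
    and "\<not> [t * q = a div 2] (mod a) \<Longrightarrow> Lie_weight (b * q) y x p = 0"
  using phase_pos[OF assms(2,1)]
  by (simp_all add: Lie_weight_def x_multiple_pos[OF assms(2)] neg_p_exponent[OF assms(1)])

text \<open>If \<open>x ^^ (b * q)\<close> agrees with \<open>y\<close> at p, the
  \<open>x\<close>-cycle of p contains the \<open>y\<close>-cycle of p and with it - p. So the sign
  is -1 whenever the weight is nonzero.\<close>

lemma root_weight_A:
  assumes "- p \<in> orbit y p" "(x ^^ b) p = (y ^^ t) p"
  shows "root_weight (b * q) y x p = (if [t * q = 1] (mod a) then - 1 else 0)"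
proof -
  have iff: "(x ^^ (b * q)) p = y p \<longleftrightarrow> [t * q = 1] (mod a)"
    using y_eq_iff[of "t * q" 1] by (simp add: x_multiple_pos[OF assms(2)])
  have "- p \<in> orbit x p" if *: "[t * q = 1] (mod a)"
  proof -
    obtain h where h: "(y ^^ h) p = - p" using assms(1) by (auto simp: in_orbit_iff[OF py])
    have "[t * (q * h) = h] (mod a)" using cong_scalar_right[OF *, of h] by (simp add: mult.assoc)
    then have "(x ^^ (b * (q * h))) p = - p"
      unfolding x_multiple_pos[OF assms(2)] h[symmetric] y_eq_iff .
    then show ?thesis by (metis in_orbit_iff[OF px])
  qed
  then show ?thesis by (simp add: root_weight_def iff)
qed

lemma Lie_weight_B_pos:
  assumes "- p \<notin> orbit y p" "(x ^^ b) p = (y ^^ t) p"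
  shows "Lie_weight (b * q) y x p = 0"
  using neg_not_orbit[OF assms(1), of "t * q" 0] by (simp add: Lie_weight_def x_multiple_pos[OF assms(2)])

lemma Lie_weight_B_neg:
  assumes "- p \<notin> orbit y p" "(x ^^ b) p = - (y ^^ t) p"
  shows "odd q \<Longrightarrow> a dvd t * q \<Longrightarrow> \<exists>u. [2 * t * u = gcd t a] (mod a) \<and> Lie_weight (b * q) y x p = unit_root a ^ (gcd t a * u)"
    and "\<not> (odd q \<and> a dvd t * q) \<Longrightarrow> Lie_weight (b * q) y x p = 0"
proof -
  have iff: "(x ^^ (b * q)) p = - p \<longleftrightarrow> odd q \<and> a dvd t * q"
    using neg_not_orbit[OF assms(1), of "t * q" 0]
    by (simp add: x_multiple_neg[OF assms(2)] funpow_eq_self_iff[OF py])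
  show "odd q \<Longrightarrow> a dvd t * q \<Longrightarrow> \<exists>u. [2 * t * u = gcd t a] (mod a) \<and> Lie_weight (b * q) y x p = unit_root a ^ (gcd t a * u)"
    using phase_neg[OF assms(2,1)] by (simp add: Lie_weight_def iff)
  show "\<not> (odd q \<and> a dvd t * q) \<Longrightarrow> Lie_weight (b * q) y x p = 0"
    by (auto simp: Lie_weight_def iff)
qed

lemma root_weight_B_pos:
  assumes "- p \<notin> orbit y p" "(x ^^ b) p = (y ^^ t) p"
  shows "root_weight (b * q) y x p = (if [t * q = 1] (mod a) then 1 else 0)"
proof -
  have iff: "(x ^^ (b * q)) p = y p \<longleftrightarrow> [t * q = 1] (mod a)"
    using y_eq_iff[of "t * q" 1] by (simp add: x_multiple_pos[OF assms(2)])
  have "- p \<notin> orbit x p"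
  proof
    assume "- p \<in> orbit x p"
    then obtain j where j: "(x ^^ j) p = - p" by (auto simp: in_orbit_iff[OF px])
    then have "b dvd j" using return_iff[of j] neg_in_block[of 0] by simp
    then obtain i where "j = b * i" by (auto simp: dvd_def)
    then show False using j neg_not_orbit[OF assms(1), of "t * i" 0] by (simp add: x_multiple_pos[OF assms(2)])
  qed
  then show ?thesis by (simp add: root_weight_def iff)
qed

text \<open>An even q that is invertible modulo a forces a to be odd; then x^(b a) p = - y^(t a) p =
  - p, which puts - p on the cycle of \<open>x\<close>.\<close>

lemma root_weight_B_neg:
  assumes "- p \<notin> orbit y p" "(x ^^ b) p = - (y ^^ t) p"
  shows "root_weight (b * q) y x p = (if even q \<and> [t * q = 1] (mod a) then - 1 else 0)"
proof -
  have iff: "(x ^^ (b * q)) p = y p \<longleftrightarrow> even q \<and> [t * q = 1] (mod a)"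
    using y_eq_iff[of "t * q" 1] neg_not_orbit[OF assms(1), of 1 "t * q"]
    by (auto simp: x_multiple_neg[OF assms(2)])
  have "- p \<in> orbit x p" if "even q" "[t * q = 1] (mod a)"
  proof -
    have "odd a"
    proof
      assume "even a"
      then have "[t * q = 1] (mod 2)" using that(2) cong_dvd_modulus_nat by blast
      then show False using that(1) by (auto simp: cong_def elim!: evenE)
    qed
    then have "(x ^^ (b * a)) p = - (y ^^ (t * a)) p" by (simp add: x_multiple_neg[OF assms(2)])
    also have "(y ^^ (t * a)) p = p" by (simp add: funpow_eq_self_iff[OF py])
    finally show ?thesis by (metis in_orbit_iff[OF px])
  qed
  then show ?thesis by (auto simp: root_weight_def iff)
qed

end

section \<open>Summing the weights over one block\<close>

lemma bij_betw_orbit: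
  assumes "permutation y"
  shows "bij_betw (\<lambda>t. (y ^^ t) p) {..<card (orbit y p)} (orbit y p)"
proof -
  let ?a = "card (orbit y p)"
  have inj: "inj_on (\<lambda>t. (y ^^ t) p) {..<?a}"
    by (rule inj_onI) (simp add: funpow_eq_iff_cong[OF assms] cong_def)
  have "(y ^^ t) p \<in> (\<lambda>t. (y ^^ t) p) ` {..<?a}" for t
  proof -
    have "(y ^^ t) p = (y ^^ (t mod ?a)) p" by (simp add: funpow_eq_iff_cong[OF assms] cong_def)
    then show ?thesis using card_orbit_pos[OF assms, of p] by auto
  qed
  then show ?thesis using inj by (auto simp: bij_betw_def in_orbit_iff[OF assms])
qed

lemma sum_collapse:
  fixes f :: "nat \<Rightarrow> complex"
  assumes "\<And>t. t < a \<Longrightarrow> \<not> P t \<Longrightarrow> f t = 0"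
  shows "(\<Sum>t<a. f t) = (\<Sum>t | t < a \<and> P t. f t)"
  by (rule sum.mono_neutral_right) (use assms in auto)

text \<open>The family \<open>X\<close> realizes every possible value v of x^b p. For k = b q, let D
  be 1 if gcd a q = 1 and 0 otherwise. If - p lies on the \<open>y\<close>-cycle of p, both sums are
  - D. If not, the Lie sum is D for odd q and 0 for even q, coming from the minus signs only; the
  root sum is D from the plus signs, cancelled by - D from the minus signs exactly when q is
  even.\<close>

lemma block_sum:
  assumes y: "y \<in> carrier (Bgrp n)" and p: "p \<noteq> 0" and b: "b > 0"
    and X: "\<And>v. v \<in> block y p \<Longrightarrow> commuting_pair n (X v) y p b"
    and Xv: "\<And>v. v \<in> block y p \<Longrightarrow> (X v ^^ b) p = v"
  shows "(\<Sum>v\<in>block y p. Lie_weight k y (X v) p) = (\<Sum>v\<in>block y p. root_weight k y (X v) p)"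
proof (cases "b dvd k")
  case False
  then have "Lie_weight k y (X v) p = 0" "root_weight k y (X v) p = 0" if "v \<in> block y p" for v
    using commuting_pair.Lie_weight_zero[OF X[OF that]] commuting_pair.root_weight_zero[OF X[OF that]]
    by blast+
  then show ?thesis by simp
next
  case True
  then obtain q where q: "k = b * q" by (auto simp: dvd_def)
  define a where "a = card (orbit y p)"
  note py = Bgrp_permutation[OF y]
  have a: "a > 0" unfolding a_def by (rule card_orbit_pos[OF py])
  have mem: "(y ^^ t) p \<in> block y p" "- (y ^^ t) p \<in> block y p" for t
    by (auto simp: block_iff[OF py])
  define Xp where "Xp t = X ((y ^^ t) p)" for t
  define Xn where "Xn t = X (- (y ^^ t) p)" for t
  have cp: "commuting_pair n (Xp t) y p b" "commuting_pair n (Xn t) y p b"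
    "(Xp t ^^ b) p = (y ^^ t) p" "(Xn t ^^ b) p = - (y ^^ t) p" for t
    using X Xv mem[of t] by (simp_all add: Xp_def Xn_def)
  have sum_pos: "(\<Sum>v\<in>orbit y p. F (X v)) = (\<Sum>t<a. F (Xp t))" for F :: "_ \<Rightarrow> complex"
    unfolding Xp_def a_def
    using sum.reindex_bij_betw[OF bij_betw_orbit[OF py], of "\<lambda>v. F (X v)"] by simp
  show ?thesis
  proof (cases "- p \<in> orbit y p")
    case True
    have blk: "block y p = orbit y p"
    proof -
      have "- v \<in> orbit y p" if v: "v \<in> orbit y p" for v
      proof -
        obtain t where "v = (y ^^ t) p" using v by (auto simp: in_orbit_iff[OF py])
        then have "- v = (y ^^ t) (- p)" by (simp add: odd_funpow[of y] Bgrp_odd[OF y])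
        then show ?thesis using funpow_in_orbit[OF True] by simp
      qed
      then show ?thesis by (auto simp: block_def)
    qed
    let ?P = "\<lambda>t. [t * q = a div 2] (mod a)"
    have ev: "even a" unfolding a_def by (rule commuting_pair.neg_p_exponent(1)[OF cp(1) True])
    have "(\<Sum>t<a. Lie_weight k y (Xp t) p) = (\<Sum>t | t < a \<and> ?P t. Lie_weight k y (Xp t) p)"
      using commuting_pair.Lie_weight_A(2)[OF cp(1) True cp(3)]
      by (intro sum_collapse) (simp add: q a_def)
    also have "\<dots> = (\<Sum>t | t < a \<and> ?P t. unit_root a ^ t)"
    proof (rule sum_inverse_exponents[OF a])
      show "?P s \<longleftrightarrow> ?P t" if "gcd s a = gcd t a" for s t
        unfolding cong_half_iff[OF a ev] using that dvd_gcd_mult_iff by metis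
      show "\<exists>u. [1 * t * u = gcd t a] (mod a) \<and> Lie_weight k y (Xp t) p = unit_root a ^ (gcd t a * u)"
        if "?P t" for t
        using commuting_pair.Lie_weight_A(1)[OF cp(1) True cp(3)] that unfolding q a_def .
    qed
    also have "\<dots> = - (if gcd a q = 1 then 1 else 0)" by (simp add: sum_root_half[OF a ev])
    also have "\<dots> = - (\<Sum>t<a. if [t * q = 1] (mod a) then 1 else 0)" by (simp only: sum_cong_1[OF a])
    also have "\<dots> = (\<Sum>t<a. root_weight k y (Xp t) p)"
      using commuting_pair.root_weight_A[OF cp(1) True cp(3)]
      by (auto simp: q a_def sum_negf[symmetric] intro!: sum.cong)
    finally show ?thesis
      unfolding blk sum_pos[of "\<lambda>x. Lie_weight k y x p"] sum_pos[of "\<lambda>x. root_weight k y x p"] .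
  next
    case False
    have disj: "orbit y p \<inter> uminus ` orbit y p = {}"
      using commuting_pair.neg_not_orbit[OF cp(1) False] by (auto simp: in_orbit_iff[OF py]) metis
    have fin: "finite (orbit y p)" using finite_orbit permutation_self_in_orbit[OF py] by metis
    have sum_neg: "(\<Sum>v\<in>uminus ` orbit y p. F (X v)) = (\<Sum>t<a. F (Xn t))" for F :: "_ \<Rightarrow> complex"
    proof -
      have "(\<Sum>v\<in>uminus ` orbit y p. F (X v)) = (\<Sum>v\<in>orbit y p. F (X (- v)))"
        by (subst sum.reindex) (auto simp: inj_on_def)
      also have "\<dots> = (\<Sum>t<a. F (Xn t))"
        unfolding Xn_def a_def
        using sum.reindex_bij_betw[OF bij_betw_orbit[OF py], of "\<lambda>v. F (X (- v))"] by simp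
      finally show ?thesis .
    qed
    have split: "(\<Sum>v\<in>block y p. F (X v)) = (\<Sum>t<a. F (Xp t)) + (\<Sum>t<a. F (Xn t))"
      for F :: "_ \<Rightarrow> complex"
      unfolding block_def using fin disj
      by (subst sum.union_disjoint) (simp_all add: sum_pos sum_neg)
    let ?P = "\<lambda>t. odd q \<and> a dvd t * q"
    have L0: "(\<Sum>t<a. Lie_weight k y (Xp t) p) = 0"
      using commuting_pair.Lie_weight_B_pos[OF cp(1) False cp(3)] by (simp add: q)
    have "(\<Sum>t<a. Lie_weight k y (Xn t) p) = (\<Sum>t | t < a \<and> ?P t. Lie_weight k y (Xn t) p)"
      using commuting_pair.Lie_weight_B_neg(2)[OF cp(2) False cp(4)]
      by (intro sum_collapse) (simp add: q a_def)
    also have "\<dots> = (\<Sum>t | t < a \<and> ?P t. unit_root a ^ t)"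
    proof (rule sum_inverse_exponents[OF a])
      show "?P s \<longleftrightarrow> ?P t" if "gcd s a = gcd t a" for s t
        using that dvd_gcd_mult_iff by metis
      show "\<exists>u. [2 * t * u = gcd t a] (mod a) \<and> Lie_weight k y (Xn t) p = unit_root a ^ (gcd t a * u)"
        if "?P t" for t
        using commuting_pair.Lie_weight_B_neg(1)[OF cp(2) False cp(4)] that unfolding q a_def by blast
    qed
    also have "\<dots> = (if odd q \<and> gcd a q = 1 then 1 else 0)"
      using sum_root_dvd[OF a, of q] by (cases "odd q") simp_all
    finally have L: "(\<Sum>t<a. Lie_weight k y (Xn t) p) = (if odd q \<and> gcd a q = 1 then 1 else 0)" .
    have "(\<Sum>t<a. root_weight k y (Xp t) p) = (\<Sum>t<a. if [t * q = 1] (mod a) then 1 else 0)"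
      using commuting_pair.root_weight_B_pos[OF cp(1) False cp(3)] by (simp add: q a_def)
    also have "\<dots> = (if gcd a q = 1 then 1 else 0)" by (rule sum_cong_1[OF a])
    finally have R1: "(\<Sum>t<a. root_weight k y (Xp t) p) = (if gcd a q = 1 then 1 else 0)" .
    have "(\<Sum>t<a. root_weight k y (Xn t) p) =
        (if even q then - (\<Sum>t<a. if [t * q = 1] (mod a) then 1 else 0) else 0)"
      using commuting_pair.root_weight_B_neg[OF cp(2) False cp(4)]
      by (auto simp: q a_def sum_negf[symmetric] intro!: sum.cong sum.neutral)
    also have "(\<Sum>t<a. if [t * q = 1] (mod a) then 1 else 0 :: complex) = (if gcd a q = 1 then 1 else 0)"
      by (rule sum_cong_1[OF a])
    finally have R2: "(\<Sum>t<a. root_weight k y (Xn t) p) =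
        (if even q then - (if gcd a q = 1 then 1 else 0) else 0)" .
    show ?thesis
      using split[of "\<lambda>x. Lie_weight k y x p"] split[of "\<lambda>x. root_weight k y x p"]
      by (simp add: L0 L R1 R2)
  qed
qed

text \<open>The group generated by \<open>y\<close> and negation, acting on \<open>block y p\<close> only.\<close>

definition shifts :: "(int \<Rightarrow> int) \<Rightarrow> int \<Rightarrow> (int \<Rightarrow> int) set" where
  "shifts y p = (\<Union>t. {perm_restrict (y ^^ t) (block y p), perm_restrict (uminus \<circ> (y ^^ t)) (block y p)})"

lemma shifts_cases:
  assumes "\<kappa> \<in> shifts y p"
  obtains t where "\<kappa> = perm_restrict (y ^^ t) (block y p)"
  | t where "\<kappa> = perm_restrict (uminus \<circ> (y ^^ t)) (block y p)"
  using assms by (auto simp: shifts_def)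

lemma shifts_outside:
  assumes "\<kappa> \<in> shifts y p" "v \<notin> block y p" shows "\<kappa> v = v"
  using assms by (auto elim!: shifts_cases simp: perm_restrict_def)

lemma block_closed:
  assumes "permutation y" "\<And>i. y (- i) = - y i" "v \<in> block y p"
  shows "(y ^^ t) v \<in> block y p" "- v \<in> block y p"
proof -
  have "(y ^^ t) v \<in> block y v" "- v \<in> block y v"
    unfolding block_iff[OF assms(1)] by (metis, metis funpow_0)
  then show "(y ^^ t) v \<in> block y p" "- v \<in> block y p"
    unfolding block_eq_of_mem[of y, OF assms] .
qed

lemma block_subset_pm:
  assumes "y \<in> carrier (Bgrp n)" "p \<in> pm n" shows "block y p \<subseteq> pm n"
  using permutes_orbit_subset[OF Bgrp_permutes[OF assms(1)] assms(2)] by (auto simp: block_def)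

lemma block_apply_iff:
  assumes "y \<in> carrier (Bgrp n)"
  shows "y i \<in> block y p \<longleftrightarrow> i \<in> block y p"
proof
  note py = Bgrp_permutation[OF assms] and oy = Bgrp_odd[OF assms]
  have "y i \<in> block y i" by (simp add: block_def orbit.base)
  then have *: "block y (y i) = block y i" by (rule block_eq_of_mem[of y, OF py oy])
  show "i \<in> block y p" if "y i \<in> block y p"
    using block_eq_of_mem[of y, OF py oy that] * self_in_block[OF py] by metis
  show "y i \<in> block y p" if "i \<in> block y p"
    using block_closed(1)[of y, OF py oy that, of 1] by simp
qed

lemma block_uminus_iff:
  assumes "y \<in> carrier (Bgrp n)"
  shows "- i \<in> block y p \<longleftrightarrow> i \<in> block y p"
  using block_closed(2)[of y, OF Bgrp_permutation[OF assms] Bgrp_odd[OF assms]] by (metis minus_minus)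

lemma shifts_block:
  assumes "y \<in> carrier (Bgrp n)" "\<kappa> \<in> shifts y p"
  shows "\<kappa> v \<in> block y p \<longleftrightarrow> v \<in> block y p"
  using assms(2) block_closed[of y, OF Bgrp_permutation[OF assms(1)] Bgrp_odd[OF assms(1)]]
  by (cases rule: shifts_cases) (auto simp: perm_restrict_def)

lemma shifts_commute:
  assumes y: "y \<in> carrier (Bgrp n)" and z: "z \<in> carrier (Bgrp n)" "z \<circ> y = y \<circ> z"
    and \<kappa>: "\<kappa> \<in> shifts y p" and zb: "\<And>v. z v \<in> block y p \<longleftrightarrow> v \<in> block y p"
  shows "z \<circ> \<kappa> = \<kappa> \<circ> z"
  using \<kappa>
  by (cases rule: shifts_cases)
    (auto simp: perm_restrict_def fun_eq_iff zb funpow_commute[OF z(2)] Bgrp_odd[OF z(1)])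

lemma shifts_Bgrp:
  assumes y: "y \<in> carrier (Bgrp n)" and p: "p \<in> pm n" and \<kappa>: "\<kappa> \<in> shifts y p"
  shows "\<kappa> \<in> carrier (Bgrp n)"
  unfolding Bgrp_iff
proof
  let ?B = "block y p"
  have inj: "inj_on w ?B \<Longrightarrow> w ` ?B \<subseteq> ?B \<Longrightarrow> perm_restrict w ?B permutes pm n" for w
  proof -
    assume w: "inj_on w ?B" "w ` ?B \<subseteq> ?B"
    have fin: "finite ?B" using finite_subset[OF block_subset_pm[OF y p]] by simp
    have "bij_betw w ?B ?B" using w endo_inj_surj[OF fin w(2,1)] by (simp add: bij_betw_def)
    then have "bij_betw (perm_restrict w ?B) ?B ?B"
      by (subst bij_betw_cong[where g = w]) (auto simp: perm_restrict_def)
    then have "perm_restrict w ?B permutes ?B"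
      by (rule bij_imp_permutes) (auto simp: perm_restrict_def)
    then show ?thesis by (rule permutes_subset) (rule block_subset_pm[OF y p])
  qed
  note cl = block_closed[of y, OF Bgrp_permutation[OF y] Bgrp_odd[OF y]]
  have injy: "inj (y ^^ t)" for t using Bgrp_inj[OF Bgrp_funpow[OF y]] .
  show "\<kappa> permutes pm n"
    using \<kappa>
  proof (cases rule: shifts_cases)
    case (1 t)
    show ?thesis unfolding 1 using injy[of t] cl(1)
      by (intro inj) (auto intro: inj_on_subset)
  next
    case (2 t)
    have "inj (uminus \<circ> (y ^^ t))" using injy[of t] by (simp add: inj_def)
    then show ?thesis unfolding 2 using cl
      by (intro inj) (auto intro: inj_on_subset)
  qed
  show "\<forall>i. \<kappa> (- i) = - \<kappa> i"
    using \<kappa> by (cases rule: shifts_cases)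
      (auto simp: perm_restrict_def block_uminus_iff[OF y] odd_funpow[of y] Bgrp_odd[OF y])
qed

text \<open>A transitive abelian group acts regularly: its elements commute with \<open>y\<close>
  and negation, so each is determined on the block by the image of \<open>p\<close>.\<close>

lemma shifts_bij:
  assumes y: "y \<in> carrier (Bgrp n)"
  shows "bij_betw (\<lambda>\<kappa>. \<kappa> p) (shifts y p) (block y p)"
  unfolding bij_betw_def
proof
  note py = Bgrp_permutation[OF y] and oy = Bgrp_odd[OF y]
  have pin: "p \<in> block y p" by (rule self_in_block[OF py])
  show "inj_on (\<lambda>\<kappa>. \<kappa> p) (shifts y p)"
  proof (rule inj_onI)
    fix \<kappa> \<kappa>' assume k: "\<kappa> \<in> shifts y p" "\<kappa>' \<in> shifts y p" and eq: "\<kappa> p = \<kappa>' p"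
    have comm: "\<kappa> ((y ^^ s) p) = (y ^^ s) (\<kappa> p) \<and> \<kappa> (- (y ^^ s) p) = - (y ^^ s) (\<kappa> p)"
      if "\<kappa> \<in> shifts y p" for \<kappa> s
    proof -
      have "y \<circ> \<kappa> = \<kappa> \<circ> y"
        by (rule shifts_commute[OF y y refl that]) (rule block_apply_iff[OF y])
      then have c: "(y ^^ s) (\<kappa> p) = \<kappa> ((y ^^ s) p)" using funpow_commute by metis
      have "\<kappa> (- i) = - \<kappa> i" for i
        using that by (cases rule: shifts_cases)
          (auto simp: perm_restrict_def block_uminus_iff[OF y] odd_funpow[of y] oy)
      then show ?thesis using c by simp
    qed
    have "\<kappa> i = \<kappa>' i" for i
    proof (cases "i \<in> block y p")
      case True
      then obtain s where "i = (y ^^ s) p \<or> i = - (y ^^ s) p" by (auto simp: block_iff[OF py])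
      then show ?thesis using comm[OF k(1), of s] comm[OF k(2), of s] eq by auto
    next
      case False
      then show ?thesis using shifts_outside k by metis
    qed
    then show "\<kappa> = \<kappa>'" by blast
  qed
  show "(\<lambda>\<kappa>. \<kappa> p) ` shifts y p = block y p"
  proof (intro equalityI subsetI)
    fix v assume "v \<in> (\<lambda>\<kappa>. \<kappa> p) ` shifts y p"
    then show "v \<in> block y p" using shifts_block[OF y] pin by auto
  next
    fix v assume "v \<in> block y p"
    then obtain t where "v = (y ^^ t) p \<or> v = - (y ^^ t) p" by (auto simp: block_iff[OF py])
    then have "v = perm_restrict (y ^^ t) (block y p) p \<or> v = perm_restrict (uminus \<circ> (y ^^ t)) (block y p) p"
      using pin by (simp add: perm_restrict_def)
    then show "v \<in> (\<lambda>\<kappa>. \<kappa> p) ` shifts y p" unfolding shifts_def by blast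
  qed
qed

text \<open>Shifting by K does not change the first return time b, and the shifted b-th power sends
  p to x^b (\<kappa> p). As \<kappa> runs through K this value runs once through the block, so
  \<open>block_sum\<close> applies.\<close>

lemma shift_sum:
  assumes x: "x \<in> carrier (Bgrp n)" and y: "y \<in> carrier (Bgrp n)" and comm: "x \<circ> y = y \<circ> x"
    and p: "p \<in> pm n"
  shows "(\<Sum>\<kappa>\<in>shifts y p. Lie_weight k y (x \<circ> \<kappa>) p) = (\<Sum>\<kappa>\<in>shifts y p. root_weight k y (x \<circ> \<kappa>) p)"
proof -
  note px = Bgrp_permutation[OF x] and ox = Bgrp_odd[OF x]
  note py = Bgrp_permutation[OF y] and oy = Bgrp_odd[OF y]
  let ?B = "block y p"
  define b where "b = (LEAST b. 0 < b \<and> (x ^^ b) p \<in> ?B)"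
  obtain N where "N > 0" "x ^^ N = id" by (rule permutation_period[OF px])
  then have "0 < N \<and> (x ^^ N) p \<in> ?B" using self_in_block[OF py] by simp
  then have b: "0 < b \<and> (x ^^ b) p \<in> ?B" unfolding b_def by (rule LeastI)
  have least: "(x ^^ b') p \<notin> ?B" if "0 < b'" "b' < b" for b'
    using not_less_Least[of b' "\<lambda>b. 0 < b \<and> (x ^^ b) p \<in> ?B"] that by (auto simp: b_def)
  have move: "(x ^^ j) v \<in> ?B \<longleftrightarrow> (x ^^ j) p \<in> ?B" if v: "v \<in> ?B" for j v
  proof -
    have "(x ^^ j) v \<in> block y ((x ^^ j) p)"
      by (rule block_commute[OF py funpow_circ_commute[OF comm] _ v]) (rule odd_funpow[of x, OF ox])
    then have *: "block y ((x ^^ j) v) = block y ((x ^^ j) p)" by (rule block_eq_of_mem[of y, OF py oy])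
    show ?thesis using block_eq_of_mem[of y, OF py oy] * self_in_block[OF py] by metis
  qed
  \<comment> \<open>\<kappa> takes effect only at the first step: until the return at time
    \<open>b\<close> the iterates stay outside the block, where \<kappa> is the identity.\<close>
  have pow: "((x \<circ> \<kappa>) ^^ j) p = (x ^^ j) (\<kappa> p)" if k: "\<kappa> \<in> shifts y p" and j: "0 < j" "j \<le> b" for \<kappa> j
    using j
  proof (induction j)
    case (Suc j)
    show ?case
    proof (cases "j = 0")
      case False
      then have "((x \<circ> \<kappa>) ^^ j) p = (x ^^ j) (\<kappa> p)"
        by (intro Suc.IH) (use Suc.prems in auto)
      moreover have "(x ^^ j) (\<kappa> p) \<notin> ?B"
        using move[of "\<kappa> p" j] shifts_block[OF y k, of p] self_in_block[OF py, of p] least[of j] False Suc.prems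
        by linarith
      then have "\<kappa> ((x ^^ j) (\<kappa> p)) = (x ^^ j) (\<kappa> p)" by (rule shifts_outside[OF k])
      ultimately show ?thesis by (metis comp_apply funpow.simps(2))
    qed simp
  qed simp
  define ev where "ev \<kappa> = (x ^^ b) (\<kappa> p)" for \<kappa>
  have finB: "finite ?B" using finite_subset[OF block_subset_pm[OF y p]] by simp
  have "(x ^^ b) ` ?B \<subseteq> ?B" using move b by blast
  moreover have injb: "inj_on (x ^^ b) ?B"
    using Bgrp_inj[OF Bgrp_funpow[OF x]] by (meson inj_on_subset subset_UNIV)
  ultimately have "bij_betw (x ^^ b) ?B ?B"
    using endo_inj_surj[OF finB] by (simp add: bij_betw_def)
  from bij_betw_trans[OF shifts_bij[OF y] this]
  have bij: "bij_betw ev (shifts y p) ?B" by (simp add: ev_def[abs_def] comp_def)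
  define X where "X v = x \<circ> inv_into (shifts y p) ev v" for v
  have inv: "inv_into (shifts y p) ev v \<in> shifts y p" "ev (inv_into (shifts y p) ev v) = v" if "v \<in> ?B" for v
    using bij that unfolding bij_betw_def by (simp_all add: inv_into_into f_inv_into_f)
  have "(\<Sum>v\<in>?B. Lie_weight k y (X v) p) = (\<Sum>v\<in>?B. root_weight k y (X v) p)"
  proof (rule block_sum[OF y])
    show "p \<noteq> 0" using p by (simp add: pm_def)
    show "0 < b" using b ..
    fix v assume v: "v \<in> ?B"
    define \<kappa> where "\<kappa> = inv_into (shifts y p) ev v"
    have k: "\<kappa> \<in> shifts y p" "ev \<kappa> = v" using inv[OF v] by (simp_all add: \<kappa>_def)
    have kp: "\<kappa> p \<in> ?B" using shifts_block[OF y k(1)] self_in_block[OF py] by simp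
    have Xk: "X v = x \<circ> \<kappa>" by (simp add: X_def \<kappa>_def)
    show Xb: "(X v ^^ b) p = v" unfolding Xk using pow[OF k(1), of b] b k(2) by (simp add: ev_def)
    show "commuting_pair n (X v) y p b"
    proof
      show "X v \<in> carrier (Bgrp n)" unfolding Xk by (intro Bgrp_compose x shifts_Bgrp[OF y p k(1)])
      show "X v \<circ> y = y \<circ> X v"
        using shifts_commute[OF y y refl k(1) block_apply_iff[OF y]] comm
        unfolding Xk by (metis comp_assoc)
      show "(X v ^^ b) p \<in> ?B" using Xb v by simp
      show "(X v ^^ b') p \<notin> ?B" if "0 < b'" "b' < b" for b'
        using pow[OF k(1), of b'] that move[OF kp] least[OF that] by (simp add: Xk)
    qed (use y b p in \<open>auto simp: pm_def\<close>)
  qed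
  then have "(\<Sum>\<kappa>\<in>shifts y p. Lie_weight k y (X (ev \<kappa>)) p) = (\<Sum>\<kappa>\<in>shifts y p. root_weight k y (X (ev \<kappa>)) p)"
    using sum.reindex_bij_betw[OF bij, of "\<lambda>v. Lie_weight k y (X v) p"]
      sum.reindex_bij_betw[OF bij, of "\<lambda>v. root_weight k y (X v) p"] by simp
  moreover have "X (ev \<kappa>) = x \<circ> \<kappa>" if "\<kappa> \<in> shifts y p" for \<kappa>
    using that bij by (simp add: X_def bij_betw_def inv_into_f_f)
  ultimately show ?thesis by (simp cong: sum.cong)
qed

subsection \<open>Exchanging the weights orbit by orbit\<close>

text \<open>For permutations this is the orbit relation of the group generated by \<open>x\<close>,
  \<open>y\<close> and negation. Forward steps suffice, since inverses are nonnegative powers by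
  finiteness of the order.\<close>

definition linked :: "(int \<Rightarrow> int) \<Rightarrow> (int \<Rightarrow> int) \<Rightarrow> (int \<times> int) set" where
  "linked x y = {(i, j). j = x i \<or> j = y i \<or> j = - i}\<^sup>*"

lemma linked_refl: "(i, i) \<in> linked x y"
  by (simp add: linked_def)

lemma linked_trans: "(i, j) \<in> linked x y \<Longrightarrow> (j, l) \<in> linked x y \<Longrightarrow> (i, l) \<in> linked x y"
  by (simp add: linked_def)

lemma linked_step: "(i, x i) \<in> linked x y" "(i, y i) \<in> linked x y" "(i, - i) \<in> linked x y"
  by (auto simp: linked_def)

lemma linked_funpow: "(i, (x ^^ a) i) \<in> linked x y" "(i, (y ^^ a) i) \<in> linked x y"
proof -
  show "(i, (x ^^ a) i) \<in> linked x y"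
  proof (induction a)
    case (Suc a)
    show ?case using linked_trans[OF Suc linked_step(1)] by simp
  qed (simp add: linked_refl)
  show "(i, (y ^^ a) i) \<in> linked x y"
  proof (induction a)
    case (Suc a)
    show ?case using linked_trans[OF Suc linked_step(2)] by simp
  qed (simp add: linked_refl)
qed

lemma linked_neg_funpow: "(i, - (y ^^ a) i) \<in> linked x y"
  by (rule linked_trans[OF linked_funpow(2) linked_step(3)])

lemma linked_closed:
  assumes "(i, j) \<in> linked x y" "i \<in> S"
    and "\<And>l. l \<in> S \<Longrightarrow> x l \<in> S" "\<And>l. l \<in> S \<Longrightarrow> y l \<in> S" "\<And>l. l \<in> S \<Longrightarrow> - l \<in> S"
  shows "j \<in> S"
  using assms(1,2) unfolding linked_def
  by (induction rule: rtrancl_induct) (use assms(3-) in auto)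

lemma linked_sym:
  assumes "permutation x" "permutation y" "(i, j) \<in> linked x y"
  shows "(j, i) \<in> linked x y"
proof -
  have step_back: "(z l, l) \<in> linked x y"
    if z: "permutation z" "\<And>i a. (i, (z ^^ a) i) \<in> linked x y" for z :: "int \<Rightarrow> int" and l
  proof -
    obtain N where N: "N > 0" "z ^^ N = id" by (rule permutation_period[OF z(1)])
    have "(z ^^ (N - 1)) (z l) = (z ^^ N) l" using N(1)
      by (metis Suc_pred' comp_apply funpow_Suc_right)
    then show ?thesis using z(2)[of "z l" "N - 1"] N(2) by simp
  qed
  have neg: "(- l, l) \<in> linked x y" for l using linked_step(3)[of "- l" x y] by simp
  have "j \<in> {j. (j, i) \<in> linked x y}"
  proof (rule linked_closed[OF assms(3)])
    fix l assume "l \<in> {j. (j, i) \<in> linked x y}"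
    then have l: "(l, i) \<in> linked x y" by simp
    show "x l \<in> {j. (j, i) \<in> linked x y}"
      using linked_trans[OF step_back[OF assms(1) linked_funpow(1)] l] by simp
    show "y l \<in> {j. (j, i) \<in> linked x y}"
      using linked_trans[OF step_back[OF assms(2) linked_funpow(2)] l] by simp
    show "- l \<in> {j. (j, i) \<in> linked x y}" using linked_trans[OF neg l] by simp
  qed (simp add: linked_refl)
  then show ?thesis by simp
qed

text \<open>The least positive element of each orbit. Every nonempty orbit inside
  \<open>pm n\<close> has one because negation is among the generators, and integer representatives
  let the exchange run through 1, ..., n in order.\<close>

definition reps :: "nat \<Rightarrow> (int \<Rightarrow> int) \<Rightarrow> (int \<Rightarrow> int) \<Rightarrow> int set" where
  "reps n x y = {p \<in> {1..int n}. \<forall>j>0. (p, j) \<in> linked x y \<longrightarrow> p \<le> j}"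

lemma finite_reps [simp]: "finite (reps n x y)"
  by (rule finite_subset[of _ "{1..int n}"]) (auto simp: reps_def)

lemma reps_pm: "p \<in> reps n x y \<Longrightarrow> p \<in> pm n"
  by (auto simp: reps_def pm_def)

lemma reps_pos: "p \<in> reps n x y \<Longrightarrow> 0 < p"
  by (auto simp: reps_def)

lemma reps_unique:
  assumes "permutation x" "permutation y" "p \<in> reps n x y" "q \<in> reps n x y" "(p, q) \<in> linked x y"
  shows "p = q"
proof (rule antisym)
  show "p \<le> q" using assms(3,5) reps_pos[OF assms(4)] by (auto simp: reps_def)
  show "q \<le> p" using assms(4) reps_pos[OF assms(3)] linked_sym[OF assms(1,2,5)] by (auto simp: reps_def)
qed

lemma linked_pm:
  assumes "x \<in> carrier (Bgrp n)" "y \<in> carrier (Bgrp n)" "(i, j) \<in> linked x y" "i \<in> pm n"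
  shows "j \<in> pm n"
  by (rule linked_closed[OF assms(3,4)]) (simp_all add: Bgrp_in_pm[OF assms(1)] Bgrp_in_pm[OF assms(2)])

lemma reps_exists:
  assumes x: "x \<in> carrier (Bgrp n)" and y: "y \<in> carrier (Bgrp n)" and i: "i \<in> pm n"
  obtains p where "p \<in> reps n x y" "(p, i) \<in> linked x y"
proof -
  let ?S = "{j. 0 < j \<and> (i, j) \<in> linked x y}"
  have sub: "?S \<subseteq> {1..int n}" using linked_pm[OF x y _ i] by (force simp: pm_def)
  then have fin: "finite ?S" using finite_subset by blast
  have "i \<in> ?S \<or> - i \<in> ?S" using i linked_step(3)[of i x y] linked_refl[of i x y] by (auto simp: pm_def)
  then have ne: "?S \<noteq> {}" by blast
  define p where "p = Min ?S"
  have p: "p \<in> ?S" unfolding p_def by (rule Min_in[OF fin ne])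
  have le: "p \<le> j" if "0 < j" "(p, j) \<in> linked x y" for j
  proof -
    have "(i, j) \<in> linked x y" using p that(2) linked_trans by blast
    then show ?thesis unfolding p_def using fin that(1) by (intro Min_le) auto
  qed
  have "p \<in> {1..int n}" using p sub by blast
  then have "p \<in> reps n x y" using le by (simp add: reps_def)
  moreover have "(p, i) \<in> linked x y"
    using p linked_sym[OF Bgrp_permutation[OF x] Bgrp_permutation[OF y]] by blast
  ultimately show ?thesis by (rule that)
qed

lemma weights_cong:
  assumes "\<And>j. (x' ^^ j) p = (x ^^ j) p"
  shows "Lie_weight k y x' p = Lie_weight k y x p" "root_weight k y x' p = root_weight k y x p"
proof -
  have "orbit x' p = orbit x p" unfolding orbit_altdef by (simp add: assms)
  then show "Lie_weight k y x' p = Lie_weight k y x p" "root_weight k y x' p = root_weight k y x p"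
    by (simp_all add: Lie_weight_def root_weight_def phase_def assms)
qed

lemma linked_mono:
  assumes "\<And>i. (i, x' i) \<in> linked x y" shows "linked x' y \<subseteq> linked x y"
proof
  fix e assume e: "e \<in> linked x' y"
  obtain i j where ij: "e = (i, j)" by (cases e)
  have "j \<in> {j. (i, j) \<in> linked x y}"
    by (rule linked_closed[of i j x' y])
      (use e ij in \<open>auto simp: linked_refl intro: linked_trans assms linked_step\<close>)
  then show "e \<in> linked x y" by (simp add: ij)
qed

text \<open>\<kappa> moves points only within their orbits, and x i = (x \<circ> \<kappa>) j for i =
  \<kappa> j, so each of the two maps is a walk in the relation of the other. Hence the
  representatives are the same throughout a coset of K.\<close>

lemma linked_shift:
  assumes x: "x \<in> carrier (Bgrp n)" and y: "y \<in> carrier (Bgrp n)" and p: "p \<in> pm n"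
    and k: "\<kappa> \<in> shifts y p"
  shows "linked (x \<circ> \<kappa>) y = linked x y"
proof
  have kB: "\<kappa> \<in> carrier (Bgrp n)" by (rule shifts_Bgrp[OF y p k])
  have ki: "(i, \<kappa> i) \<in> linked z y" for i z
    using k by (cases rule: shifts_cases)
      (auto simp: perm_restrict_def linked_refl intro: linked_funpow linked_neg_funpow)
  show "linked (x \<circ> \<kappa>) y \<subseteq> linked x y"
  proof (rule linked_mono)
    show "(i, (x \<circ> \<kappa>) i) \<in> linked x y" for i
      using linked_trans[OF ki[of i x] linked_step(1)[of "\<kappa> i" x y]] by simp
  qed
  have pxk: "permutation (x \<circ> \<kappa>)" by (rule Bgrp_permutation[OF Bgrp_compose[OF x kB]])
  show "linked x y \<subseteq> linked (x \<circ> \<kappa>) y"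
  proof (rule linked_mono)
    fix i
    obtain j where j: "i = \<kappa> j" using permutes_surj[OF Bgrp_permutes[OF kB]] by (meson surjD)
    have "(\<kappa> j, j) \<in> linked (x \<circ> \<kappa>) y"
      by (rule linked_sym[OF pxk Bgrp_permutation[OF y] ki])
    moreover have "(j, x (\<kappa> j)) \<in> linked (x \<circ> \<kappa>) y" using linked_step(1)[of j "x \<circ> \<kappa>" y] by simp
    ultimately show "(i, x i) \<in> linked (x \<circ> \<kappa>) y" unfolding j by (rule linked_trans)
  qed
qed

text \<open>Interpolates between the two products: the representatives below the threshold
  \<open>s\<close> have already been exchanged.\<close>

definition hybrid :: "nat \<Rightarrow> nat \<Rightarrow> (int \<Rightarrow> int) \<Rightarrow> int \<Rightarrow> (int \<Rightarrow> int) \<Rightarrow> complex" where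
  "hybrid n k y s x = (\<Prod>p\<in>reps n x y. if p < s then root_weight k y x p else Lie_weight k y x p)"

text \<open>The \<open>x\<close>-orbit of any other representative avoids the block of
  \<open>s\<close>, so its weight does not notice \<kappa>. What matters is that \<open>c\<close> is
  chosen before \<kappa> and pulls out of the sum over K.\<close>

lemma hybrid_shift:
  assumes x: "x \<in> carrier (Bgrp n)" and y: "y \<in> carrier (Bgrp n)" and s: "s \<in> reps n x y"
  shows "\<exists>c. \<forall>\<kappa>\<in>shifts y s.
    hybrid n k y s (x \<circ> \<kappa>) = c * Lie_weight k y (x \<circ> \<kappa>) s \<and>
    hybrid n k y (s + 1) (x \<circ> \<kappa>) = c * root_weight k y (x \<circ> \<kappa>) s"
proof -
  note px = Bgrp_permutation[OF x] and py = Bgrp_permutation[OF y]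
  let ?w = "\<lambda>p x. if p < s then root_weight k y x p else Lie_weight k y x p"
  define c where "c = (\<Prod>p\<in>reps n x y - {s}. ?w p x)"
  have "hybrid n k y s (x \<circ> \<kappa>) = c * Lie_weight k y (x \<circ> \<kappa>) s \<and>
    hybrid n k y (s + 1) (x \<circ> \<kappa>) = c * root_weight k y (x \<circ> \<kappa>) s" if k: "\<kappa> \<in> shifts y s" for \<kappa>
  proof -
    have reps: "reps n (x \<circ> \<kappa>) y = reps n x y"
      unfolding reps_def linked_shift[OF x y reps_pm[OF s] k] ..
    have same: "?w p (x \<circ> \<kappa>) = ?w p x" if p: "p \<in> reps n x y" "p \<noteq> s" for p
    proof -
      have off: "(x ^^ j) p \<notin> block y s" for j
      proof
        assume "(x ^^ j) p \<in> block y s"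
        then have "(s, (x ^^ j) p) \<in> linked x y"
          by (auto simp: block_iff[OF py] intro: linked_funpow linked_neg_funpow)
        moreover have "((x ^^ j) p, p) \<in> linked x y" by (rule linked_sym[OF px py linked_funpow(1)])
        ultimately have "(s, p) \<in> linked x y" by (rule linked_trans)
        then show False using reps_unique[OF px py s p(1)] p(2) by simp
      qed
      have "((x \<circ> \<kappa>) ^^ j) p = (x ^^ j) p" for j
      proof (induction j)
        case (Suc j)
        have "\<kappa> ((x ^^ j) p) = (x ^^ j) p" by (rule shifts_outside[OF k off])
        then show ?case using Suc by simp
      qed simp
      then show ?thesis using weights_cong[of "x \<circ> \<kappa>" p x] by simp
    qed
    have "hybrid n k y s (x \<circ> \<kappa>) = Lie_weight k y (x \<circ> \<kappa>) s * (\<Prod>p\<in>reps n x y - {s}. ?w p (x \<circ> \<kappa>))"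
      unfolding hybrid_def reps by (subst prod.remove[OF finite_reps s]) simp
    moreover have "hybrid n k y (s + 1) (x \<circ> \<kappa>) = root_weight k y (x \<circ> \<kappa>) s *
        (\<Prod>p\<in>reps n x y - {s}. if p < s + 1 then root_weight k y (x \<circ> \<kappa>) p else Lie_weight k y (x \<circ> \<kappa>) p)"
      unfolding hybrid_def reps by (subst prod.remove[OF finite_reps s]) simp
    moreover have "(\<Prod>p\<in>reps n x y - {s}. if p < s + 1 then root_weight k y (x \<circ> \<kappa>) p else Lie_weight k y (x \<circ> \<kappa>) p) =
        (\<Prod>p\<in>reps n x y - {s}. ?w p (x \<circ> \<kappa>))"
      by (rule prod.cong) auto
    moreover have "(\<Prod>p\<in>reps n x y - {s}. ?w p (x \<circ> \<kappa>)) = c"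
      unfolding c_def by (rule prod.cong) (use same in auto)
    ultimately show ?thesis by (simp add: mult.commute)
  qed
  then show ?thesis by blast
qed

text \<open>Averaging: x \<mapsto> x \<circ> \<kappa> permutes the elements of the centralizer that
  have \<open>s\<close> as a representative, so the sum over them, multiplied by the order of K, is
  a double sum whose inner sums are exchanged by \<open>shift_sum\<close>. For the remaining
  elements the threshold crosses no representative.\<close>

lemma hybrid_step:
  assumes y: "y \<in> carrier (Bgrp n)" and s: "s \<in> {1..int n}"
  shows "(\<Sum>x\<in>centralizer (Bgrp n) y. hybrid n k y s x) = (\<Sum>x\<in>centralizer (Bgrp n) y. hybrid n k y (s + 1) x)"
proof -
  let ?Z = "centralizer (Bgrp n) y"
  let ?Zs = "{x \<in> ?Z. s \<in> reps n x y}"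
  let ?K = "shifts y s"
  have sp: "s \<in> pm n" using s by (auto simp: pm_def)
  have finZ: "finite ?Z" using finite_Bgrp by (auto simp: centralizer_def)
  have cardK: "card ?K = card (block y s)" by (rule bij_betw_same_card[OF shifts_bij[OF y]])
  have "finite (block y s)" using finite_subset[OF block_subset_pm[OF y sp]] by simp
  then have cardK0: "card ?K \<noteq> 0"
    using cardK self_in_block[OF Bgrp_permutation[OF y], of s] by (auto simp: card_eq_0_iff)
  have shift: "(\<Sum>x\<in>?Zs. F (x \<circ> \<kappa>)) = (\<Sum>x\<in>?Zs. F x)" if k: "\<kappa> \<in> ?K" for \<kappa> and F :: "_ \<Rightarrow> complex"
  proof -
    have kB: "\<kappa> \<in> carrier (Bgrp n)" by (rule shifts_Bgrp[OF y sp k])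
    have ky: "y \<circ> \<kappa> = \<kappa> \<circ> y" by (rule shifts_commute[OF y y refl k block_apply_iff[OF y]])
    have "(\<lambda>x. x \<circ> \<kappa>) ` ?Zs \<subseteq> ?Zs"
    proof
      fix z assume "z \<in> (\<lambda>x. x \<circ> \<kappa>) ` ?Zs"
      then obtain x where x: "x \<in> ?Zs" "z = x \<circ> \<kappa>" by blast
      then have xB: "x \<in> carrier (Bgrp n)" "x \<circ> y = y \<circ> x" "s \<in> reps n x y"
        by (auto simp: in_centralizer_iff)
      have "reps n z y = reps n x y" unfolding reps_def x(2) linked_shift[OF xB(1) y sp k] ..
      moreover have "z \<circ> y = y \<circ> z" unfolding x(2) using xB(2) ky by (metis comp_assoc)
      ultimately show "z \<in> ?Zs" using xB(3) Bgrp_compose[OF xB(1) kB] by (simp add: in_centralizer_iff x(2))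
    qed
    moreover have inj: "inj_on (\<lambda>x. x \<circ> \<kappa>) ?Zs"
    proof (rule inj_onI)
      fix x x' assume "x \<circ> \<kappa> = x' \<circ> \<kappa>"
      then show "x = x'" using permutes_surj[OF Bgrp_permutes[OF kB]]
        by (metis surj_fun_eq comp_apply)
    qed
    ultimately have "bij_betw (\<lambda>x. x \<circ> \<kappa>) ?Zs ?Zs"
      using endo_inj_surj[of ?Zs] finZ by (simp add: bij_betw_def)
    then show ?thesis by (rule sum.reindex_bij_betw)
  qed
  have average: "of_nat (card ?K) * (\<Sum>x\<in>?Zs. F x) = (\<Sum>x\<in>?Zs. \<Sum>\<kappa>\<in>?K. F (x \<circ> \<kappa>))" for F :: "_ \<Rightarrow> complex"
    by (subst sum.swap) (simp add: shift)
  have "(\<Sum>\<kappa>\<in>?K. hybrid n k y s (x \<circ> \<kappa>)) = (\<Sum>\<kappa>\<in>?K. hybrid n k y (s + 1) (x \<circ> \<kappa>))" if "x \<in> ?Zs" for x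
  proof -
    have x: "x \<in> carrier (Bgrp n)" "x \<circ> y = y \<circ> x" "s \<in> reps n x y"
      using that by (auto simp: in_centralizer_iff)
    obtain c where c: "\<And>\<kappa>. \<kappa> \<in> ?K \<Longrightarrow> hybrid n k y s (x \<circ> \<kappa>) = c * Lie_weight k y (x \<circ> \<kappa>) s"
      "\<And>\<kappa>. \<kappa> \<in> ?K \<Longrightarrow> hybrid n k y (s + 1) (x \<circ> \<kappa>) = c * root_weight k y (x \<circ> \<kappa>) s"
      using hybrid_shift[OF x(1) y x(3)] by blast
    then show ?thesis using shift_sum[OF x(1) y x(2) sp, of k] by (simp flip: sum_distrib_left)
  qed
  then have "of_nat (card ?K) * (\<Sum>x\<in>?Zs. hybrid n k y s x) = of_nat (card ?K) * (\<Sum>x\<in>?Zs. hybrid n k y (s + 1) x)"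
    unfolding average by (rule sum.cong[OF refl])
  then have on: "(\<Sum>x\<in>?Zs. hybrid n k y s x) = (\<Sum>x\<in>?Zs. hybrid n k y (s + 1) x)"
    using cardK0 by simp
  have off: "hybrid n k y s x = hybrid n k y (s + 1) x" if "s \<notin> reps n x y" for x
    unfolding hybrid_def using that by (intro prod.cong refl if_cong) (auto simp: less_le)
  have split: "(\<Sum>x\<in>?Z. F x) = (\<Sum>x\<in>?Zs. F x) + (\<Sum>x\<in>?Z - ?Zs. F x)" for F :: "_ \<Rightarrow> complex"
    using finZ by (subst sum.subset_diff[of ?Zs ?Z]) auto
  show ?thesis
    unfolding split on using off by (intro arg_cong2[of _ _ _ _ "(+)"] refl sum.cong) auto
qed

lemma hybrid_invariant:
  assumes y: "y \<in> carrier (Bgrp n)"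
  shows "(\<Sum>x\<in>centralizer (Bgrp n) y. hybrid n k y 1 x) = (\<Sum>x\<in>centralizer (Bgrp n) y. hybrid n k y (int n + 1) x)"
proof -
  have "m \<le> n \<Longrightarrow> (\<Sum>x\<in>centralizer (Bgrp n) y. hybrid n k y 1 x) =
      (\<Sum>x\<in>centralizer (Bgrp n) y. hybrid n k y (int m + 1) x)" for m
  proof (induction m)
    case (Suc m)
    then show ?case using hybrid_step[OF y, of "int m + 1" k] by (simp add: algebra_simps)
  qed simp
  then show ?thesis by simp
qed

section \<open>The character chi as a product over orbits\<close>

lemma prod_ratio_sgn:
  fixes c :: "nat \<Rightarrow> int"
  assumes "\<And>s. c s \<noteq> 0"
  shows "(\<Prod>s<l. sgn (c (Suc s)) * sgn (c s)) = sgn (c l) * sgn (c 0)"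
proof (induction l)
  case 0
  then show ?case using assms[of 0] by (simp add: sgn_if)
next
  case (Suc l)
  then show ?case using assms[of l] by (simp add: sgn_if)
qed

text \<open>Let l be the first time at which x^l p is p or - p. The absolute values of the first l
  iterates are the positive entries of the block, and by oddness the sign at each is the product of
  the signs of two consecutive iterates. The product telescopes to the sign of x^l p, and x^l p = -
  p exactly for class -1.\<close>

lemma sign_of_signed_cycle:
  assumes x: "x \<in> carrier (Bgrp n)" and p: "p \<in> pm n" "p > 0"
  shows "(\<Prod>i | i \<in> block x p \<and> i > 0. sgn (x i)) = (if - p \<in> orbit x p then - 1 else 1)"
proof -
  note px = Bgrp_permutation[OF x] and ox = Bgrp_odd[OF x]
  \<comment> \<open>With the identity in place of \<open>y\<close>, \<open>first_return_dvd\<close>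
    describes the return up to sign.\<close>
  have blk_id: "block id p = {p, - p}" by (auto simp: block_iff[OF permutation_id])
  define l where "l = (LEAST l. 0 < l \<and> (x ^^ l) p \<in> {p, - p})"
  obtain N where "N > 0" "x ^^ N = id" by (rule permutation_period[OF px])
  then have "0 < N \<and> (x ^^ N) p \<in> {p, - p}" by simp
  then have l: "0 < l \<and> (x ^^ l) p \<in> {p, - p}" unfolding l_def by (rule LeastI)
  have least: "(x ^^ j) p \<notin> {p, - p}" if "0 < j" "j < l" for j
    using not_less_Least[of j "\<lambda>l. 0 < l \<and> (x ^^ l) p \<in> {p, - p}"] that by (auto simp: l_def)
  have ret: "(x ^^ j) p \<in> {p, - p} \<longleftrightarrow> l dvd j" for j
    using first_return_dvd[OF x Bgrp_id, of l p j] l least by (simp add: blk_id)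
  have nz: "(x ^^ s) p \<noteq> 0" for s
    using Bgrp_in_pm[OF Bgrp_funpow[OF x], of s p] p by (auto simp: pm_def)
  have inj': False if st: "s < t" "t < l" "\<bar>(x ^^ s) p\<bar> = \<bar>(x ^^ t) p\<bar>" for s t
  proof -
    have "(x ^^ t) p = (x ^^ s) ((x ^^ (t - s)) p)"
      using st(1) by (metis comp_apply funpow_add le_add_diff_inverse less_imp_le)
    moreover have "(x ^^ t) p = (x ^^ s) p \<or> (x ^^ t) p = (x ^^ s) (- p)"
      using st(3) odd_funpow[of x, OF ox] by (auto simp: abs_eq_iff)
    ultimately have "(x ^^ (t - s)) p \<in> {p, - p}"
      using Bgrp_inj[OF Bgrp_funpow[OF x, of s]] by (auto dest: injD)
    then show False using least[of "t - s"] st(1,2) by (metis less_imp_diff_less zero_less_diff)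
  qed
  have inj: "inj_on (\<lambda>s. \<bar>(x ^^ s) p\<bar>) {..<l}"
  proof (rule inj_onI)
    fix s t assume "s \<in> {..<l}" "t \<in> {..<l}" "\<bar>(x ^^ s) p\<bar> = \<bar>(x ^^ t) p\<bar>"
    then show "s = t" using inj'[of s t] inj'[of t s] by (metis lessThan_iff linorder_neqE_nat)
  qed
  have abs_mod: "\<bar>(x ^^ s) p\<bar> = \<bar>(x ^^ (s mod l)) p\<bar>" for s
  proof -
    have "(x ^^ s) p = (x ^^ (s mod l)) ((x ^^ (l * (s div l))) p)"
      by (metis comp_apply funpow_add mod_mult_div_eq)
    moreover have "(x ^^ (l * (s div l))) p \<in> {p, - p}" by (simp only: ret dvd_triv_left)
    ultimately show ?thesis using odd_funpow[of x, OF ox] by auto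
  qed
  have img: "(\<lambda>s. \<bar>(x ^^ s) p\<bar>) ` {..<l} = {i. i \<in> block x p \<and> i > 0}"
  proof (intro equalityI subsetI)
    fix i assume "i \<in> (\<lambda>s. \<bar>(x ^^ s) p\<bar>) ` {..<l}"
    then obtain s where "i = \<bar>(x ^^ s) p\<bar>" by blast
    then show "i \<in> {i. i \<in> block x p \<and> i > 0}"
      using nz[of s] by (auto simp: block_iff[OF px] abs_if)
  next
    fix i assume "i \<in> {i. i \<in> block x p \<and> i > 0}"
    then obtain s where "i = (x ^^ s) p \<or> i = - (x ^^ s) p" "i > 0" by (auto simp: block_iff[OF px])
    then have "i = \<bar>(x ^^ s) p\<bar>" by auto
    then show "i \<in> (\<lambda>s. \<bar>(x ^^ s) p\<bar>) ` {..<l}"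
      using abs_mod[of s] l by (intro image_eqI[of _ _ "s mod l"]) auto
  qed
  have "(\<Prod>i | i \<in> block x p \<and> i > 0. sgn (x i)) = (\<Prod>s<l. sgn (x \<bar>(x ^^ s) p\<bar>))"
    unfolding img[symmetric] by (subst prod.reindex[OF inj]) simp
  also have "\<dots> = (\<Prod>s<l. sgn ((x ^^ Suc s) p) * sgn ((x ^^ s) p))"
  proof (rule prod.cong[OF refl])
    fix s
    show "sgn (x \<bar>(x ^^ s) p\<bar>) = sgn ((x ^^ Suc s) p) * sgn ((x ^^ s) p)"
      using nz[of s] by (cases "(x ^^ s) p > 0") (auto simp: abs_if ox)
  qed
  also have "\<dots> = sgn ((x ^^ l) p)" using prod_ratio_sgn[of "\<lambda>s. (x ^^ s) p" l] nz p by simp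
  also have "\<dots> = (if - p \<in> orbit x p then - 1 else 1)"
  proof (cases "(x ^^ l) p = - p")
    case True
    then have "- p \<in> orbit x p" by (metis in_orbit_iff[OF px])
    then show ?thesis using True p by simp
  next
    case False
    then have lp: "(x ^^ l) p = p" using l by auto
    have "- p \<notin> orbit x p"
    proof
      assume "- p \<in> orbit x p"
      then obtain j where j: "(x ^^ j) p = - p" by (auto simp: in_orbit_iff[OF px])
      then have "l dvd j" using ret[of j] by simp
      moreover have "card (orbit x p) dvd l" using lp by (simp add: funpow_eq_self_iff[OF px])
      ultimately have "(x ^^ j) p = p" by (meson dvd_trans funpow_eq_self_iff[OF px])
      then show False using j p by simp
    qed
    then show ?thesis using lp p by simp
  qed
  finally show ?thesis .
qed

text \<open>A power of \<open>x\<close> adds nothing to the group generated by \<open>x\<close> and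
  negation, so the orbits for a root of \<open>y\<close> are its signed cycles.\<close>

lemma linked_power:
  assumes x: "x \<in> carrier (Bgrp n)" and "x ^^ k = y"
  shows "(p, i) \<in> linked x y \<longleftrightarrow> i \<in> block x p"
proof
  note px = Bgrp_permutation[OF x] and ox = Bgrp_odd[OF x]
  show "i \<in> block x p" if "(p, i) \<in> linked x y"
  proof (rule linked_closed[OF that])
    show "x l \<in> block x p" "- l \<in> block x p" if "l \<in> block x p" for l
      using that block_apply_iff[OF x] block_uminus_iff[OF x] by simp_all
    show "y l \<in> block x p" if "l \<in> block x p" for l
      unfolding assms(2)[symmetric] by (rule block_closed(1)[of x, OF px ox that])
  qed (rule self_in_block[OF px])
  show "(p, i) \<in> linked x y" if "i \<in> block x p"
    using that by (auto simp: block_iff[OF px] intro: linked_funpow linked_trans[OF linked_funpow(1) linked_step(3)])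
qed

lemma chi_prod_reps:
  assumes x: "x \<in> carrier (Bgrp n)" and y: "x ^^ k = y"
  shows "chi n x = (\<Prod>p\<in>reps n x y. if - p \<in> orbit x p then - 1 else 1)"
proof -
  have yB: "y \<in> carrier (Bgrp n)" using Bgrp_funpow[OF x] y by blast
  note px = Bgrp_permutation[OF x] and py = Bgrp_permutation[OF yB]
  let ?A = "\<lambda>p. {i. i \<in> block x p \<and> i > 0}"
  have sub: "?A p \<subseteq> {1..int n}" if "p \<in> reps n x y" for p
    using block_subset_pm[OF x reps_pm[OF that]] by (force simp: pm_def)
  have fin: "finite (?A p)" if "p \<in> reps n x y" for p
    using finite_subset[OF sub[OF that]] by simp
  have "{1..int n} = (\<Union>p\<in>reps n x y. ?A p)"
  proof (intro equalityI subsetI)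
    fix i assume i: "i \<in> {1..int n}"
    then have "i \<in> pm n" by (auto simp: pm_def)
    then obtain p where "p \<in> reps n x y" "(p, i) \<in> linked x y" by (rule reps_exists[OF x yB])
    then show "i \<in> (\<Union>p\<in>reps n x y. ?A p)" using i by (auto simp: linked_power[OF x y])
  qed (use sub in blast)
  then have "(\<Prod>i\<in>{1..int n}. sgn (x i)) = (\<Prod>p\<in>reps n x y. \<Prod>i\<in>?A p. sgn (x i))"
  proof (simp only:, intro prod.UNION_disjoint ballI impI)
    fix p q assume pq: "p \<in> reps n x y" "q \<in> reps n x y" "p \<noteq> q"
    show "?A p \<inter> ?A q = {}"
    proof (rule ccontr)
      assume "?A p \<inter> ?A q \<noteq> {}"
      then obtain i where "(p, i) \<in> linked x y" "(q, i) \<in> linked x y"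
        by (auto simp: linked_power[OF x y])
      then have "(p, q) \<in> linked x y" using linked_sym[OF px py] linked_trans by blast
      then show False using reps_unique[OF px py pq(1,2)] pq(3) by simp
    qed
  qed (use fin in auto)
  also have "\<dots> = (\<Prod>p\<in>reps n x y. if - p \<in> orbit x p then - 1 else 1)"
    using sign_of_signed_cycle[OF x reps_pm reps_pos] by (intro prod.cong) auto
  finally have "(\<Prod>i\<in>{1..int n}. sgn (x i)) = (\<Prod>p\<in>reps n x y. if - p \<in> orbit x p then - 1 else 1)" .
  then have "of_int (\<Prod>i\<in>{1..int n}. sgn (x i)) = (of_int (\<Prod>p\<in>reps n x y. if - p \<in> orbit x p then - 1 else 1) :: complex)"
    by simp
  then show ?thesis by (simp add: chi_def if_distrib cong: if_cong)
qed

text \<open>The set on which \<open>x ^^ k\<close> and \<open>z\<close> agree is closed under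
  \<open>x\<close>, \<open>y\<close> and negation, since both maps commute with these. It is applied
  to z = w0 and to z = y, at the two ends of the interpolation.\<close>

lemma pow_eq_of_reps:
  assumes x: "x \<in> carrier (Bgrp n)" and y: "y \<in> carrier (Bgrp n)" and comm: "x \<circ> y = y \<circ> x"
    and z: "z \<in> carrier (Bgrp n)" "z \<circ> x = x \<circ> z" "z \<circ> y = y \<circ> z"
    and eq: "\<And>p. p \<in> reps n x y \<Longrightarrow> (x ^^ k) p = z p"
  shows "x ^^ k = z"
proof
  fix i
  show "(x ^^ k) i = z i"
  proof (cases "i \<in> pm n")
    case False
    then show ?thesis using Bgrp_outside[OF z(1)] Bgrp_outside[OF Bgrp_funpow[OF x]] by simp
  next
    case True
    then obtain p where p: "p \<in> reps n x y" "(p, i) \<in> linked x y" by (rule reps_exists[OF x y])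
    have "i \<in> {i. (x ^^ k) i = z i}"
    proof (rule linked_closed[OF p(2)])
      fix l assume "l \<in> {i. (x ^^ k) i = z i}"
      then have l: "(x ^^ k) l = z l" by simp
      show "x l \<in> {i. (x ^^ k) i = z i}"
        using l fun_cong[OF z(2), of l] by (simp add: funpow_swap1[symmetric])
      show "y l \<in> {i. (x ^^ k) i = z i}"
        using l fun_cong[OF z(3), of l] funpow_commute[OF comm[symmetric], of k l] by simp
      show "- l \<in> {i. (x ^^ k) i = z i}"
        using l by (simp add: odd_funpow[of x, OF Bgrp_odd[OF x]] Bgrp_odd[OF z(1)])
    qed (use eq p in simp)
    then show ?thesis by simp
  qed
qed

definition Lie_product :: "nat \<Rightarrow> (int \<Rightarrow> int) \<Rightarrow> (int \<Rightarrow> int) \<Rightarrow> complex" where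
  "Lie_product n x y = (\<Prod>p\<in>reps n x y. phase x y p)"

lemma w0_comm:
  assumes "x \<in> carrier (Bgrp n)" shows "w0 n \<circ> x = x \<circ> w0 n"
  using Bgrp_in_pm[OF assms] Bgrp_odd[OF assms] by (auto simp: w0_def fun_eq_iff)

lemma hybrid_first:
  assumes x: "x \<in> carrier (Bgrp n)" and y: "y \<in> carrier (Bgrp n)" and comm: "x \<circ> y = y \<circ> x"
  shows "hybrid n k y 1 x = (if x ^^ k = w0 n then Lie_product n x y else 0)"
proof -
  have h: "hybrid n k y 1 x = (\<Prod>p\<in>reps n x y. Lie_weight k y x p)"
    unfolding hybrid_def by (intro prod.cong refl) (auto dest: reps_pos)
  have w: "w0 n p = - p" if "p \<in> reps n x y" for p using reps_pm[OF that] by (simp add: w0_def)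
  show ?thesis
  proof (cases "x ^^ k = w0 n")
    case True
    then show ?thesis unfolding h Lie_product_def
      by (auto simp: Lie_weight_def w intro!: prod.cong)
  next
    case False
    then obtain p where p: "p \<in> reps n x y" "(x ^^ k) p \<noteq> w0 n p"
      using pow_eq_of_reps[OF x y comm w0_in_Bgrp w0_comm[OF x] w0_comm[OF y]] by blast
    then have "Lie_weight k y x p = 0" by (simp add: Lie_weight_def w)
    then show ?thesis unfolding h using False p(1) by (auto intro!: prod_zero)
  qed
qed

lemma hybrid_last:
  assumes x: "x \<in> carrier (Bgrp n)" and y: "y \<in> carrier (Bgrp n)" and comm: "x \<circ> y = y \<circ> x"
  shows "hybrid n k y (int n + 1) x = (if x ^^ k = y then chi n x else 0)"
proof -
  have h: "hybrid n k y (int n + 1) x = (\<Prod>p\<in>reps n x y. root_weight k y x p)"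
    unfolding hybrid_def by (intro prod.cong refl) (auto simp: reps_def)
  show ?thesis
  proof (cases "x ^^ k = y")
    case True
    then show ?thesis unfolding h chi_prod_reps[OF x True]
      by (auto simp: root_weight_def intro!: prod.cong)
  next
    case False
    then obtain p where p: "p \<in> reps n x y" "(x ^^ k) p \<noteq> y p"
      using pow_eq_of_reps[OF x y comm y comm[symmetric] refl] by blast
    then have "root_weight k y x p = 0" by (simp add: root_weight_def)
    then show ?thesis unfolding h using False p(1) by (auto intro!: prod_zero)
  qed
qed

lemma sum_Lie_product:
  assumes y: "y \<in> carrier (Bgrp n)"
  shows "(\<Sum>x | x \<in> centralizer (Bgrp n) y \<and> x ^^ k = w0 n. Lie_product n x y) =
         (\<Sum>x | x \<in> carrier (Bgrp n) \<and> x ^^ k = y. chi n x)"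
proof -
  let ?Z = "centralizer (Bgrp n) y"
  have fin: "finite ?Z" using finite_Bgrp by (auto simp: centralizer_def)
  have Z: "x \<in> carrier (Bgrp n)" "x \<circ> y = y \<circ> x" if "x \<in> ?Z" for x
    using that by (auto simp: in_centralizer_iff)
  have roots: "x \<in> ?Z" if "x \<in> carrier (Bgrp n)" "x ^^ k = y" for x
    using that funpow_circ_commute[of x x k] by (simp add: in_centralizer_iff)
  have "(\<Sum>x | x \<in> ?Z \<and> x ^^ k = w0 n. Lie_product n x y) = (\<Sum>x\<in>?Z. hybrid n k y 1 x)"
    using fin by (intro sum.mono_neutral_cong_left) (auto simp: hybrid_first[OF Z(1) y Z(2)])
  also have "\<dots> = (\<Sum>x\<in>?Z. hybrid n k y (int n + 1) x)" by (rule hybrid_invariant[OF y])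
  also have "\<dots> = (\<Sum>x | x \<in> ?Z \<and> x ^^ k = y. chi n x)"
    using fin by (intro sum.mono_neutral_cong_right) (auto simp: hybrid_last[OF Z(1) y Z(2)])
  also have "{x. x \<in> ?Z \<and> x ^^ k = y} = {x. x \<in> carrier (Bgrp n) \<and> x ^^ k = y}"
    using roots Z(1) by blast
  finally show ?thesis .
qed

subsection \<open>Characters of centralizers\<close>

definition base_point :: "(int \<Rightarrow> int) \<Rightarrow> int set \<Rightarrow> int \<Rightarrow> int" where
  "base_point x P i = (THE p. p \<in> P \<and> i \<in> block x p)"

text \<open>Together with the base point this gives coordinates on \<open>pm n\<close>. The least
  choice gives base points the index 0, which makes the character below trivial on the
  complement.\<close>

definition base_index :: "(int \<Rightarrow> int) \<Rightarrow> int set \<Rightarrow> int \<Rightarrow> nat" where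
  "base_index x P i = (LEAST j. (x ^^ j) (base_point x P i) = i)"

text \<open>The situation of a root of \<open>w0\<close>: all signed cycles have class -1. Each
  block is then a single cycle, and the base group is a product of cyclic groups generated by the
  signed cycles.\<close>

locale negative_perm =
  fixes n :: nat and x :: "int \<Rightarrow> int" and P :: "int set"
  assumes x: "x \<in> carrier (Bgrp n)" and neg: "\<And>i. i \<in> pm n \<Longrightarrow> - i \<in> orbit x i"
    and base: "base_points n x P"
begin

abbreviation "bp \<equiv> base_point x P"
abbreviation "ix \<equiv> base_index x P"
abbreviation "len p \<equiv> card (orbit x p)"

lemmas px = Bgrp_permutation[OF x]

lemma odd_x: "(x ^^ m) (- i) = - (x ^^ m) i"
  by (rule odd_funpow[of x, OF Bgrp_odd[OF x]])

lemma x_pm: "(x ^^ m) i \<in> pm n \<longleftrightarrow> i \<in> pm n"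
  by (rule Bgrp_in_pm[OF Bgrp_funpow[OF x]])

lemma P_pm: "p \<in> P \<Longrightarrow> p \<in> pm n"
  using base by (auto simp: base_points_def)

lemma finite_P: "finite P"
  by (rule finite_subset[of _ "pm n"]) (auto simp: P_pm)

lemma block_eq_orbit:
  assumes "p \<in> pm n" shows "block x p = orbit x p"
proof -
  have "- v \<in> orbit x p" if v: "v \<in> orbit x p" for v
  proof -
    obtain t where "v = (x ^^ t) p" using v by (auto simp: in_orbit_iff[OF px])
    then have "- v = (x ^^ t) (- p)" by (simp add: odd_x)
    then show ?thesis using funpow_in_orbit[OF neg[OF assms]] by simp
  qed
  then show ?thesis by (auto simp: block_def)
qed

lemma bp:
  assumes "i \<in> pm n" shows "bp i \<in> P" "(x ^^ ix i) (bp i) = i"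
proof -
  have ex: "\<exists>!p. p \<in> P \<and> i \<in> block x p" using base assms by (auto simp: base_points_def)
  have *: "bp i \<in> P \<and> i \<in> block x (bp i)" unfolding base_point_def by (rule theI'[OF ex])
  then show "bp i \<in> P" by simp
  have "i \<in> orbit x (bp i)" using * block_eq_orbit[OF P_pm] by blast
  then obtain j where "(x ^^ j) (bp i) = i" unfolding in_orbit_iff[OF px] by metis
  then show "(x ^^ ix i) (bp i) = i" unfolding base_index_def by (rule LeastI)
qed

lemma bp_x:
  assumes "p \<in> P" shows "bp ((x ^^ j) p) = p"
proof -
  let ?i = "(x ^^ j) p"
  have i: "?i \<in> pm n" using P_pm[OF assms] by (simp add: x_pm)
  have "\<exists>!p. p \<in> P \<and> ?i \<in> block x p" using base i by (auto simp: base_points_def)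
  moreover have "p \<in> P \<and> ?i \<in> block x p" using assms by (auto simp: block_iff[OF px])
  ultimately show ?thesis unfolding base_point_def by (rule the1_equality)
qed

lemma bp_self: "p \<in> P \<Longrightarrow> bp p = p"
  using bp_x[of p 0] by simp

lemma x_eq_iff: "(x ^^ s) p = (x ^^ t) p \<longleftrightarrow> [s = t] (mod len p)"
  by (rule funpow_eq_iff_cong[OF px])

lemma ix_x:
  assumes "p \<in> P" shows "[ix ((x ^^ j) p) = j] (mod len p)"
  using bp(2)[of "(x ^^ j) p"] P_pm[OF assms] by (simp add: x_pm bp_x[OF assms] x_eq_iff)

lemma bp_orbit:
  assumes "i \<in> pm n" "j \<in> orbit x i" shows "bp j = bp i"
proof -
  obtain a where "j = (x ^^ a) i" using assms(2) by (auto simp: in_orbit_iff[OF px])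
  then have "j = (x ^^ (a + ix i)) (bp i)" using bp(2)[OF assms(1)] by (simp add: funpow_add)
  then show ?thesis using bp_x[OF bp(1)[OF assms(1)]] by simp
qed

lemma bp_funpow: "i \<in> pm n \<Longrightarrow> bp ((x ^^ m) i) = bp i"
  by (rule bp_orbit) (auto simp: in_orbit_iff[OF px])

lemma bp_uminus: "i \<in> pm n \<Longrightarrow> bp (- i) = bp i"
  by (rule bp_orbit[OF _ neg])

lemma orbit_bp: "i \<in> pm n \<Longrightarrow> orbit x (bp i) = orbit x i"
  by (metis bp(2) in_orbit_iff[OF px] orbit_eq_of_mem[OF px])

lemma len_bp: "i \<in> pm n \<Longrightarrow> len (bp i) = len i"
  by (simp add: orbit_bp)

text \<open>The elements of the base group, given by an exponent for each signed cycle.\<close>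

definition spin :: "(int \<Rightarrow> nat) \<Rightarrow> int \<Rightarrow> int" where
  "spin e i = (if i \<in> pm n then (x ^^ e (bp i)) i else i)"

lemma spin_spin: "spin e \<circ> spin f = spin (\<lambda>p. e p + f p)"
  by (auto simp: spin_def fun_eq_iff x_pm bp_funpow funpow_add)

lemma spin_cong:
  assumes "\<And>p. p \<in> P \<Longrightarrow> [e p = f p] (mod len p)" shows "spin e = spin f"
proof
  fix i
  show "spin e i = spin f i"
    using assms[OF bp(1)[of i]] by (auto simp: spin_def x_eq_iff len_bp)
qed

lemma spin_zero: "spin (\<lambda>p. 0) = id"
  by (auto simp: spin_def)

lemma spin_funpow: "spin e ^^ m = spin (\<lambda>p. m * e p)"
  by (induction m) (simp_all add: spin_zero spin_spin)

lemma spin_Bgrp: "spin e \<in> carrier (Bgrp n)"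
  unfolding Bgrp_iff
proof
  \<comment> \<open>The exponents of the inverse are chosen so that each sum of exponents is a
    multiple of the cycle length.\<close>
  obtain e' where e': "spin e \<circ> spin e' = id" "spin e' \<circ> spin e = id"
  proof -
    let ?f = "\<lambda>p. (len p - 1) * e p"
    have "e p + ?f p = len p * e p" "?f p + e p = len p * e p" for p
      using card_orbit_pos[OF px, of p] by (cases "len p"; auto)+
    then have "spin e \<circ> spin ?f = spin (\<lambda>p. 0)" "spin ?f \<circ> spin e = spin (\<lambda>p. 0)"
      unfolding spin_spin by (auto intro!: spin_cong simp: cong_0_iff)
    then show ?thesis using that[of ?f] by (simp add: spin_zero)
  qed
  have "bij_betw (spin e) (pm n) (pm n)"
    by (rule bij_betwI[where g = "spin e'"])
      (use e' in \<open>auto simp: fun_eq_iff spin_def x_pm split: if_splits\<close>)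
  then show "spin e permutes pm n" by (rule bij_imp_permutes) (simp add: spin_def)
  show "\<forall>i. spin e (- i) = - spin e i" by (auto simp: spin_def bp_uminus odd_x)
qed

lemma spin_comm: "spin e \<circ> x = x \<circ> spin e"
  using bp_funpow[of _ 1] Bgrp_in_pm[OF x] by (auto simp: spin_def fun_eq_iff funpow_swap1)

lemma spin_centralizer: "spin e \<in> centralizer (Bgrp n) x"
  by (simp add: in_centralizer_iff spin_Bgrp spin_comm)

lemma in_orbit_base_iff:
  assumes "p \<in> P" shows "i \<in> orbit x p \<longleftrightarrow> i \<in> pm n \<and> bp i = p"
proof
  assume i: "i \<in> orbit x p"
  have "i \<in> pm n" using i permutes_orbit_subset[OF Bgrp_permutes[OF x] P_pm[OF assms]] by blast
  moreover have "bp i = p" using bp_orbit[OF P_pm[OF assms] i] bp_self[OF assms] by simp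
  ultimately show "i \<in> pm n \<and> bp i = p" ..
next
  assume i: "i \<in> pm n \<and> bp i = p"
  then have "orbit x p = orbit x i" using orbit_bp by blast
  then show "i \<in> orbit x p" by (simp add: permutation_self_in_orbit[OF px])
qed

lemma signed_cycle_spin:
  assumes "p \<in> P" shows "signed_cycle x p = spin (\<lambda>q. if q = p then 1 else 0)"
  by (auto simp: fun_eq_iff signed_cycle_def perm_restrict_def block_eq_orbit[OF P_pm[OF assms]]
      in_orbit_base_iff[OF assms] spin_def)

lemma centralizer_pm: "z \<in> centralizer (Bgrp n) x \<Longrightarrow> z i \<in> pm n \<longleftrightarrow> i \<in> pm n"
  by (simp add: in_centralizer_iff Bgrp_in_pm)

lemma centralizer_pow: "z \<in> centralizer (Bgrp n) x \<Longrightarrow> z ((x ^^ m) i) = (x ^^ m) (z i)"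
  using funpow_commute[of z x m i] by (simp add: in_centralizer_iff)

lemma bp_centralizer:
  assumes z: "z \<in> centralizer (Bgrp n) x" and i: "i \<in> pm n"
  shows "bp (z i) = bp (z (bp i))"
proof -
  have "z i = (x ^^ ix i) (z (bp i))" using bp(2)[OF i] centralizer_pow[OF z] by metis
  then show ?thesis using bp_funpow[of "z (bp i)"] P_pm[OF bp(1)[OF i]] centralizer_pm[OF z] by simp
qed

lemma len_centralizer:
  assumes z: "z \<in> centralizer (Bgrp n) x" shows "len (z i) = len i"
  using z card_orbit_commute[OF px Bgrp_inj[of z n]] by (simp add: in_centralizer_iff)

lemma bp_centralizer_inj:
  assumes z: "z \<in> centralizer (Bgrp n) x" shows "inj_on (\<lambda>p. bp (z p)) P"
proof (rule inj_onI)
  fix p q assume pq: "p \<in> P" "q \<in> P" "bp (z p) = bp (z q)"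
  have zB: "z \<in> carrier (Bgrp n)" "z \<circ> x = x \<circ> z" using z by (auto simp: in_centralizer_iff)
  have "orbit x (z p) = orbit x (z q)"
    using orbit_bp[of "z p"] orbit_bp[of "z q"] pq P_pm centralizer_pm[OF z] by metis
  then have "z ` orbit x p = z ` orbit x q" unfolding orbit_commute_image[OF px zB(2)] .
  then have "orbit x p = orbit x q" using Bgrp_inj[OF zB(1)] by (simp add: inj_image_eq_iff)
  then have "q \<in> orbit x p" using permutation_self_in_orbit[OF px] by metis
  then have "bp q = bp p" by (rule bp_orbit[OF P_pm[OF pq(1)]])
  then show "p = q" using pq bp_self by simp
qed

lemma bp_centralizer_bij:
  assumes z: "z \<in> centralizer (Bgrp n) x" shows "bij_betw (\<lambda>p. bp (z p)) P P"
proof -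
  have "(\<lambda>p. bp (z p)) ` P \<subseteq> P" using bp(1) P_pm centralizer_pm[OF z] by blast
  then show ?thesis
    using endo_inj_surj[OF finite_P _ bp_centralizer_inj[OF z]] bp_centralizer_inj[OF z]
    by (simp add: bij_betw_def)
qed

text \<open>The complement factor is \<open>t = z \<circ> (spin e)\<^sup>-\<^sup>1\<close>; the exponents \<open>(len p - 1) * e p\<close> express the
  inverse without negative powers.\<close>

lemma factor_centralizer:
  assumes z: "z \<in> centralizer (Bgrp n) x"
  obtains t where "t \<in> cycle_complement n x P" "z = t \<circ> spin (\<lambda>p. ix (z p))"
    "\<And>p. p \<in> P \<Longrightarrow> t p = bp (z p)"
proof
  let ?e = "\<lambda>p. ix (z p)"
  let ?f = "\<lambda>p. (len p - 1) * ix (z p)"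
  define t where "t = z \<circ> spin ?f"
  have zB: "z \<in> carrier (Bgrp n)" "z \<circ> x = x \<circ> z" using z by (auto simp: in_centralizer_iff)
  have ef: "?f p + ?e p = len p * ?e p" for p
    using card_orbit_pos[OF px, of p] by (cases "len p") auto
  have "t \<circ> x = x \<circ> t"
    using fun_cong[OF spin_comm[of ?f]] fun_cong[OF zB(2)] by (simp add: t_def fun_eq_iff)
  then have tZ: "t \<in> centralizer (Bgrp n) x"
    unfolding t_def by (simp add: in_centralizer_iff Bgrp_compose zB(1) spin_Bgrp)
  show tp: "t p = bp (z p)" if p: "p \<in> P" for p
  proof -
    have zp: "z p \<in> pm n" using P_pm[OF p] centralizer_pm[OF z] by simp
    have "t p = (x ^^ ?f p) (z p)"
      using P_pm[OF p] by (simp add: t_def spin_def bp_self[OF p] centralizer_pow[OF z])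
    also have "\<dots> = (x ^^ (?f p + ?e p)) (bp (z p))"
      using bp(2)[OF zp] by (simp add: funpow_add)
    also have "\<dots> = (x ^^ 0) (bp (z p))"
      unfolding x_eq_iff ef by (simp add: len_bp[OF zp] len_centralizer[OF z] cong_0_iff)
    finally show ?thesis by simp
  qed
  have "t ` P = (\<lambda>p. bp (z p)) ` P" using tp by (rule image_cong[OF refl])
  also have "\<dots> = P" using bp_centralizer_bij[OF z] by (simp add: bij_betw_def)
  finally show "t \<in> cycle_complement n x P" using tZ by (simp add: cycle_complement_def)
  have "spin ?f \<circ> spin ?e = spin (\<lambda>p. 0)"
    unfolding spin_spin by (rule spin_cong) (simp only: ef cong_0_iff dvd_triv_left)
  then show "z = t \<circ> spin ?e" by (simp add: t_def comp_assoc spin_zero)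
qed

section \<open>Linear characters of the centralizer\<close>

lemma linear_characterD:
  assumes "linear_character (Bgrp n) (centralizer (Bgrp n) x) \<omega>"
  shows "\<And>a b. a \<in> centralizer (Bgrp n) x \<Longrightarrow> b \<in> centralizer (Bgrp n) x \<Longrightarrow> \<omega> (a \<circ> b) = \<omega> a * \<omega> b"
    and "\<And>a. a \<in> centralizer (Bgrp n) x \<Longrightarrow> \<omega> a \<noteq> 0" and "\<omega> id = 1"
proof -
  show m: "\<omega> (a \<circ> b) = \<omega> a * \<omega> b" if "a \<in> centralizer (Bgrp n) x" "b \<in> centralizer (Bgrp n) x" for a b
    using assms that by (simp add: linear_character_def hom_def complex_units_def)
  show nz: "\<omega> a \<noteq> 0" if "a \<in> centralizer (Bgrp n) x" for a
    using assms that by (auto simp: linear_character_def hom_def complex_units_def)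
  have "id \<in> centralizer (Bgrp n) x" by (simp add: in_centralizer_iff Bgrp_id)
  then show "\<omega> id = 1" using m[of id id] nz[of id] by simp
qed

lemma character_spin:
  assumes \<omega>: "linear_character (Bgrp n) (centralizer (Bgrp n) x) \<omega>"
  shows "\<omega> (spin e) = (\<Prod>p\<in>P. \<omega> (signed_cycle x p) ^ e p)"
proof -
  note D = linear_characterD[OF \<omega>]
  have pow: "\<omega> (spin (\<lambda>q. m * f q)) = \<omega> (spin f) ^ m" for m f
  proof (induction m)
    case (Suc m)
    have "spin (\<lambda>q. Suc m * f q) = spin f \<circ> spin (\<lambda>q. m * f q)" by (simp add: spin_spin)
    then show ?case by (simp only: D(1)[OF spin_centralizer spin_centralizer] Suc power_Suc)
  qed (simp only: mult_0 spin_zero D(3) power_0)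
  have "\<omega> (spin (\<lambda>q. if q \<in> Q then e q else 0)) = (\<Prod>p\<in>Q. \<omega> (signed_cycle x p) ^ e p)"
    if "Q \<subseteq> P" "finite Q" for Q
    using that(2,1)
  proof (induction Q)
    case empty
    then show ?case by (simp only: empty_iff if_False spin_zero D(3) prod.empty)
  next
    case (insert p Q)
    have "spin (\<lambda>q. if q \<in> insert p Q then e q else 0) =
        spin (\<lambda>q. e p * (if q = p then 1 else 0)) \<circ> spin (\<lambda>q. if q \<in> Q then e q else 0)"
      unfolding spin_spin by (rule arg_cong[of _ _ spin]) (use insert.hyps(2) in \<open>auto simp: fun_eq_iff\<close>)
    then have "\<omega> (spin (\<lambda>q. if q \<in> insert p Q then e q else 0)) =
        \<omega> (spin (\<lambda>q. e p * (if q = p then 1 else 0))) * \<omega> (spin (\<lambda>q. if q \<in> Q then e q else 0))"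
      by (simp only: D(1)[OF spin_centralizer spin_centralizer])
    then show ?case
      using insert signed_cycle_spin[of p] unfolding pow by simp
  qed
  from this[OF order_refl finite_P]
  have "\<omega> (spin (\<lambda>q. if q \<in> P then e q else 0)) = (\<Prod>p\<in>P. \<omega> (signed_cycle x p) ^ e p)" .
  moreover have "spin (\<lambda>q. if q \<in> P then e q else 0) = spin e" by (rule spin_cong) simp
  ultimately show ?thesis by simp
qed

text \<open>In the factorization of \<open>z\<close> the complement contributes 1, and the exponents
  of the base part are the indices of the images of the base points.\<close>

lemma character_eq_prod:
  assumes \<omega>: "linear_character (Bgrp n) (centralizer (Bgrp n) x) \<omega>"
    and triv: "\<And>t. t \<in> cycle_complement n x P \<Longrightarrow> \<omega> t = 1"
    and z: "z \<in> centralizer (Bgrp n) x"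
  shows "\<omega> z = (\<Prod>p\<in>P. \<omega> (signed_cycle x p) ^ ix (z p))"
proof -
  obtain t where t: "t \<in> cycle_complement n x P" "z = t \<circ> spin (\<lambda>p. ix (z p))"
    by (rule factor_centralizer[OF z])
  have "\<omega> z = \<omega> (t \<circ> spin (\<lambda>p. ix (z p)))" using arg_cong[OF t(2)] .
  also have "\<dots> = \<omega> t * \<omega> (spin (\<lambda>p. ix (z p)))"
    using t(1) by (intro linear_characterD(1)[OF \<omega> _ spin_centralizer]) (simp add: cycle_complement_def)
  finally have "\<omega> z = \<omega> t * \<omega> (spin (\<lambda>p. ix (z p)))" .
  then show ?thesis using triv[OF t(1)] character_spin[OF \<omega>] by simp
qed

text \<open>The canonical choice for the character of the centralizer: every signed cycle goes to
  the standard primitive root of unity of its length.\<close>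

definition cyclo_char :: "(int \<Rightarrow> int) \<Rightarrow> complex" where
  "cyclo_char z = (\<Prod>p\<in>P. unit_root (len p) ^ ix (z p))"

text \<open>The indices form a cocycle: with q = \<open>bp (b p)\<close>, the index of a (b p) is
  that of b p plus that of a q, modulo the length. Since p \<mapsto> q is a length-preserving
  permutation of the base points, the second terms multiply to the value at
  \<open>a\<close>.\<close>

lemma cyclo_char_mult:
  assumes a: "a \<in> centralizer (Bgrp n) x" and b: "b \<in> centralizer (Bgrp n) x"
  shows "cyclo_char (a \<circ> b) = cyclo_char a * cyclo_char b"
proof -
  have "unit_root (len p) ^ ix (a (b p)) = unit_root (len (bp (b p))) ^ ix (a (bp (b p))) * unit_root (len p) ^ ix (b p)"
    if p: "p \<in> P" for p
  proof -
    have bP: "b p \<in> pm n" using P_pm[OF p] centralizer_pm[OF b] by simp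
    let ?q = "bp (b p)"
    have q: "?q \<in> P" by (rule bp(1)[OF bP])
    have aq: "a ?q \<in> pm n" using P_pm[OF q] centralizer_pm[OF a] by simp
    have lq: "len ?q = len p" by (simp add: len_bp[OF bP] len_centralizer[OF b])
    have la: "len (bp (a ?q)) = len p" by (simp add: len_bp[OF aq] len_centralizer[OF a] lq)
    have "a (b p) = (x ^^ ix (b p)) (a ?q)" using bp(2)[OF bP] centralizer_pow[OF a] by metis
    also have "\<dots> = (x ^^ (ix (b p) + ix (a ?q))) (bp (a ?q))"
      using bp(2)[OF aq] by (simp add: funpow_add)
    finally have "[ix (a (b p)) = ix (b p) + ix (a ?q)] (mod len p)"
      using ix_x[OF bp(1)[OF aq]] la by simp
    then show ?thesis using root_pow_cong lq by (simp add: power_add mult.commute)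
  qed
  then have "cyclo_char (a \<circ> b) =
      (\<Prod>p\<in>P. unit_root (len (bp (b p))) ^ ix (a (bp (b p)))) * (\<Prod>p\<in>P. unit_root (len p) ^ ix (b p))"
    by (simp add: cyclo_char_def prod.distrib)
  also have "(\<Prod>p\<in>P. unit_root (len (bp (b p))) ^ ix (a (bp (b p)))) = cyclo_char a"
    unfolding cyclo_char_def
    using prod.reindex_bij_betw[OF bp_centralizer_bij[OF b], of "\<lambda>p. unit_root (len p) ^ ix (a p)"] .
  finally show ?thesis by (simp add: cyclo_char_def)
qed

lemma cyclo_char_linear: "linear_character (Bgrp n) (centralizer (Bgrp n) x) cyclo_char"
proof -
  have "cyclo_char z \<noteq> 0" for z
    using finite_P by (simp add: cyclo_char_def unit_root_def cis_neq_zero)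
  then show ?thesis
    by (auto simp: linear_character_def hom_def complex_units_def cyclo_char_mult)
qed

lemma cyclo_char_spin: "cyclo_char (spin e) = (\<Prod>p\<in>P. unit_root (len p) ^ e p)"
  unfolding cyclo_char_def
proof (rule prod.cong[OF refl])
  fix p assume p: "p \<in> P"
  have "spin e p = (x ^^ e p) p" using P_pm[OF p] by (simp add: spin_def bp_self[OF p])
  then show "unit_root (len p) ^ ix (spin e p) = unit_root (len p) ^ e p"
    using root_pow_cong[OF ix_x[OF p]] by simp
qed

lemma signed_cycle_pow:
  assumes "p \<in> P" shows "signed_cycle x p ^^ m = spin (\<lambda>q. if q = p then m else 0)"
  unfolding signed_cycle_spin[OF assms] spin_funpow by (rule arg_cong[of _ _ spin]) auto

lemma signed_cycle_pow_eq_iff: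
  assumes "p \<in> P"
  shows "signed_cycle x p ^^ s = signed_cycle x p ^^ t \<longleftrightarrow> [s = t] (mod len p)"
proof
  assume "[s = t] (mod len p)"
  then show "signed_cycle x p ^^ s = signed_cycle x p ^^ t"
    unfolding signed_cycle_pow[OF assms] by (intro spin_cong) auto
next
  assume "signed_cycle x p ^^ s = signed_cycle x p ^^ t"
  then have "spin (\<lambda>q. if q = p then s else 0) p = spin (\<lambda>q. if q = p then t else 0) p"
    unfolding signed_cycle_pow[OF assms] by simp
  then show "[s = t] (mod len p)"
    using P_pm[OF assms] by (simp add: spin_def bp_self[OF assms] x_eq_iff)
qed

lemma generate_signed_cycle:
  assumes p: "p \<in> P"
  shows "generate (Bgrp n) {signed_cycle x p} = (\<lambda>m. signed_cycle x p ^^ m) ` UNIV"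
proof -
  interpret group "Bgrp n" by (rule group_Bgrp)
  let ?c = "signed_cycle x p"
  have cB: "?c \<in> carrier (Bgrp n)" unfolding signed_cycle_spin[OF p] by (rule spin_Bgrp)
  show ?thesis
  proof (intro equalityI subsetI)
    fix g assume "g \<in> generate (Bgrp n) {?c}"
    then obtain k :: int where "g = ?c [^]\<^bsub>Bgrp n\<^esub> k" unfolding generate_pow[OF cB] by blast
    moreover have "\<exists>m. ?c [^]\<^bsub>Bgrp n\<^esub> k = ?c ^^ m" by (metis Bgrp_int_pow cB)
    ultimately show "g \<in> (\<lambda>m. ?c ^^ m) ` UNIV" by auto
  next
    fix g assume "g \<in> (\<lambda>m. ?c ^^ m) ` UNIV"
    then obtain m where "g = ?c [^]\<^bsub>Bgrp n\<^esub> int m" by (auto simp: int_pow_int Bgrp_nat_pow)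
    then show "g \<in> generate (Bgrp n) {?c}" unfolding generate_pow[OF cB] by blast
  qed
qed

lemma prod_power_delta:
  fixes f :: "int \<Rightarrow> complex"
  assumes "p \<in> P" shows "(\<Prod>q\<in>P. f q ^ (if q = p then m else 0)) = f p ^ m"
  using finite_P assms by (subst prod.remove[OF finite_P assms]) (auto intro!: prod.neutral)

text \<open>Shows that an admissible character exists, so that the choice in
  \<open>higher_Lie_character\<close> is made from a nonempty set.\<close>

lemma cyclo_char_centralizer_character: "centralizer_character n x P cyclo_char"
  unfolding centralizer_character_def
proof (intro conjI ballI impI)
  show "linear_character (Bgrp n) (centralizer (Bgrp n) x) cyclo_char" by (rule cyclo_char_linear)
  show "inj_on cyclo_char (generate (Bgrp n) {signed_cycle x p})" if p: "p \<in> P" for p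
    unfolding generate_signed_cycle[OF p]
  proof (rule inj_onI)
    fix g h assume "g \<in> (\<lambda>m. signed_cycle x p ^^ m) ` UNIV" "h \<in> (\<lambda>m. signed_cycle x p ^^ m) ` UNIV"
      and eq: "cyclo_char g = cyclo_char h"
    then obtain s t where st: "g = signed_cycle x p ^^ s" "h = signed_cycle x p ^^ t" by blast
    have "unit_root (len p) ^ s = unit_root (len p) ^ t"
      using eq unfolding st signed_cycle_pow[OF p] cyclo_char_spin
        prod_power_delta[OF p, of "\<lambda>q. unit_root (len q)"] .
    then show "g = h" unfolding st signed_cycle_pow_eq_iff[OF p]
      by (simp add: root_pow_eq_iff[OF card_orbit_pos[OF px]])
  qed
  \<comment> \<open>Vacuous: here every cycle equals its negation.\<close>
  show "cyclo_char (block_negation x p) = 1" if "p \<in> P" "positive_cycle x p" for p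
  proof -
    have "uminus ` orbit x p \<subseteq> orbit x p"
      using block_eq_orbit[OF P_pm[OF that(1)]] by (auto simp: block_def)
    then have "orbit x p = uminus ` orbit x p" by (auto simp: image_iff) (metis imageI minus_minus subsetD)
    then show ?thesis using that(2) by (simp add: positive_cycle_def)
  qed
  show "cyclo_char z = 1" if "z \<in> cycle_complement n x P" for z
    unfolding cyclo_char_def
  proof (rule prod.neutral, rule ballI)
    fix p assume p: "p \<in> P"
    then have "z p \<in> P" using that by (auto simp: cycle_complement_def)
    then have "ix (z p) = 0" by (simp add: base_index_def bp_self)
    then show "unit_root (len p) ^ ix (z p) = 1" by simp
  qed
qed

text \<open>\<open>z\<close> induces the permutation \<open>\<tau>\<close> of the base points.
  Following \<open>z\<close> along the \<open>\<tau>\<close>-cycle of the base point of r adds up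
  the indices, and z^s r is back on the \<open>x\<close>-cycle of r exactly when
  \<open>\<tau>\<close> has returned. So the phase exponent is the sum of the indices over that
  \<open>\<tau>\<close>-cycle, which consists of the base points in the orbit of r, all of the same
  length.\<close>

lemma phase_eq_prod:
  assumes z: "z \<in> centralizer (Bgrp n) x" and r: "r \<in> pm n"
  shows "phase x z r = (\<Prod>p | p \<in> P \<and> (r, p) \<in> linked x z. unit_root (len p) ^ ix (z p))"
proof -
  have zB: "z \<in> carrier (Bgrp n)" "z \<circ> x = x \<circ> z" using z by (auto simp: in_centralizer_iff)
  note pz = Bgrp_permutation[OF zB(1)]
  define \<tau> where "\<tau> p = bp (z p)" for p
  define p0 where "p0 = bp r"
  define J where "J p = ix (z p)" for p
  have p0: "p0 \<in> P" and r_eq: "(x ^^ ix r) p0 = r" unfolding p0_def by (rule bp[OF r])+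
  have \<tau>P: "(\<tau> ^^ s) p0 \<in> P" for s
  proof (induction s)
    case (Suc s)
    then show ?case using bp(1) P_pm centralizer_pm[OF z] by (simp add: \<tau>_def)
  qed (simp add: p0)
  have walk: "(z ^^ s) p0 = (x ^^ (\<Sum>i<s. J ((\<tau> ^^ i) p0))) ((\<tau> ^^ s) p0)" for s
  proof (induction s)
    case (Suc s)
    let ?S = "\<Sum>i<s. J ((\<tau> ^^ i) p0)"
    have zp: "z ((\<tau> ^^ s) p0) \<in> pm n" using P_pm[OF \<tau>P] centralizer_pm[OF z] by simp
    have "(z ^^ Suc s) p0 = (x ^^ ?S) (z ((\<tau> ^^ s) p0))" using Suc centralizer_pow[OF z] by simp
    also have "z ((\<tau> ^^ s) p0) = (x ^^ J ((\<tau> ^^ s) p0)) ((\<tau> ^^ Suc s) p0)"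
      using bp(2)[OF zp] by (simp add: J_def \<tau>_def)
    finally show ?case by (simp add: funpow_add)
  qed simp
  have return: "(z ^^ s) r \<in> orbit x r \<longleftrightarrow> (\<tau> ^^ s) p0 = p0" for s
  proof -
    have "bp ((z ^^ s) r) = bp ((x ^^ ix r) ((z ^^ s) p0))"
      by (metis r_eq funpow_commute2[OF zB(2)])
    also have "\<dots> = bp ((x ^^ (ix r + (\<Sum>i<s. J ((\<tau> ^^ i) p0)))) ((\<tau> ^^ s) p0))"
      by (simp add: walk funpow_add)
    also have "\<dots> = (\<tau> ^^ s) p0" by (rule bp_x[OF \<tau>P])
    finally have b: "bp ((z ^^ s) r) = (\<tau> ^^ s) p0" .
    have zr: "(z ^^ s) r \<in> pm n" using r by (simp add: Bgrp_in_pm[OF Bgrp_funpow[OF zB(1)]])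
    show ?thesis
    proof
      assume "(z ^^ s) r \<in> orbit x r"
      then show "(\<tau> ^^ s) p0 = p0" using bp_orbit[OF r] b by (simp add: p0_def)
    next
      assume "(\<tau> ^^ s) p0 = p0"
      then have "orbit x ((z ^^ s) r) = orbit x r"
        using orbit_bp[OF zr] orbit_bp[OF r] b by (simp add: p0_def)
      then show "(z ^^ s) r \<in> orbit x r" using permutation_self_in_orbit[OF px] by blast
    qed
  qed
  define m where "m = funpow_dist1 \<tau> p0 p0"
  obtain N where N: "N > 0" "z ^^ N = id" by (rule permutation_period[OF pz])
  have "(\<tau> ^^ N) p0 = p0" using return[of N] N(2) permutation_self_in_orbit[OF px] by simp
  then have self: "p0 \<in> orbit \<tau> p0" unfolding orbit_altdef using N(1) by (metis (mono_tags, lifting) mem_Collect_eq)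
  have m0: "m > 0" by (simp add: m_def)
  have m: "(\<tau> ^^ m) p0 = p0" unfolding m_def by (rule funpow_dist1_prop[OF self])
  have inj: "inj_on (\<lambda>s. (\<tau> ^^ s) p0) {0..<m}" unfolding m_def by (rule inj_on_funpow_dist1[OF self])
  have orb: "orbit \<tau> p0 = (\<lambda>s. (\<tau> ^^ s) p0) ` {0..<m}"
    unfolding m_def by (rule orbit_conv_funpow_dist1[OF self])
  let ?S = "\<Sum>i<m. J ((\<tau> ^^ i) p0)"
  have "phase x z r = unit_root (len r) ^ ?S"
  proof (rule phaseI[OF px m0])
    \<comment> \<open>The walk was computed from \<open>p0\<close>; a power of \<open>x\<close>,
      which commutes with \<open>z\<close>, carries it over to \<open>r\<close>.\<close>
    have "(z ^^ m) r = (x ^^ ix r) ((z ^^ m) p0)"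
      by (metis r_eq funpow_commute2[OF zB(2)])
    also have "\<dots> = (x ^^ ?S) ((x ^^ ix r) p0)"
      unfolding walk m by (metis comp_apply funpow_add add.commute)
    finally show "(z ^^ m) r = (x ^^ ?S) r" by (simp only: r_eq)
    show "(z ^^ m') r \<notin> orbit x r" if "0 < m'" "m' < m" for m'
      unfolding return using funpow_dist1_least[of m' \<tau> p0 p0] that by (simp add: m_def)
  qed
  also have "\<dots> = (\<Prod>s\<in>{0..<m}. unit_root (len r) ^ J ((\<tau> ^^ s) p0))"
    by (simp add: power_sum atLeast0LessThan)
  also have "\<dots> = (\<Prod>p\<in>orbit \<tau> p0. unit_root (len r) ^ J p)"
    unfolding orb by (subst prod.reindex[OF inj]) simp
  also have "\<dots> = (\<Prod>p\<in>orbit \<tau> p0. unit_root (len p) ^ J p)"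
  proof (rule prod.cong[OF refl])
    fix p assume "p \<in> orbit \<tau> p0"
    then obtain s where s: "p = (\<tau> ^^ s) p0" using orb by auto
    have "len ((\<tau> ^^ s) p0) = len r"
    proof (induction s)
      case 0
      then show ?case using orbit_bp[OF r] by (simp add: p0_def)
    next
      case (Suc s)
      have "z ((\<tau> ^^ s) p0) \<in> pm n" using P_pm[OF \<tau>P] centralizer_pm[OF z] by simp
      then have "len (\<tau> ((\<tau> ^^ s) p0)) = len ((\<tau> ^^ s) p0)"
        unfolding \<tau>_def[of "(\<tau> ^^ s) p0"] by (simp add: len_bp len_centralizer[OF z])
      then show ?case using Suc by simp
    qed
    then show "unit_root (len r) ^ J p = unit_root (len p) ^ J p" by (simp add: s)
  qed
  also have "orbit \<tau> p0 = {p. p \<in> P \<and> (r, p) \<in> linked x z}"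
  proof (intro equalityI subsetI)
    fix p assume "p \<in> orbit \<tau> p0"
    then obtain s where s: "p = (\<tau> ^^ s) p0" using orb by auto
    have step: "(i, bp i) \<in> linked x z" if "i \<in> pm n" for i
      using linked_sym[OF px pz linked_funpow(1)[of "bp i" "ix i"]] bp(2)[OF that] by simp
    have "(r, (\<tau> ^^ s) p0) \<in> linked x z"
    proof (induction s)
      case 0
      then show ?case using step[OF r] by (simp add: p0_def)
    next
      case (Suc s)
      have zp: "z ((\<tau> ^^ s) p0) \<in> pm n" using P_pm[OF \<tau>P] centralizer_pm[OF z] by simp
      show ?case using linked_trans[OF Suc linked_trans[OF linked_step(2) step[OF zp]]]
        by (simp only: funpow.simps comp_apply \<tau>_def[of "(\<tau> ^^ s) p0"])
    qed
    then show "p \<in> {p. p \<in> P \<and> (r, p) \<in> linked x z}" using \<tau>P by (simp add: s)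
  next
    fix p assume "p \<in> {p. p \<in> P \<and> (r, p) \<in> linked x z}"
    then have p: "p \<in> P" "(r, p) \<in> linked x z" by auto
    have "p \<in> {i \<in> pm n. bp i \<in> orbit \<tau> p0}"
    proof (rule linked_closed[OF p(2)])
      show "r \<in> {i \<in> pm n. bp i \<in> orbit \<tau> p0}" using r self by (simp add: p0_def)
      fix l assume "l \<in> {i \<in> pm n. bp i \<in> orbit \<tau> p0}"
      then have l: "l \<in> pm n" "bp l \<in> orbit \<tau> p0" by auto
      show "x l \<in> {i \<in> pm n. bp i \<in> orbit \<tau> p0}"
        using l bp_funpow[OF l(1), of 1] by (simp add: Bgrp_in_pm[OF x])
      show "- l \<in> {i \<in> pm n. bp i \<in> orbit \<tau> p0}" using l by (simp add: bp_uminus)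
      have "bp (z l) = \<tau> (bp l)" using bp_centralizer[OF z l(1)] by (simp add: \<tau>_def)
      then show "z l \<in> {i \<in> pm n. bp i \<in> orbit \<tau> p0}"
        using l orbit.step[OF l(2)] by (simp add: centralizer_pm[OF z])
    qed
    then show "p \<in> orbit \<tau> p0" using bp_self[OF p(1)] by simp
  qed
  finally show ?thesis by (simp add: J_def)
qed

text \<open>The base points are grouped by orbits of \<open>x\<close> and \<open>z\<close>, one
  phase for each group. The left side is free of base points, so the canonical character does not
  depend on them.\<close>

lemma Lie_product_eq:
  assumes z: "z \<in> centralizer (Bgrp n) x" shows "Lie_product n x z = cyclo_char z"
proof -
  have zB: "z \<in> carrier (Bgrp n)" using z by (simp add: in_centralizer_iff)
  note pz = Bgrp_permutation[OF zB]
  let ?A = "\<lambda>r. {p. p \<in> P \<and> (r, p) \<in> linked x z}"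
  have P: "P = (\<Union>r\<in>reps n x z. ?A r)"
  proof (intro equalityI subsetI)
    fix p assume p: "p \<in> P"
    obtain r where "r \<in> reps n x z" "(r, p) \<in> linked x z"
      by (rule reps_exists[OF x zB P_pm[OF p]])
    then show "p \<in> (\<Union>r\<in>reps n x z. ?A r)" using p by blast
  qed blast
  have "Lie_product n x z = (\<Prod>r\<in>reps n x z. \<Prod>p\<in>?A r. unit_root (len p) ^ ix (z p))"
    unfolding Lie_product_def by (rule prod.cong[OF refl]) (rule phase_eq_prod[OF z reps_pm])
  also have "\<dots> = (\<Prod>p\<in>(\<Union>r\<in>reps n x z. ?A r). unit_root (len p) ^ ix (z p))"
  proof (rule prod.UNION_disjoint[symmetric])
    show "\<forall>r\<in>reps n x z. finite (?A r)" using finite_P by simp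
    show "\<forall>r\<in>reps n x z. \<forall>q\<in>reps n x z. r \<noteq> q \<longrightarrow> ?A r \<inter> ?A q = {}"
    proof (intro ballI impI)
      fix r q assume rq: "r \<in> reps n x z" "q \<in> reps n x z" "r \<noteq> q"
      have False if "(r, p) \<in> linked x z" "(q, p) \<in> linked x z" for p
      proof -
        have "(r, q) \<in> linked x z" using that linked_sym[OF px pz] linked_trans by blast
        then show False using reps_unique[OF px pz rq(1,2)] rq(3) by simp
      qed
      then show "?A r \<inter> ?A q = {}" by blast
    qed
  qed simp
  also have "\<dots> = cyclo_char z" unfolding cyclo_char_def P[symmetric] ..
  finally show ?thesis .
qed

text \<open>Transport of structure: moving the base points along with the conjugation preserves
  cycle lengths and indices on the nose, so the factors match one by one.\<close>

lemma conjugate_negative_perm: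
  assumes g: "g \<in> carrier (Bgrp n)" and x': "x' \<in> carrier (Bgrp n)" "g \<circ> x' = x \<circ> g"
  shows "negative_perm n x' (Hilbert_Choice.inv g ` P)"
    and "y \<in> carrier (Bgrp n) \<Longrightarrow> (\<Prod>p\<in>Hilbert_Choice.inv g ` P. unit_root (card (orbit x' p)) ^ base_index x' (Hilbert_Choice.inv g ` P) (y p))
      = cyclo_char (g \<circ> y \<circ> Hilbert_Choice.inv g)"
proof -
  let ?h = "Hilbert_Choice.inv g"
  note hB = Bgrp_inverse[OF g]
  note gh = permutes_inverses[OF Bgrp_permutes[OF g]]
  note px' = Bgrp_permutation[OF x'(1)]
  have hx: "?h \<circ> x = x' \<circ> ?h"
  proof
    fix i
    have "g (?h (x i)) = g (x' (?h i))" using fun_cong[OF x'(2), of "?h i"] by (simp add: gh)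
    then show "(?h \<circ> x) i = (x' \<circ> ?h) i" using Bgrp_inj[OF g] by (simp add: inj_eq)
  qed
  have powh: "?h ((x ^^ a) i) = (x' ^^ a) (?h i)" for a i
    by (induction a) (use fun_cong[OF hx] in auto)
  have orb: "orbit x' (?h i) = ?h ` orbit x i" for i
    unfolding orbit_altdef_permutation[OF px] orbit_altdef_permutation[OF px'] by (auto simp flip: powh)
  have blk: "block x' (?h i) = ?h ` block x i" for i
    unfolding block_def orb by (auto simp: image_Un image_image Bgrp_odd[OF hB])
  have hinj: "?h i = ?h j \<longleftrightarrow> i = j" for i j using Bgrp_inj[OF hB] by (simp add: inj_eq)
  have "base_points n x' (?h ` P)"
    unfolding base_points_def
  proof (intro conjI ballI)
    show "?h ` P \<subseteq> pm n" using P_pm by (auto simp: Bgrp_in_pm[OF hB])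
    fix i assume i: "i \<in> pm n"
    then have gi: "g i \<in> pm n" by (simp add: Bgrp_in_pm[OF g])
    have mem: "i \<in> block x' (?h p) \<longleftrightarrow> g i \<in> block x p" for p
      unfolding blk by (metis gh hinj image_iff)
    have ex: "\<exists>!p. p \<in> P \<and> g i \<in> block x p" using base gi by (auto simp: base_points_def)
    then obtain p where p: "p \<in> P" "g i \<in> block x p" by blast
    show "\<exists>!p. p \<in> ?h ` P \<and> i \<in> block x' p"
    proof (rule ex1I[of _ "?h p"])
      show "?h p \<in> ?h ` P \<and> i \<in> block x' (?h p)" using p mem by blast
      fix q assume "q \<in> ?h ` P \<and> i \<in> block x' q"
      then obtain p' where "q = ?h p'" "p' \<in> P" "g i \<in> block x p'" using mem by blast
      then show "q = ?h p" using ex p by blast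
    qed
  qed
  moreover have "- i \<in> orbit x' i" if "i \<in> pm n" for i
  proof -
    have "- g i \<in> orbit x (g i)" using neg that by (simp add: Bgrp_in_pm[OF g])
    then have "?h (- g i) \<in> orbit x' (?h (g i))" unfolding orb by blast
    then show ?thesis by (simp add: Bgrp_odd[OF hB] gh)
  qed
  ultimately show N: "negative_perm n x' (?h ` P)" by (simp add: negative_perm_def x')
  interpret N: negative_perm n x' "?h ` P" by (rule N)
  show "(\<Prod>p\<in>?h ` P. unit_root (card (orbit x' p)) ^ base_index x' (?h ` P) (y p)) = cyclo_char (g \<circ> y \<circ> ?h)"
    if y: "y \<in> carrier (Bgrp n)"
  proof -
    have "unit_root (card (orbit x' (?h p))) ^ base_index x' (?h ` P) (y (?h p)) = unit_root (len p) ^ ix (g (y (?h p)))"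
      if p: "p \<in> P" for p
    proof -
      have c: "card (orbit x' (?h p)) = len p"
        unfolding orb by (rule card_image) (use hinj in \<open>auto simp: inj_on_def\<close>)
      have i: "g (y (?h p)) \<in> pm n" using P_pm[OF p] by (simp add: Bgrp_in_pm[OF g] Bgrp_in_pm[OF y] Bgrp_in_pm[OF hB])
      let ?i = "g (y (?h p))"
      have "y (?h p) = ?h ((x ^^ ix ?i) (bp ?i))" unfolding bp(2)[OF i] by (simp add: gh)
      then have yi: "y (?h p) = (x' ^^ ix ?i) (?h (bp ?i))" unfolding powh .
      have b: "base_point x' (?h ` P) (y (?h p)) = ?h (bp ?i)"
        using N.bp_x[of "?h (bp ?i)" "ix ?i"] bp(1)[OF i] by (simp only: yi[symmetric] imageI)
      have "(x' ^^ j) (?h (bp ?i)) = y (?h p) \<longleftrightarrow> (x ^^ j) (bp ?i) = ?i" for j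
        unfolding powh[symmetric] by (metis gh(1,2))
      then have "base_index x' (?h ` P) (y (?h p)) = ix ?i" unfolding base_index_def b by simp
      then show ?thesis by (simp add: c)
    qed
    then show ?thesis
      unfolding cyclo_char_def using hinj by (subst prod.reindex) (auto simp: inj_on_def intro!: prod.cong)
  qed
qed

text \<open>Moves the conjugation from the argument of the character to the element whose character
  it is. The two canonical characters use different base points, which \<open>Lie_product\<close>
  forgets.\<close>

lemma Lie_product_conjugate:
  assumes g: "g \<in> carrier (Bgrp n)" and y: "y \<in> carrier (Bgrp n)"
    and z: "g \<circ> y \<circ> Hilbert_Choice.inv g \<in> centralizer (Bgrp n) x"
  shows "Lie_product n x (g \<circ> y \<circ> Hilbert_Choice.inv g) = Lie_product n (Hilbert_Choice.inv g \<circ> x \<circ> g) y"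
    and "Hilbert_Choice.inv g \<circ> x \<circ> g \<in> centralizer (Bgrp n) y"
proof -
  let ?h = "Hilbert_Choice.inv g"
  let ?x = "?h \<circ> x \<circ> g"
  note hB = Bgrp_inverse[OF g]
  note gh = permutes_inverses[OF Bgrp_permutes[OF g]]
  have x': "?x \<in> carrier (Bgrp n)" by (intro Bgrp_compose hB x g)
  have gx: "g \<circ> ?x = x \<circ> g" by (simp add: fun_eq_iff gh)
  have c: "g (y (?h (x i))) = x (g (y (?h i)))" for i
    using z by (auto simp: in_centralizer_iff fun_eq_iff)
  have "y (?h (x (g i))) = ?h (x (g (y i)))" for i
    using c[of "g i"] gh by metis
  then have comm: "y \<circ> ?x = ?x \<circ> y" by (simp add: fun_eq_iff)
  then show "?x \<in> centralizer (Bgrp n) y" using x' by (simp add: in_centralizer_iff)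
  have yc: "y \<in> centralizer (Bgrp n) ?x" using y comm by (simp add: in_centralizer_iff)
  interpret N: negative_perm n ?x "?h ` P" by (rule conjugate_negative_perm(1)[OF g x' gx])
  show "Lie_product n x (g \<circ> y \<circ> ?h) = Lie_product n ?x y"
    unfolding Lie_product_eq[OF z] N.Lie_product_eq[OF yc] N.cyclo_char_def
    by (rule conjugate_negative_perm(2)[OF g x' gx y, symmetric])
qed

section \<open>Normalizing an arbitrary choice of faithful characters\<close>

lemma signed_cycle_centralizer: "p \<in> P \<Longrightarrow> signed_cycle x p \<in> centralizer (Bgrp n) x"
  by (simp add: signed_cycle_spin spin_centralizer)

lemma character_signed_cycle_pow:
  assumes "linear_character (Bgrp n) (centralizer (Bgrp n) x) \<omega>" "p \<in> P"
  shows "\<omega> (signed_cycle x p ^^ m) = \<omega> (signed_cycle x p) ^ m"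
  unfolding signed_cycle_pow[OF assms(2)] character_spin[OF assms(1)]
    prod_power_delta[OF assms(2), of "\<lambda>q. \<omega> (signed_cycle x q)"] ..

text \<open>By faithfulness the first \<open>len p\<close> powers of the value at the signed cycle
  are distinct, so they exhaust the roots of unity of that order. The value and
  \<open>unit_root (len p)\<close> are thus powers of each other, and the two exponents are mutually
  inverse.\<close>

lemma faithful_exponents:
  assumes lin: "linear_character (Bgrp n) (centralizer (Bgrp n) x) \<omega>" and p: "p \<in> P"
    and inj: "inj_on \<omega> (generate (Bgrp n) {signed_cycle x p})"
  shows "\<exists>r. \<omega> (signed_cycle x p) ^ r = unit_root (len p)"
    and "\<omega> (signed_cycle x p) ^ r = unit_root (len p) \<Longrightarrow> \<exists>c. [c * r = 1] (mod len p)"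
proof -
  let ?c = "signed_cycle x p"
  let ?z = "\<omega> ?c"
  have l: "len p > 0" by (rule card_orbit_pos[OF px])
  have "?c ^^ len p = ?c ^^ 0" unfolding signed_cycle_pow_eq_iff[OF p] by (simp add: cong_0_iff)
  then have z1: "?z ^ len p = 1"
    using character_signed_cycle_pow[OF lin p, of "len p"] character_signed_cycle_pow[OF lin p, of 0] by simp
  have injz: "inj_on (\<lambda>m. ?z ^ m) {..<len p}"
  proof (rule inj_onI)
    fix s t assume st: "s \<in> {..<len p}" "t \<in> {..<len p}" "?z ^ s = ?z ^ t"
    then have "\<omega> (?c ^^ s) = \<omega> (?c ^^ t)" by (simp only: character_signed_cycle_pow[OF lin p])
    then have "?c ^^ s = ?c ^^ t"
      using inj unfolding generate_signed_cycle[OF p] by (auto dest: inj_onD)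
    then show "s = t" using st unfolding signed_cycle_pow_eq_iff[OF p] by (simp add: cong_def)
  qed
  have "(\<lambda>m. ?z ^ m) ` {..<len p} = {w. w ^ len p = 1}"
  proof (rule card_subset_eq)
    show "finite {w :: complex. w ^ len p = 1}" using l by (intro finite_roots_unity) simp
    show "(\<lambda>m. ?z ^ m) ` {..<len p} \<subseteq> {w. w ^ len p = 1}"
    proof clarify
      fix m
      have "(?z ^ m) ^ len p = (?z ^ len p) ^ m" by (simp only: power_mult[symmetric] mult.commute)
      then show "(?z ^ m) ^ len p = 1" using z1 by simp
    qed
    show "card ((\<lambda>m. ?z ^ m) ` {..<len p}) = card {w :: complex. w ^ len p = 1}"
      using card_image[OF injz] card_roots_unity_eq[OF l] by simp
  qed
  moreover have "unit_root (len p) \<in> {w. w ^ len p = 1}" using root_pow_self[OF l] by simp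
  ultimately show "\<exists>r. ?z ^ r = unit_root (len p)" by (metis imageE)
  assume r: "?z ^ r = unit_root (len p)"
  have "?z \<in> (\<lambda>t. unit_root (len p) ^ t) ` {..<len p}"
    using bij_betw_root_pow[OF l] z1 by (simp add: bij_betw_def)
  then obtain c where c: "?z = unit_root (len p) ^ c" by blast
  have "unit_root (len p) ^ (c * r) = unit_root (len p) ^ 1" using r by (simp add: c power_mult)
  then show "\<exists>c. [c * r = 1] (mod len p)" unfolding root_pow_eq_iff[OF l] by blast
qed

text \<open>Conjugation by \<open>z\<close> takes the signed cycle at \<open>p\<close> to the one at
  \<open>bp (z p)\<close>, and a linear character is constant on conjugates.\<close>

lemma character_signed_cycle_invariant:
  assumes lin: "linear_character (Bgrp n) (centralizer (Bgrp n) x) \<omega>"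
    and z: "z \<in> centralizer (Bgrp n) x" and p: "p \<in> P"
  shows "\<omega> (signed_cycle x (bp (z p))) = \<omega> (signed_cycle x p)"
proof -
  have zp: "bp (z p) \<in> P" using bp(1) P_pm[OF p] centralizer_pm[OF z] by simp
  have "z \<circ> signed_cycle x p = signed_cycle x (bp (z p)) \<circ> z"
  proof
    fix i
    show "(z \<circ> signed_cycle x p) i = (signed_cycle x (bp (z p)) \<circ> z) i"
    proof (cases "i \<in> pm n")
      case True
      have "bp (z i) = bp (z p) \<longleftrightarrow> bp i = p"
        unfolding bp_centralizer[OF z True]
        using inj_on_eq_iff[OF bp_centralizer_inj[OF z] bp(1)[OF True] p] .
      then show ?thesis
        using True centralizer_pow[OF z, of 1]
        by (simp add: signed_cycle_spin[OF p] signed_cycle_spin[OF zp] spin_def centralizer_pm[OF z])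
    qed (simp add: signed_cycle_spin[OF p] signed_cycle_spin[OF zp] spin_def centralizer_pm[OF z])
  qed
  then have "\<omega> (z \<circ> signed_cycle x p) = \<omega> (signed_cycle x (bp (z p)) \<circ> z)" by (rule arg_cong)
  then have "\<omega> z * \<omega> (signed_cycle x p) = \<omega> (signed_cycle x (bp (z p))) * \<omega> z"
    by (simp only: linear_characterD(1)[OF lin z signed_cycle_centralizer[OF p]]
      linear_characterD(1)[OF lin signed_cycle_centralizer[OF zp] z])
  then show ?thesis using linear_characterD(2)[OF lin z] by (metis mult.commute mult_left_cancel)
qed

text \<open>Multiplies the index on each cycle by a unit modulo its length, so that one step of
  \<open>x\<close> becomes r p steps; thus it conjugates \<open>x\<close> into
  \<open>spin r\<close>.\<close>

definition power_conjugator :: "(int \<Rightarrow> nat) \<Rightarrow> int \<Rightarrow> int" where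
  "power_conjugator r i = (if i \<in> pm n then (x ^^ (r (bp i) * ix i)) (bp i) else i)"

lemma power_conjugator_Bgrp:
  assumes r: "\<And>p. p \<in> P \<Longrightarrow> \<exists>c. [c * r p = 1] (mod len p)"
  shows "power_conjugator r \<in> carrier (Bgrp n)"
  unfolding Bgrp_iff
proof
  let ?g = "power_conjugator r"
  have gpm: "?g i \<in> pm n" and bpg: "bp (?g i) = bp i" if "i \<in> pm n" for i
    using that bp(1)[OF that] P_pm by (simp_all add: power_conjugator_def x_pm bp_x)
  have "inj_on ?g (pm n)"
  proof (rule inj_onI)
    fix i j assume ij: "i \<in> pm n" "j \<in> pm n" "?g i = ?g j"
    then have b: "bp i = bp j" using bpg by metis
    let ?p = "bp i"
    have p: "?p \<in> P" by (rule bp(1)[OF ij(1)])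
    obtain c where c: "[c * r ?p = 1] (mod len ?p)" using r[OF p] by blast
    have "[r ?p * ix i = r ?p * ix j] (mod len ?p)"
      using ij b by (simp add: power_conjugator_def x_eq_iff)
    then have A: "[(c * r ?p) * ix i = (c * r ?p) * ix j] (mod len ?p)"
      unfolding mult.assoc by (rule cong_scalar_left)
    have K: "[(c * r ?p) * k = k] (mod len ?p)" for k using cong_scalar_right[OF c, of k] by simp
    have "[ix i = ix j] (mod len ?p)"
      using cong_trans[OF cong_trans[OF cong_sym[OF K[of "ix i"]] A] K[of "ix j"]] .
    then have "(x ^^ ix i) ?p = (x ^^ ix j) ?p" by (simp only: x_eq_iff)
    then show "i = j" unfolding bp(2)[OF ij(1)] unfolding b bp(2)[OF ij(2)] .
  qed
  moreover have "?g ` pm n \<subseteq> pm n" using gpm by blast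
  ultimately have "bij_betw ?g (pm n) (pm n)"
    using endo_inj_surj[of "pm n" ?g] by (simp add: bij_betw_def)
  then show "?g permutes pm n" by (rule bij_imp_permutes) (simp add: power_conjugator_def)
  show "\<forall>i. ?g (- i) = - ?g i"
  proof
    fix i
    show "?g (- i) = - ?g i"
    proof (cases "i \<in> pm n")
      case True
      let ?p = "bp i"
      have p: "?p \<in> P" by (rule bp(1)[OF True])
      \<comment> \<open>Negation adds \<open>h\<close> to the index. A cycle containing p and - p
        has even length, so the unit \<open>r ?p\<close> is odd, and \<open>h * r ?p\<close> steps
        again lead from p to - p.\<close>
      obtain h where h: "(x ^^ h) ?p = - ?p"
        using neg[OF P_pm[OF p]] unfolding in_orbit_iff[OF px] by metis
      have hs: "(x ^^ (h * s)) ?p = (if even s then ?p else - ?p)" for s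
        by (induction s) (simp_all add: funpow_add h odd_x)
      have np: "- ?p \<noteq> ?p" using P_pm[OF p] by (simp add: pm_def)
      have "even (len ?p)"
      proof (rule ccontr)
        assume "odd (len ?p)"
        then have "(x ^^ (h * len ?p)) ?p = - ?p" by (simp add: hs)
        moreover have "(x ^^ (h * len ?p)) ?p = ?p" by (simp add: funpow_eq_self_iff[OF px])
        ultimately show False using np by simp
      qed
      moreover obtain c where c: "[c * r ?p = 1] (mod len ?p)" using r[OF p] by blast
      ultimately have "[c * r ?p = 1] (mod 2)" using cong_dvd_modulus_nat by blast
      then have odd_r: "odd (r ?p)" by (auto simp: cong_def elim!: evenE)
      have "(x ^^ (h + ix i)) ?p = (x ^^ ix i) ((x ^^ h) ?p)" by (metis add.commute comp_apply funpow_add)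
      also have "\<dots> = - i" unfolding h odd_x bp(2)[OF True] ..
      finally have "- i = (x ^^ (h + ix i)) ?p" ..
      then have "[ix (- i) = h + ix i] (mod len ?p)" using ix_x[OF p] by simp
      then have "[r ?p * ix (- i) = r ?p * (h + ix i)] (mod len ?p)" by (rule cong_scalar_left)
      then have "(x ^^ (r ?p * ix (- i))) ?p = (x ^^ (r ?p * (h + ix i))) ?p" by (simp only: x_eq_iff)
      also have "\<dots> = (x ^^ (r ?p * ix i)) ((x ^^ (h * r ?p)) ?p)"
        by (metis comp_apply funpow_add distrib_left mult.commute add.commute)
      also have "\<dots> = - (x ^^ (r ?p * ix i)) ?p" by (simp add: hs odd_r odd_x)
      finally show ?thesis using True by (simp add: power_conjugator_def bp_uminus)
    qed (simp add: power_conjugator_def)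
  qed
qed

lemma power_conjugator_spin: "power_conjugator r \<circ> x = spin r \<circ> power_conjugator r"
proof
  fix i
  show "(power_conjugator r \<circ> x) i = (spin r \<circ> power_conjugator r) i"
  proof (cases "i \<in> pm n")
    case True
    let ?p = "bp i"
    have p: "?p \<in> P" by (rule bp(1)[OF True])
    have xi: "x i \<in> pm n" using True by (simp add: Bgrp_in_pm[OF x])
    have bx: "bp (x i) = ?p" using bp_funpow[OF True, of 1] by simp
    have "x i = (x ^^ Suc (ix i)) ?p" using bp(2)[OF True] by simp
    then have "[ix (x i) = Suc (ix i)] (mod len ?p)" using ix_x[OF p] by metis
    then have "[r ?p * ix (x i) = r ?p * Suc (ix i)] (mod len ?p)" by (rule cong_scalar_left)
    then have "power_conjugator r (x i) = (x ^^ (r ?p * Suc (ix i))) ?p"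
      using xi by (simp only: power_conjugator_def bx x_eq_iff if_True)
    also have "\<dots> = (x ^^ r ?p) (power_conjugator r i)"
      using True by (simp add: power_conjugator_def funpow_add)
    also have "\<dots> = spin r (power_conjugator r i)"
      using True P_pm[OF p] by (simp add: power_conjugator_def spin_def x_pm bp_x[OF p])
    finally show ?thesis by simp
  qed (simp add: power_conjugator_def spin_def Bgrp_outside[OF x])
qed

lemma orbit_spin:
  assumes r: "\<And>p. p \<in> P \<Longrightarrow> \<exists>c. [c * r p = 1] (mod len p)" and i: "i \<in> pm n"
  shows "orbit (spin r) i = orbit x i"
proof -
  note ps = Bgrp_permutation[OF spin_Bgrp[of r]]
  have pow: "(spin r ^^ m) i = (x ^^ (m * r (bp i))) i" for m
    using i by (simp add: spin_funpow spin_def)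
  obtain c where c: "[c * r (bp i) = 1] (mod len i)" using r[OF bp(1)[OF i]] len_bp[OF i] by auto
  have "(x ^^ a) i = (spin r ^^ (a * c)) i" for a
    using cong_scalar_left[OF c, of a] by (simp add: pow x_eq_iff cong_sym mult.assoc)
  then show ?thesis
    unfolding orbit_altdef_permutation[OF px] orbit_altdef_permutation[OF ps] using pow by auto
qed

text \<open>One inclusion holds because \<open>r\<close> is constant along the cycles permuted by
  the centralizer. For equality it suffices to count: conjugation by
  \<open>power_conjugator r\<close> embeds the larger centralizer into the smaller one.\<close>

lemma centralizer_spin:
  assumes inv: "\<And>z p. z \<in> centralizer (Bgrp n) x \<Longrightarrow> p \<in> P \<Longrightarrow> r (bp (z p)) = r p"
    and cop: "\<And>p. p \<in> P \<Longrightarrow> \<exists>c. [c * r p = 1] (mod len p)"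
  shows "centralizer (Bgrp n) (spin r) = centralizer (Bgrp n) x"
proof -
  let ?g = "power_conjugator r"
  let ?h = "Hilbert_Choice.inv ?g"
  have gB: "?g \<in> carrier (Bgrp n)" by (rule power_conjugator_Bgrp[of r, OF cop])
  note hB = Bgrp_inverse[OF gB]
  note gh = permutes_inverses[OF Bgrp_permutes[OF gB]]
  have sub: "centralizer (Bgrp n) x \<subseteq> centralizer (Bgrp n) (spin r)"
  proof
    fix z assume z: "z \<in> centralizer (Bgrp n) x"
    have "z (spin r i) = spin r (z i)" for i
      using inv[OF z bp(1)[of i]] bp_centralizer[OF z, of i]
      by (auto simp: spin_def centralizer_pm[OF z] centralizer_pow[OF z])
    then show "z \<in> centralizer (Bgrp n) (spin r)"
      using z by (auto simp: in_centralizer_iff)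
  qed
  have fin: "finite (centralizer (Bgrp n) u)" for u using finite_Bgrp by (auto simp: centralizer_def)
  have "(\<lambda>z. ?h \<circ> z \<circ> ?g) ` centralizer (Bgrp n) (spin r) \<subseteq> centralizer (Bgrp n) x"
  proof clarify
    fix z assume z: "z \<in> centralizer (Bgrp n) (spin r)"
    have g1: "?g (x i) = spin r (?g i)" for i using fun_cong[OF power_conjugator_spin] by simp
    have z1: "z (spin r i) = spin r (z i)" for i using z by (auto simp: in_centralizer_iff fun_eq_iff)
    have "?g (?h (z (?g (x i)))) = ?g (x (?h (z (?g i))))" for i
      by (simp add: gh g1 z1)
    then have "?h (z (?g (x i))) = x (?h (z (?g i)))" for i using Bgrp_inj[OF gB] by (meson injD)
    then have "(?h \<circ> z \<circ> ?g) \<circ> x = x \<circ> (?h \<circ> z \<circ> ?g)" by (simp add: fun_eq_iff)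
    moreover have "?h \<circ> z \<circ> ?g \<in> carrier (Bgrp n)"
      using z by (intro Bgrp_compose hB gB) (simp add: in_centralizer_iff)
    ultimately show "?h \<circ> z \<circ> ?g \<in> centralizer (Bgrp n) x" by (simp only: in_centralizer_iff)
  qed
  moreover have "inj_on (\<lambda>z. ?h \<circ> z \<circ> ?g) (centralizer (Bgrp n) (spin r))"
  proof (rule inj_onI)
    fix a b assume eq: "?h \<circ> a \<circ> ?g = ?h \<circ> b \<circ> ?g"
    have "a i = b i" for i
    proof -
      have "?h (a (?g (?h i))) = ?h (b (?g (?h i)))" using fun_cong[OF eq, of "?h i"] by simp
      then show ?thesis using Bgrp_inj[OF hB] by (simp add: gh inj_eq)
    qed
    then show "a = b" by blast
  qed
  ultimately have "card (centralizer (Bgrp n) (spin r)) \<le> card (centralizer (Bgrp n) x)"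
    using card_inj_on_le fin by blast
  then show ?thesis using card_seteq[OF fin sub] by simp
qed

text \<open>Replacing \<open>x\<close> by a conjugate with the same centralizer, in which each signed cycle is
  a power of the one of \<open>x\<close>, turns any choice of faithful characters into \<open>cis (2 * pi / len)\<close>.\<close>

lemma centralizer_character_normalize:
  assumes \<omega>: "centralizer_character n x P \<omega>"
  obtains g x' where "g \<in> carrier (Bgrp n)" "x' \<in> carrier (Bgrp n)" "g \<circ> x = x' \<circ> g"
    "negative_perm n x' P" "centralizer (Bgrp n) x' = centralizer (Bgrp n) x"
    "\<And>z. z \<in> centralizer (Bgrp n) x \<Longrightarrow> \<omega> z = Lie_product n x' z"
proof -
  have lin: "linear_character (Bgrp n) (centralizer (Bgrp n) x) \<omega>"
    and faith: "\<And>p. p \<in> P \<Longrightarrow> inj_on \<omega> (generate (Bgrp n) {signed_cycle x p})"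
    and triv: "\<And>t. t \<in> cycle_complement n x P \<Longrightarrow> \<omega> t = 1"
    using \<omega> by (auto simp: centralizer_character_def)
  \<comment> \<open>The least exponent is a function of the character value and the length alone, so
    it agrees on cycles that the centralizer exchanges.\<close>
  define r where "r p = (LEAST r. \<omega> (signed_cycle x p) ^ r = unit_root (len p))" for p
  have r: "\<omega> (signed_cycle x p) ^ r p = unit_root (len p)" if "p \<in> P" for p
    unfolding r_def using faithful_exponents(1)[OF lin that faith[OF that]] by (rule LeastI_ex)
  have cop: "\<exists>c. [c * r p = 1] (mod len p)" if "p \<in> P" for p
    by (rule faithful_exponents(2)[OF lin that faith[OF that] r[OF that]])
  have inv: "r (bp (z p)) = r p" if z: "z \<in> centralizer (Bgrp n) x" and p: "p \<in> P" for z p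
  proof -
    have "z p \<in> pm n" using P_pm[OF p] centralizer_pm[OF z] by simp
    then show ?thesis
      by (simp add: r_def character_signed_cycle_invariant[OF lin z p] len_bp len_centralizer[OF z])
  qed
  have Z: "centralizer (Bgrp n) (spin r) = centralizer (Bgrp n) x"
    by (rule centralizer_spin) (use inv cop in blast)+
  have orb: "orbit (spin r) i = orbit x i" if "i \<in> pm n" for i by (rule orbit_spin[of r, OF cop that])
  have N: "negative_perm n (spin r) P"
  proof
    show "spin r \<in> carrier (Bgrp n)" by (rule spin_Bgrp)
    show "- i \<in> orbit (spin r) i" if "i \<in> pm n" for i using neg[OF that] orb[OF that] by simp
    have "block (spin r) p = block x p" if "p \<in> P" for p by (simp add: block_def orb[OF P_pm[OF that]])
    then show "base_points n (spin r) P"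
      using base unfolding base_points_def by (metis (no_types, lifting))
  qed
  interpret N: negative_perm n "spin r" P by (rule N)
  have "\<omega> z = Lie_product n (spin r) z" if z: "z \<in> centralizer (Bgrp n) x" for z
  proof -
    have sc: "\<omega> (signed_cycle (spin r) p) = unit_root (card (orbit (spin r) p))" if p: "p \<in> P" for p
    proof -
      have b: "block (spin r) p = orbit x p"
        using N.block_eq_orbit[OF P_pm[OF p]] orb[OF P_pm[OF p]] by simp
      have "signed_cycle (spin r) p = signed_cycle x p ^^ r p"
      proof
        fix i
        show "signed_cycle (spin r) p i = (signed_cycle x p ^^ r p) i"
          unfolding signed_cycle_pow[OF p] by (simp add: signed_cycle_def perm_restrict_def b in_orbit_base_iff[OF p] spin_def)
      qed
      then show ?thesis
        using character_signed_cycle_pow[OF lin p, of "r p"] r[OF p] orb[OF P_pm[OF p]] by simp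
    qed
    have "\<omega> z = (\<Prod>p\<in>P. \<omega> (signed_cycle (spin r) p) ^ base_index (spin r) P (z p))"
      using lin triv z by (intro N.character_eq_prod) (auto simp: Z cycle_complement_def)
    also have "\<dots> = N.cyclo_char z" unfolding N.cyclo_char_def by (rule prod.cong) (simp_all add: sc)
    also have "\<dots> = Lie_product n (spin r) z" using N.Lie_product_eq[of z] z by (simp add: Z)
    finally show ?thesis .
  qed
  then show ?thesis
    using that[OF power_conjugator_Bgrp[of r, OF cop] spin_Bgrp power_conjugator_spin N Z] by blast
qed

end

subsection \<open>Higher Lie characters\<close>

lemma exists_base_points:
  assumes x: "x \<in> carrier (Bgrp n)"
  obtains P where "base_points n x P"
proof
  note px = Bgrp_permutation[OF x] and ox = Bgrp_odd[OF x]
  let ?b = "\<lambda>i. Min (block x i)"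
  have blk: "?b i \<in> block x i" if "i \<in> pm n" for i
    using finite_subset[OF block_subset_pm[OF x that]] self_in_block[OF px, of i] by (intro Min_in) auto
  show "base_points n x (?b ` pm n)"
    unfolding base_points_def
  proof (intro conjI ballI)
    show "?b ` pm n \<subseteq> pm n" using blk block_subset_pm[OF x] by blast
    fix i assume i: "i \<in> pm n"
    show "\<exists>!p. p \<in> ?b ` pm n \<and> i \<in> block x p"
    proof (rule ex1I[of _ "?b i"])
      have "block x (?b i) = block x i" by (rule block_eq_of_mem[of x, OF px ox blk[OF i]])
      then show "?b i \<in> ?b ` pm n \<and> i \<in> block x (?b i)" using i self_in_block[OF px] by simp
      fix q assume q: "q \<in> ?b ` pm n \<and> i \<in> block x q"
      then obtain j where j: "j \<in> pm n" "q = ?b j" by blast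
      have "block x q = block x j" unfolding j(2) by (rule block_eq_of_mem[of x, OF px ox blk[OF j(1)]])
      moreover have "block x i = block x q" using q by (intro block_eq_of_mem[of x, OF px ox]) simp
      ultimately show "q = ?b i" using j(2) by simp
    qed
  qed
qed

lemma conj_classesE:
  assumes "C \<in> conj_classes (Bgrp n)"
  obtains u where "u \<in> carrier (Bgrp n)"
    "C = {g \<circ> u \<circ> Hilbert_Choice.inv g | g. g \<in> carrier (Bgrp n)}"
proof -
  obtain u where u: "u \<in> carrier (Bgrp n)"
    "C = {g \<otimes>\<^bsub>Bgrp n\<^esub> u \<otimes>\<^bsub>Bgrp n\<^esub> inv\<^bsub>Bgrp n\<^esub> g | g. g \<in> carrier (Bgrp n)}"
    using assms by (auto simp: conj_classes_def)
  have "{g \<otimes>\<^bsub>Bgrp n\<^esub> u \<otimes>\<^bsub>Bgrp n\<^esub> inv\<^bsub>Bgrp n\<^esub> g | g. g \<in> carrier (Bgrp n)} =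
      {g \<circ> u \<circ> Hilbert_Choice.inv g | g. g \<in> carrier (Bgrp n)}"
    by (rule Collect_cong) (metis Bgrp_inv Bgrp_mult)
  then show ?thesis using that u by simp
qed

text \<open>Makes an arbitrary member the representative of the class, and states conjugacy as an
  intertwining equation without inverses.\<close>

lemma conj_class_mem_iff:
  assumes C: "C \<in> conj_classes (Bgrp n)" and u: "u \<in> C"
  shows "v \<in> C \<longleftrightarrow> (\<exists>g\<in>carrier (Bgrp n). v \<in> carrier (Bgrp n) \<and> g \<circ> u = v \<circ> g)"
proof -
  obtain w where w: "w \<in> carrier (Bgrp n)"
    "C = {g \<circ> w \<circ> Hilbert_Choice.inv g | g. g \<in> carrier (Bgrp n)}"
    by (rule conj_classesE[OF C])
  have mem: "v \<in> C \<longleftrightarrow> (\<exists>g\<in>carrier (Bgrp n). v \<in> carrier (Bgrp n) \<and> g \<circ> w = v \<circ> g)" for v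
  proof
    assume "v \<in> C"
    then obtain g where g: "g \<in> carrier (Bgrp n)" "v = g \<circ> w \<circ> Hilbert_Choice.inv g" using w(2) by blast
    have "v \<circ> g = g \<circ> w"
      using permutes_inverses[OF Bgrp_permutes[OF g(1)]] by (simp add: g(2) fun_eq_iff)
    moreover have "v \<in> carrier (Bgrp n)"
      unfolding g(2) by (intro Bgrp_compose Bgrp_inverse g(1) w(1))
    ultimately show "\<exists>g\<in>carrier (Bgrp n). v \<in> carrier (Bgrp n) \<and> g \<circ> w = v \<circ> g" using g(1) by metis
  next
    assume "\<exists>g\<in>carrier (Bgrp n). v \<in> carrier (Bgrp n) \<and> g \<circ> w = v \<circ> g"
    then obtain g where g: "g \<in> carrier (Bgrp n)" "g \<circ> w = v \<circ> g" by blast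
    have "v = g \<circ> w \<circ> Hilbert_Choice.inv g"
      unfolding g(2) using permutes_inverses[OF Bgrp_permutes[OF g(1)]] by (simp add: fun_eq_iff)
    then show "v \<in> C" using w(2) g(1) by blast
  qed
  obtain h where h: "h \<in> carrier (Bgrp n)" "h \<circ> w = u \<circ> h" using u mem by blast
  let ?h = "Hilbert_Choice.inv h"
  note hB = Bgrp_inverse[OF h(1)]
  note hh = permutes_inverses[OF Bgrp_permutes[OF h(1)]]
  have hw: "h (w i) = u (h i)" for i using fun_cong[OF h(2)] by simp
  have hu: "w (?h i) = ?h (u i)" for i by (metis hh hw)
  show ?thesis
    unfolding mem
  proof (intro iffI; clarify)
    fix g assume g: "g \<in> carrier (Bgrp n)" "v \<in> carrier (Bgrp n)" "g \<circ> w = v \<circ> g"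
    have "(g \<circ> ?h) \<circ> u = v \<circ> (g \<circ> ?h)" using fun_cong[OF g(3)] by (simp add: fun_eq_iff flip: hu)
    then show "\<exists>g\<in>carrier (Bgrp n). v \<in> carrier (Bgrp n) \<and> g \<circ> u = v \<circ> g"
      using Bgrp_compose[OF g(1) hB] g(2) by blast
  next
    fix g assume g: "g \<in> carrier (Bgrp n)" "v \<in> carrier (Bgrp n)" "g \<circ> u = v \<circ> g"
    have "(g \<circ> h) \<circ> w = v \<circ> (g \<circ> h)" using fun_cong[OF g(3)] by (simp add: fun_eq_iff hw)
    then show "\<exists>g\<in>carrier (Bgrp n). v \<in> carrier (Bgrp n) \<and> g \<circ> w = v \<circ> g"
      using Bgrp_compose[OF g(1) h(1)] g(2) by blast
  qed
qed

lemma conj_class_nonempty: "C \<in> conj_classes (Bgrp n) \<Longrightarrow> C \<noteq> {}"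
  by (erule conj_classesE) (use Bgrp_id in blast)

lemma conj_class_subset:
  assumes "C \<in> conj_classes (Bgrp n)" shows "C \<subseteq> carrier (Bgrp n)"
  using conj_class_mem_iff[OF assms] by blast

lemma exists_conj_class:
  assumes x: "x \<in> carrier (Bgrp n)"
  obtains C where "C \<in> conj_classes (Bgrp n)" "x \<in> C"
proof
  let ?C = "{g \<otimes>\<^bsub>Bgrp n\<^esub> x \<otimes>\<^bsub>Bgrp n\<^esub> inv\<^bsub>Bgrp n\<^esub> g | g. g \<in> carrier (Bgrp n)}"
  show "?C \<in> conj_classes (Bgrp n)" unfolding conj_classes_def using x by blast
  have "x = id \<otimes>\<^bsub>Bgrp n\<^esub> x \<otimes>\<^bsub>Bgrp n\<^esub> inv\<^bsub>Bgrp n\<^esub> id" using Bgrp_id by simp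
  then show "x \<in> ?C" using Bgrp_id by blast
qed

lemma conj_classes_disjoint:
  assumes C: "C \<in> conj_classes (Bgrp n)" and D: "D \<in> conj_classes (Bgrp n)" and "C \<inter> D \<noteq> {}"
  shows "C = D"
proof -
  obtain u where "u \<in> C" "u \<in> D" using assms(3) by blast
  then show ?thesis using conj_class_mem_iff[OF C] conj_class_mem_iff[OF D] by blast
qed

lemma conj_class_power_w0:
  assumes C: "C \<in> conj_classes (Bgrp n)" and u: "u \<in> C" "u ^^ k = w0 n" and v: "v \<in> C"
  shows "v ^^ k = w0 n"
proof -
  obtain g where g: "g \<in> carrier (Bgrp n)" "v \<in> carrier (Bgrp n)" "g \<circ> u = v \<circ> g"
    using v conj_class_mem_iff[OF C u(1)] by blast
  have gu: "g ((u ^^ j) i) = (v ^^ j) (g i)" for i j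
    by (induction j) (use fun_cong[OF g(3)] in auto)
  note hh = permutes_inverses[OF Bgrp_permutes[OF g(1)]]
  have "(v ^^ k) i = w0 n i" for i
  proof -
    have "(v ^^ k) (g (Hilbert_Choice.inv g i)) = g (w0 n (Hilbert_Choice.inv g i))"
      by (simp only: u(2)[symmetric] gu)
    also have "\<dots> = w0 n (g (Hilbert_Choice.inv g i))" using fun_cong[OF w0_comm[OF g(1)]] by simp
    finally show ?thesis by (simp add: hh)
  qed
  then show ?thesis by blast
qed

lemma w0_root_negative:
  assumes "x \<in> carrier (Bgrp n)" "x ^^ k = w0 n" "i \<in> pm n" shows "- i \<in> orbit x i"
proof -
  have "(x ^^ k) i = - i" using assms(2,3) by (simp add: w0_def)
  then show ?thesis by (metis in_orbit_iff[OF Bgrp_permutation[OF assms(1)]])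
qed

text \<open>The group elements are sorted by u = g^-1 x g. Membership of g y g^-1 in the centralizer
  of x means that u commutes with y, and each fibre is a coset of the centralizer of x, whose size
  cancels the denominator.\<close>

lemma induced_character_conjugates:
  assumes C: "C \<in> conj_classes (Bgrp n)" and x: "x \<in> C" and y: "y \<in> carrier (Bgrp n)"
    and F: "\<And>g. g \<in> carrier (Bgrp n) \<Longrightarrow> g \<circ> y \<circ> Hilbert_Choice.inv g \<in> centralizer (Bgrp n) x \<Longrightarrow>
      \<omega> (g \<circ> y \<circ> Hilbert_Choice.inv g) = F (Hilbert_Choice.inv g \<circ> x \<circ> g)"
  shows "induced_character (Bgrp n) (centralizer (Bgrp n) x) \<omega> y = (\<Sum>u\<in>C \<inter> centralizer (Bgrp n) y. F u)"
proof -
  let ?Z = "centralizer (Bgrp n) x"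
  let ?inv = "Hilbert_Choice.inv :: (int \<Rightarrow> int) \<Rightarrow> int \<Rightarrow> int"
  let ?G = "{g \<in> carrier (Bgrp n). g \<circ> y \<circ> ?inv g \<in> ?Z}"
  let ?f = "\<lambda>g. ?inv g \<circ> x \<circ> g"
  have xB: "x \<in> carrier (Bgrp n)" using x conj_class_subset[OF C] by blast
  have finG: "finite ?G" and finZ: "finite ?Z" using finite_Bgrp by (auto simp: centralizer_def)
  have cancel: "g (?inv g i) = i" "?inv g (g i) = i" if "g \<in> carrier (Bgrp n)" for g i
    using permutes_inverses[OF Bgrp_permutes[OF that]] by auto
  have fB: "?f g \<in> carrier (Bgrp n)" if "g \<in> carrier (Bgrp n)" for g
    using that by (intro Bgrp_compose Bgrp_inverse xB)
  have fC: "?f g \<in> C" if g: "g \<in> carrier (Bgrp n)" for g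
  proof -
    have "?inv g \<circ> x = ?f g \<circ> ?inv g" by (simp add: fun_eq_iff cancel[OF g])
    then show ?thesis unfolding conj_class_mem_iff[OF C x] using Bgrp_inverse[OF g] fB[OF g] by blast
  qed
  have G_iff: "g \<in> ?G \<longleftrightarrow> ?f g \<in> centralizer (Bgrp n) y" if g: "g \<in> carrier (Bgrp n)" for g
  proof -
    have gyB: "g \<circ> y \<circ> ?inv g \<in> carrier (Bgrp n)" by (intro Bgrp_compose Bgrp_inverse g y)
    have "(\<forall>i. g (y (?inv g (x i))) = x (g (y (?inv g i)))) \<longleftrightarrow>
        (\<forall>i. ?inv g (x (g (y i))) = y (?inv g (x (g i))))"
      using cancel[OF g] by metis
    then show ?thesis using g gyB fB[OF g] by (simp add: in_centralizer_iff fun_eq_iff)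
  qed
  have img: "?f ` ?G = C \<inter> centralizer (Bgrp n) y"
  proof (intro equalityI subsetI)
    fix u assume "u \<in> ?f ` ?G"
    then obtain g where "g \<in> ?G" "u = ?f g" by blast
    then show "u \<in> C \<inter> centralizer (Bgrp n) y" using fC G_iff by blast
  next
    fix u assume u: "u \<in> C \<inter> centralizer (Bgrp n) y"
    then obtain h where h: "h \<in> carrier (Bgrp n)" "u \<in> carrier (Bgrp n)" "h \<circ> x = u \<circ> h"
      using conj_class_mem_iff[OF C x] by blast
    let ?g = "?inv h"
    have gB: "?g \<in> carrier (Bgrp n)" by (rule Bgrp_inverse[OF h(1)])
    have "?inv ?g = h" using permutes_inv_inv[OF Bgrp_permutes[OF h(1)]] .
    then have "u = ?f ?g" using fun_cong[OF h(3)] by (simp add: fun_eq_iff cancel[OF h(1)])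
    then show "u \<in> ?f ` ?G" using u G_iff[OF gB] by blast
  qed
  have fibre: "card {g \<in> ?G. ?f g = u} = card ?Z" if u: "u \<in> ?f ` ?G" for u
  proof -
    obtain g0 where g0: "g0 \<in> carrier (Bgrp n)" "g0 \<in> ?G" "u = ?f g0" using u by blast
    have xg: "?f g = ?f g0 \<longleftrightarrow> g \<circ> ?inv g0 \<in> ?Z" if g: "g \<in> carrier (Bgrp n)" for g
    proof -
      have gB: "g \<circ> ?inv g0 \<in> carrier (Bgrp n)" by (intro Bgrp_compose Bgrp_inverse g g0(1))
      have "(\<forall>i. ?inv g (x (g i)) = ?inv g0 (x (g0 i))) \<longleftrightarrow>
        (\<forall>i. g (?inv g0 (x i)) = x (g (?inv g0 i)))"
        using cancel[OF g] cancel[OF g0(1)] by metis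
      then show ?thesis using gB by (simp add: in_centralizer_iff fun_eq_iff)
    qed
    have "bij_betw (\<lambda>g. g \<circ> ?inv g0) {g \<in> ?G. ?f g = u} ?Z"
    proof (rule bij_betwI[where g = "\<lambda>z. z \<circ> g0"])
      show "(\<lambda>g. g \<circ> ?inv g0) \<in> {g \<in> ?G. ?f g = u} \<rightarrow> ?Z"
        using xg g0(3) by auto
      show "(\<lambda>z. z \<circ> g0) \<in> ?Z \<rightarrow> {g \<in> ?G. ?f g = u}"
      proof
        fix z assume z: "z \<in> ?Z"
        have zg: "z \<circ> g0 \<in> carrier (Bgrp n)" using z g0(1) by (auto simp: in_centralizer_iff intro: Bgrp_compose)
        have "(z \<circ> g0) \<circ> ?inv g0 = z" by (simp add: fun_eq_iff cancel[OF g0(1)])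
        then have fz: "?f (z \<circ> g0) = u" using xg[OF zg] z g0(3) by simp
        then have "z \<circ> g0 \<in> ?G" using G_iff[OF zg] G_iff[OF g0(1)] g0(2,3) by simp
        then show "z \<circ> g0 \<in> {g \<in> ?G. ?f g = u}" using fz by blast
      qed
    qed (simp_all add: fun_eq_iff cancel[OF g0(1)])
    then show ?thesis by (rule bij_betw_same_card)
  qed
  have "induced_character (Bgrp n) ?Z \<omega> y = (\<Sum>g\<in>?G. \<omega> (g \<circ> y \<circ> ?inv g)) / of_nat (card ?Z)"
    unfolding induced_character_def
    by (rule arg_cong2[of _ _ _ _ "(/)"]) (auto intro!: sum.cong)
  also have "(\<Sum>g\<in>?G. \<omega> (g \<circ> y \<circ> ?inv g)) = (\<Sum>g\<in>?G. F (?f g))"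
    using F by (intro sum.cong) auto
  also have "\<dots> = (\<Sum>u\<in>?f ` ?G. \<Sum>g | g \<in> ?G \<and> ?f g = u. F (?f g))"
    by (rule sum.image_gen[OF finG])
  also have "\<dots> = (\<Sum>u\<in>?f ` ?G. of_nat (card ?Z) * F u)"
  proof (rule sum.cong[OF refl])
    fix u assume u: "u \<in> ?f ` ?G"
    have "(\<Sum>g | g \<in> ?G \<and> ?f g = u. F (?f g)) = (\<Sum>g | g \<in> ?G \<and> ?f g = u. F u)"
      by (rule sum.cong) auto
    then show "(\<Sum>g | g \<in> ?G \<and> ?f g = u. F (?f g)) = of_nat (card ?Z) * F u"
      using fibre[OF u] by simp
  qed
  also have "\<dots> / of_nat (card ?Z) = (\<Sum>u\<in>?f ` ?G. F u)"
  proof -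
    have "id \<in> ?Z" by (simp add: in_centralizer_iff Bgrp_id)
    then have "card ?Z \<noteq> 0" using finZ by (auto simp: card_eq_0_iff)
    then show ?thesis by (simp flip: sum_distrib_left)
  qed
  finally show ?thesis unfolding img .
qed

text \<open>The choice operator conceals x, the base points and the character. Once an admissible
  triple is known to exist, the selected one is normalized: a conjugate x' in the same class has the
  same centralizer and the character becomes \<open>Lie_product n x'\<close>, so the sum over the
  class retains no trace of the choice.\<close>

lemma higher_Lie_character_eq:
  assumes C: "C \<in> conj_classes (Bgrp n)" and w: "\<And>x. x \<in> C \<Longrightarrow> x ^^ k = w0 n"
    and y: "y \<in> carrier (Bgrp n)"
  shows "higher_Lie_character n C y = (\<Sum>u\<in>C \<inter> centralizer (Bgrp n) y. Lie_product n u y)"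
proof -
  have CB: "C \<subseteq> carrier (Bgrp n)" by (rule conj_class_subset[OF C])
  have np: "negative_perm n x P" if "x \<in> C" "base_points n x P" for x P
    unfolding negative_perm_def using that CB w0_root_negative[OF _ w[OF that(1)]] by blast
  let ?Q = "\<lambda>\<psi>. \<exists>x\<in>C. \<exists>P \<omega>. base_points n x P \<and> centralizer_character n x P \<omega> \<and>
        \<psi> = induced_character (Bgrp n) (centralizer (Bgrp n) x) \<omega>"
  obtain x where x: "x \<in> C" using conj_class_nonempty[OF C] by blast
  obtain P where P: "base_points n x P" using exists_base_points CB x by blast
  have "\<exists>\<psi>. ?Q \<psi>"
    using x P negative_perm.cyclo_char_centralizer_character[OF np[OF x P]] by blast
  then have "?Q (higher_Lie_character n C)" unfolding higher_Lie_character_def by (rule someI_ex)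
  then obtain x P \<omega> where x: "x \<in> C" and P: "base_points n x P" and \<omega>: "centralizer_character n x P \<omega>"
    and \<psi>: "higher_Lie_character n C = induced_character (Bgrp n) (centralizer (Bgrp n) x) \<omega>"
    by blast
  obtain g x' where g: "g \<in> carrier (Bgrp n)" "x' \<in> carrier (Bgrp n)" "g \<circ> x = x' \<circ> g"
    and N: "negative_perm n x' P" and Z: "centralizer (Bgrp n) x' = centralizer (Bgrp n) x"
    and \<omega>': "\<And>z. z \<in> centralizer (Bgrp n) x \<Longrightarrow> \<omega> z = Lie_product n x' z"
    by (rule negative_perm.centralizer_character_normalize[OF np[OF x P] \<omega>]) blast
  have x': "x' \<in> C" unfolding conj_class_mem_iff[OF C x] using g by blast
  show ?thesis
    unfolding \<psi> Z[symmetric]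
  proof (rule induced_character_conjugates[OF C x' y])
    fix g assume g: "g \<in> carrier (Bgrp n)"
      and z: "g \<circ> y \<circ> Hilbert_Choice.inv g \<in> centralizer (Bgrp n) x'"
    show "\<omega> (g \<circ> y \<circ> Hilbert_Choice.inv g) = Lie_product n (Hilbert_Choice.inv g \<circ> x' \<circ> g) y"
      unfolding \<omega>'[OF z[unfolded Z]] by (rule negative_perm.Lie_product_conjugate(1)[OF N g y z])
  qed
qed

theorem theorem6p6:
  fixes k :: int and n :: nat
  shows "\<forall>y\<in>carrier (Bgrp n).
    sroots n k y =
      (\<Sum>C\<in>{C \<in> conj_classes (Bgrp n). (\<lambda>x. x [^]\<^bsub>Bgrp n\<^esub> k) ` C = {w0 n}}.
         higher_Lie_character n C y)"
proof
  fix y assume y: "y \<in> carrier (Bgrp n)"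
  obtain m where "m > 0" and m: "\<And>x. x \<in> carrier (Bgrp n) \<Longrightarrow> x [^]\<^bsub>Bgrp n\<^esub> k = x ^^ m"
    by (rule Bgrp_int_pow[of n k]) blast
  let ?CC = "{C \<in> conj_classes (Bgrp n). (\<lambda>x. x [^]\<^bsub>Bgrp n\<^esub> k) ` C = {w0 n}}"
  let ?Z = "centralizer (Bgrp n) y"
  have CCD: "C \<in> conj_classes (Bgrp n)" "\<And>x. x \<in> C \<Longrightarrow> x ^^ m = w0 n" if C: "C \<in> ?CC" for C
  proof -
    show cl: "C \<in> conj_classes (Bgrp n)" using C by simp
    fix x assume x: "x \<in> C"
    then have "x [^]\<^bsub>Bgrp n\<^esub> k = w0 n" using C by auto
    then show "x ^^ m = w0 n" using m conj_class_subset[OF cl] x by auto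
  qed
  have CCI: "C \<in> ?CC" if C: "C \<in> conj_classes (Bgrp n)" and x: "x \<in> C" "x ^^ m = w0 n" for C x
  proof -
    have "v [^]\<^bsub>Bgrp n\<^esub> k = w0 n" if "v \<in> C" for v
      using conj_class_power_w0[OF C x that] m conj_class_subset[OF C] that by auto
    then show ?thesis using C x(1) by auto
  qed
  have "?CC \<subseteq> Pow (carrier (Bgrp n))" using conj_class_subset by blast
  then have fin: "finite ?CC" using finite_Bgrp finite_subset by blast
  have finZ: "finite ?Z" using finite_Bgrp by (auto simp: centralizer_def)
  \<comment> \<open>One element with m-th power \<open>w0 n\<close> puts its whole class into
    \<open>?CC\<close>, because \<open>w0 n\<close> is central.\<close>
  have union: "{x. x \<in> ?Z \<and> x ^^ m = w0 n} = (\<Union>C\<in>?CC. C \<inter> ?Z)"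
  proof (intro equalityI subsetI)
    fix x assume x: "x \<in> {x. x \<in> ?Z \<and> x ^^ m = w0 n}"
    then have "x \<in> carrier (Bgrp n)" by (simp add: in_centralizer_iff)
    then obtain C where "C \<in> conj_classes (Bgrp n)" "x \<in> C" by (rule exists_conj_class)
    then show "x \<in> (\<Union>C\<in>?CC. C \<inter> ?Z)" using x CCI by blast
  qed (use CCD in blast)
  have "sroots n k y = (\<Sum>x | x \<in> carrier (Bgrp n) \<and> x ^^ m = y. chi n x)"
    unfolding sroots_def by (rule sum.cong) (auto simp: m)
  also have "\<dots> = (\<Sum>x | x \<in> ?Z \<and> x ^^ m = w0 n. Lie_product n x y)"
    by (rule sum_Lie_product[OF y, symmetric])
  also have "\<dots> = (\<Sum>C\<in>?CC. \<Sum>x\<in>C \<inter> ?Z. Lie_product n x y)"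
    unfolding union
  proof (rule sum.UNION_disjoint[OF fin])
    show "\<forall>C\<in>?CC. \<forall>D\<in>?CC. C \<noteq> D \<longrightarrow> (C \<inter> ?Z) \<inter> (D \<inter> ?Z) = {}"
      using conj_classes_disjoint CCD(1) by blast
  qed (use finZ in simp)
  also have "\<dots> = (\<Sum>C\<in>?CC. higher_Lie_character n C y)"
    using higher_Lie_character_eq[OF CCD(1) CCD(2) y] by (intro sum.cong) auto
  finally show "sroots n k y = (\<Sum>C\<in>?CC. higher_Lie_character n C y)" .
qed

end
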